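(* Consider the delay-coupled network $$\dot x_j(t)=F_j(x_j(t))+\varepsilon\sum_{k=1}^m G_{j,k}\big(x_j(t),x_k(t-\tau_{j,k})\big),\qquad 1\le j\le m,$$ satisfying the standing assumptions in the context. Its conjugacy equations can be solved to arbitrary precision in $\varepsilon$. That is, for every $\mathcal L\in\mathbb N$ there exist smooth maps $$f^{(\ell)}:\mathbb T^m\to\mathbb R^m,\quad e^{(\ell)}:\mathbb T^m\to\mathbb R^n,\quad E^{(\ell)}:\mathbb T^m\times[-\tau,0]\to\mathbb R^n,\qquad 0\le \ell\le\mathcal L,$$ with $f^{(0)}\equiv(\omega_1,\dots,\omega_m)$, $e^{(0)}_j(\phi)=\Gamma_j(\phi_j/\omega_j)$ and $E^{(0)}_j(\phi,s)=\Gamma_j(\phi_j/\omega_j+s)$ (so that $e^{(0)}$ parametrizes the invariant torus $\Gamma_1\times\dots\times\Gamma_m$ of the uncoupled system), such that the truncated expansions $$f=\sum_{\ell=0}^{\mathcal L}\varepsilon^\ell f^{(\ell)},\qquad e=\sum_{\ell=0}^{\mathcal L}\varepsilon^\ell e^{(\ell)},\qquad E=\sum_{\ell=0}^{\mathcal L}\varepsilon^\ell E^{(\ell)}$$ satisfy $e(\phi)=E(\phi,0)$ for all $\phi\in\mathbb T^m$ and, as $\varepsilon\to0$, uniformly in $\phi\in\mathbb T^m$ and $s\in[-\tau,0]$ and for all $1\le j\le m$, $$\partial_\phi e_j(\phi)\cdot f(\phi)=F_j(e_j(\phi))+\varepsilon\sum_{k=1}^mG_{j,k}\big(e_j(\phi),E_k(\phi,-\tau_{j,k})\big)+\mathcal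 O(\varepsilon^{\mathcal L+1}),$$ $$\partial_\phi E_j(\phi,s)\cdot f(\phi)=\partial_sE_j(\phi,s)+\mathcal O(\varepsilon^{\mathcal L+1}).$$ In particular, this yields the phase dynamics $\dot\phi=f^{(\varepsilon)}(\phi)$ on the invariant torus up to arbitrary order in $\varepsilon$, in the sense that it is given to order $\mathcal L$ by $\dot\phi=\sum_{\ell=0}^{\mathcal L}\varepsilon^\ell f^{(\ell)}(\phi)$.
   Context: $\mathbb T^m=(\mathbb R/2\pi\mathbb Z)^m$. Here $x_j\in\mathbb R^{n_j}$, $n=n_1+\dots+n_m$, $F_j:\mathbb R^{n_j}\to\mathbb R^{n_j}$ and $G_{j,k}:\mathbb R^{n_j}\times\mathbb R^{n_k}\to\mathbb R^{n_j}$ are smooth, $\tau_{j,k}>0$ are delays, $\tau=\max_{j,k}\tau_{j,k}$, and $|\varepsilon|\ll1$ is the coupling strength. The subindex $j$ of a map into $\mathbb R^n=\mathbb R^{n_1}\times\dots\times\mathbb R^{n_m}$ denotes its $\mathbb R^{n_j}$-component. Standing assumption: for each $j$, the ODE $\dot x_j=F_j(x_j)$ has a (nonconstant) periodic solution $\Gamma_j(t)$ of period $T_j>0$ whose orbit is normally hyperbolic, i.e. its trivial Floquet multiplier $1$ is algebraically simple and it has no other Floquet multipliers on the unit circle. Put $\omega_j=2\pi/T_j$. The conjugacy equations for maps $f^{(\varepsilon)}:\mathbb T^m\to\mathbb R^m$, $e^{(\varepsilon)}:\mathbb T^m\to\mathbb R^n$, $E^{(\varepsilon)}:\mathbb T^m\times[-\tau,0]\to\mathbb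 R^n$ are $$\partial_\phi e^{(\varepsilon)}_j(\phi)\cdot f^{(\varepsilon)}(\phi)=F_j(e^{(\varepsilon)}_j(\phi))+\varepsilon\sum_kG_{j,k}(e^{(\varepsilon)}_j(\phi),E^{(\varepsilon)}_k(\phi,-\tau_{j,k})),\qquad \partial_\phi E^{(\varepsilon)}_j(\phi,s)\cdot f^{(\varepsilon)}(\phi)=\partial_sE^{(\varepsilon)}_j(\phi,s),$$ together with the boundary condition $e^{(\varepsilon)}(\phi)=E^{(\varepsilon)}(\phi,0)$. They express that $\phi\mapsto(e^{(\varepsilon)}(\phi),E^{(\varepsilon)}(\phi,\cdot))$ maps solutions of $\dot\phi=f^{(\varepsilon)}(\phi)$ to (state, history) pairs of solutions of the delay equation. *)

theory Defs
  imports "HOL-Analysis.Analysis" "HOL-Computational_Algebra.Polynomial"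
begin

text \<open>
  The phase space \<open>\<real>\<^sup>n = \<real>\<^sup>n\<^sup>1 \<times> \<dots> \<times> \<real>\<^sup>n\<^sup>m\<close> is the type \<^typ>\<open>real^'n\<close> together with a map
  \<open>c :: 'n \<Rightarrow> 'm\<close> that assigns to every coordinate the oscillator it belongs to. The factor
  with index \<open>j\<close> has dimension \<open>card {i. c i = j}\<close>, and the dimensions of the factors
  are arbitrary. It is identified with the coordinate subspace \<open>factor c j\<close>; a map between
  factors is a function on \<^typ>\<open>real^'n\<close> of which only the values on the factors matter.
\<close>

definition factor :: "('n::finite \<Rightarrow> 'm) \<Rightarrow> 'm \<Rightarrow> (real^'n) set" where
  "factor c j = {x. \<forall>i. c i \<noteq> j \<longrightarrow> x $ i = 0}"

definition blk :: "('n::finite \<Rightarrow> 'm) \<Rightarrow> 'm \<Rightarrow> real^'n \<Rightarrow> real^'n" where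
  "blk c j x = (\<chi> i. if c i = j then x $ i else 0)"

text \<open>
  \<open>C\<^sup>k\<close> and smooth maps. Derivatives are taken within \<open>S\<close>, so that they are one-sided at the
  ends of the history interval. This is meant for sets \<open>S\<close> in which derivatives are unique;
  it is used for the whole space and for \<open>UNIV \<times> {-\<tau>..0}\<close> with \<open>\<tau> > 0\<close>.
\<close>

primrec Ck_on :: "nat \<Rightarrow> 'a::euclidean_space set \<Rightarrow> ('a \<Rightarrow> 'b::real_normed_vector) \<Rightarrow> bool" where
  "Ck_on 0 S f \<longleftrightarrow> continuous_on S f"
| "Ck_on (Suc k) S f \<longleftrightarrow>
     (\<exists>f'. (\<forall>x\<in>S. (f has_derivative f' x) (at x within S)) \<and> (\<forall>v. Ck_on k S (\<lambda>x. f' x v)))"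

definition smooth_on :: "'a::euclidean_space set \<Rightarrow> ('a \<Rightarrow> 'b::real_normed_vector) \<Rightarrow> bool" where
  "smooth_on S f \<longleftrightarrow> (\<forall>k. Ck_on k S f)"

text \<open>Maps on the torus \<open>(\<real>/2\<pi>\<int>)\<^sup>m\<close> are represented by their periodic lifts.\<close>

definition torus_map :: "(real^'m::finite \<Rightarrow> 'b) \<Rightarrow> bool" where
  "torus_map u \<longleftrightarrow> (\<forall>\<phi> j. u (\<phi> + axis j (2 * pi)) = u \<phi>)"

definition nonconstant_periodic_solution ::
  "('n::finite \<Rightarrow> 'm) \<Rightarrow> 'm \<Rightarrow> (real^'n \<Rightarrow> real^'n) \<Rightarrow> real \<Rightarrow> (real \<Rightarrow> real^'n) \<Rightarrow> bool" where
  "nonconstant_periodic_solution c j Fj Tj \<gamma> \<longleftrightarrow>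
     0 < Tj \<and>
     (\<forall>t. \<gamma> t \<in> factor c j) \<and>
     (\<forall>t. (\<gamma> has_vector_derivative Fj (\<gamma> t)) (at t)) \<and>
     (\<forall>t. \<gamma> (t + Tj) = \<gamma> t) \<and>
     (\<exists>s t. \<gamma> s \<noteq> \<gamma> t)"

definition principal_fundamental_solution ::
  "(real \<Rightarrow> real^'n^'n) \<Rightarrow> (real \<Rightarrow> real^'n^'n::finite) \<Rightarrow> bool" where
  "principal_fundamental_solution A \<Phi> \<longleftrightarrow>
     \<Phi> 0 = mat 1 \<and> (\<forall>t. (\<Phi> has_vector_derivative A t ** \<Phi> t) (at t))"

text \<open>
  The Jacobian matrix of \<open>Fj\<close>, extended by zero from the factor to all of \<^typ>\<open>real^'n\<close>.
\<close>

definition jacobian_blk ::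
  "('n::finite \<Rightarrow> 'm) \<Rightarrow> 'm \<Rightarrow> (real^'n \<Rightarrow> real^'n) \<Rightarrow> real^'n \<Rightarrow> real^'n^'n" where
  "jacobian_blk c j Fj x = matrix (frechet_derivative (\<lambda>y. Fj (blk c j y)) (at x))"

text \<open>
  The characteristic polynomial \<open>det (z I - M\<^sub>j\<^sub>j)\<close> of the diagonal block of \<open>M\<close> with index \<open>j\<close>:
  the block is completed by an identity matrix on the remaining coordinates, which does
  not change the determinant.
\<close>

definition charpoly_blk :: "('n::finite \<Rightarrow> 'm) \<Rightarrow> 'm \<Rightarrow> real^'n^'n \<Rightarrow> complex poly" where
  "charpoly_blk c j M =
     det (\<chi> i i'. if c i = j \<and> c i' = j
                  then (if i = i' then [:0, 1:] else 0) - [:complex_of_real (M $ i $ i'):]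
                  else if i = i' then 1 else 0)"

text \<open>
  The Floquet multipliers of \<open>\<gamma>\<close> are the eigenvalues of the monodromy matrix \<open>\<Phi> Tj\<close> of the
  linearization along \<open>\<gamma>\<close>, restricted to the factor (\<open>\<Phi>\<close> exists and is unique).
\<close>

definition normally_hyperbolic ::
  "('n::finite \<Rightarrow> 'm) \<Rightarrow> 'm \<Rightarrow> (real^'n \<Rightarrow> real^'n) \<Rightarrow> real \<Rightarrow> (real \<Rightarrow> real^'n) \<Rightarrow> bool" where
  "normally_hyperbolic c j Fj Tj \<gamma> \<longleftrightarrow>
     (\<exists>\<Phi>. principal_fundamental_solution (\<lambda>t. jacobian_blk c j Fj (\<gamma> t)) \<Phi> \<and>
          order 1 (charpoly_blk c j (\<Phi> Tj)) = 1 \<and>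
          (\<forall>\<mu>. poly (charpoly_blk c j (\<Phi> Tj)) \<mu> = 0 \<and> cmod \<mu> = 1 \<longrightarrow> \<mu> = 1))"

definition freq :: "('m::finite \<Rightarrow> real) \<Rightarrow> real^'m" where
  "freq T = (\<chi> j. 2 * pi / T j)"

definition max_delay :: "('m::finite \<Rightarrow> 'm \<Rightarrow> real) \<Rightarrow> real" where
  "max_delay \<tau> = Max (range (\<lambda>(j, k). \<tau> j k))"

definition trunc :: "nat \<Rightarrow> real \<Rightarrow> (nat \<Rightarrow> 'a \<Rightarrow> 'b::real_vector) \<Rightarrow> 'a \<Rightarrow> 'b" where
  "trunc L \<epsilon> u x = (\<Sum>l\<le>L. \<epsilon> ^ l *\<^sub>R u l x)"

text \<open>
  \<open>r \<epsilon> x = O(\<epsilon>\<^sup>p)\<close> as \<open>\<epsilon> \<rightarrow> 0\<close>, uniformly in \<open>x \<in> A \<epsilon>\<close>.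
\<close>

definition uniform_bigo ::
  "nat \<Rightarrow> (real \<Rightarrow> 'a set) \<Rightarrow> (real \<Rightarrow> 'a \<Rightarrow> 'b::real_normed_vector) \<Rightarrow> bool" where
  "uniform_bigo p A r \<longleftrightarrow>
     (\<exists>C. \<forall>\<^sub>F \<epsilon> in nhds 0. \<forall>x\<in>A \<epsilon>. norm (r \<epsilon> x) \<le> C * \<bar>\<epsilon>\<bar> ^ p)"

text \<open>The vector field with index \<open>j\<close>, evaluated at a state \<open>x\<close> and delayed states \<open>y k\<close>.\<close>

definition network_rhs ::
  "('n::finite \<Rightarrow> 'm::finite) \<Rightarrow> ('m \<Rightarrow> real^'n \<Rightarrow> real^'n) \<Rightarrow>
   ('m \<Rightarrow> 'm \<Rightarrow> real^'n \<Rightarrow> real^'n \<Rightarrow> real^'n) \<Rightarrow> real \<Rightarrow> 'm \<Rightarrow> real^'n \<Rightarrow> ('m \<Rightarrow> real^'n) \<Rightarrow> real^'n" where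
  "network_rhs c F G \<epsilon> j x y =
     F j (blk c j x) + \<epsilon> *\<^sub>R (\<Sum>k\<in>UNIV. G j k (blk c j x) (blk c k (y k)))"

text \<open>All global solutions of \<open>\<phi>' = v(\<phi>)\<close>, paired with all times.\<close>

definition trajectories :: "(real^'m::finite \<Rightarrow> real^'m) \<Rightarrow> ((real \<Rightarrow> real^'m) \<times> real) set" where
  "trajectories v = {(\<phi>, t). \<forall>s. (\<phi> has_vector_derivative v (\<phi> s)) (at s)}"

end

(* The conjugacy equations are solved order by order in epsilon. If the truncated expansions
   satisfy them up to epsilon^(L+1) rho, with rho smooth in epsilon and phi, then adding terms of
   order L+1 leads to linear equations for these terms. The one for the history E is a transport
   equation. The one for the state e splits into the m equations
     (d_omega - DF_j(Gamma_j)) e_j + Gamma_j' a_j = g_j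
   on the torus, in which the phase correction a_j absorbs the tangential part of g_j. The operator
   on the left commutes with the shift S by one period T_j omega and with the propagator U over one
   period, and it divides p(S) - p(U) for every polynomial p. Normal hyperbolicity provides a p
   without zeros on the unit circle for which p(U) maps into the tangent direction. Then p(S) is a
   product of factors S - mu with |mu| different from 1 and is inverted by Neumann series. These
   series, like all other solution operators used here, commute with directional derivatives up to
   smooth coefficients, which gives smoothness. *)

theory Submission
  imports Defs "HOL-Computational_Algebra.Fundamental_Theorem_Algebra"
begin

section \<open>Smooth maps\<close>

text \<open>The obstacle is small divisors. The shift \<open>S\<close> rotates the phases of the
  other oscillators, and for arbitrary frequencies the operator \<open>S - \<mu>\<close> with
  |\<mu>| = 1 may have no inverse on smooth functions. The multiplier 1 cannot be avoided, but it is
  simple, so what it contributes is tangential. The phase correction a_j takes up this contribution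
  entirely, not only its resonant part, and no factor with |\<mu>| = 1 has to be inverted. Since
  \<open>S\<close> and \<open>U\<close> enter only through a polynomial, which can be taken real,
  the solution stays real and lives on the original torus. The residuals are carried along as exact
  multiples of \<epsilon>^(L+1), with cofactors that are smooth in all variables jointly. The
  equations of the next order are then read off from the cofactors at \<epsilon> = 0, and one power
  of \<epsilon> is gained by Hadamard division instead of by Taylor coefficients of the compositions
  with F and G.\<close>

abbreviation smooth :: "('a::euclidean_space \<Rightarrow> 'b::real_normed_vector) \<Rightarrow> bool" where
  "smooth f \<equiv> smooth_on UNIV f"

abbreviation D :: "('a::euclidean_space \<Rightarrow> 'b::real_normed_vector) \<Rightarrow> 'a \<Rightarrow> 'a \<Rightarrow> 'b" where
  "D f x \<equiv> frechet_derivative f (at x)"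

lemma Ck_on_mono: "Ck_on (Suc k) S f \<Longrightarrow> Ck_on k S f"
proof (induction k arbitrary: f)
  case 0
  then show ?case
    by (auto simp: continuous_on_eq_continuous_within intro: has_derivative_continuous)
next
  case (Suc k)
  then show ?case by (metis Ck_on.simps(2))
qed

lemma Ck_on_subset: "Ck_on k S f \<Longrightarrow> S' \<subseteq> S \<Longrightarrow> Ck_on k S' f"
proof (induction k arbitrary: f)
  case 0
  then show ?case using continuous_on_subset by auto
next
  case (Suc k)
  then obtain f' where "\<forall>x\<in>S. (f has_derivative f' x) (at x within S)" "\<forall>v. Ck_on k S (\<lambda>x. f' x v)"
    by auto
  with Suc show ?case
    by (auto intro!: exI[of _ f'] intro: has_derivative_subset)
qed

lemma smooth_on_subset: "smooth_on S f \<Longrightarrow> S' \<subseteq> S \<Longrightarrow> smooth_on S' f"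
  unfolding smooth_on_def using Ck_on_subset by blast

lemma Ck_on_bounded_linear:
  assumes "bounded_linear h"
  shows "Ck_on k S f \<Longrightarrow> Ck_on k S (\<lambda>x. h (f x))"
proof (induction k arbitrary: f)
  case 0
  then show ?case using bounded_linear.continuous_on[OF assms] by auto
next
  case (Suc k)
  then obtain f' where "\<forall>x\<in>S. (f has_derivative f' x) (at x within S)" "\<forall>v. Ck_on k S (\<lambda>x. f' x v)"
    by auto
  with Suc.IH show ?case
    by (auto intro!: exI[of _ "\<lambda>x v. h (f' x v)"] bounded_linear.has_derivative[OF assms])
qed

lemma Ck_on_const: "Ck_on k S (\<lambda>x. a)"
  by (induction k arbitrary: a) (auto intro!: exI[of _ "\<lambda>x v. 0"])

lemma Ck_on_add: "Ck_on k S f \<Longrightarrow> Ck_on k S g \<Longrightarrow> Ck_on k S (\<lambda>x. f x + g x)"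
proof (induction k arbitrary: f g)
  case 0
  then show ?case by (auto intro: continuous_on_add)
next
  case (Suc k)
  then obtain f' g' where
    "\<forall>x\<in>S. (f has_derivative f' x) (at x within S)" "\<forall>v. Ck_on k S (\<lambda>x. f' x v)"
    "\<forall>x\<in>S. (g has_derivative g' x) (at x within S)" "\<forall>v. Ck_on k S (\<lambda>x. g' x v)"
    by auto
  with Suc.IH show ?case
    by (auto intro!: exI[of _ "\<lambda>x v. f' x v + g' x v"] has_derivative_add)
qed

lemma Ck_on_sum:
  "(\<And>i. i \<in> I \<Longrightarrow> Ck_on k S (f i)) \<Longrightarrow> Ck_on k S (\<lambda>x. \<Sum>i\<in>I. f i x)"
  by (induction I rule: infinite_finite_induct) (simp_all add: Ck_on_const Ck_on_add)

lemma Ck_on_bilinear: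
  assumes "bounded_bilinear h"
  shows "Ck_on k S f \<Longrightarrow> Ck_on k S g \<Longrightarrow> Ck_on k S (\<lambda>x. h (f x) (g x))"
proof (induction k arbitrary: f g)
  case 0
  then show ?case by (auto intro: bounded_bilinear.continuous_on[OF assms])
next
  case (Suc k)
  then obtain f' g' where
    f: "\<forall>x\<in>S. (f has_derivative f' x) (at x within S)" "\<forall>v. Ck_on k S (\<lambda>x. f' x v)" and
    g: "\<forall>x\<in>S. (g has_derivative g' x) (at x within S)" "\<forall>v. Ck_on k S (\<lambda>x. g' x v)"
    by auto
  with Suc.prems[THEN Ck_on_mono] show ?case
    by (auto intro!: exI[of _ "\<lambda>x v. h (f x) (g' x v) + h (f' x v) (g x)"] Ck_on_add Suc.IH
        bounded_bilinear.FDERIV[OF assms])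
qed

lemma Ck_on_compose:
  fixes f :: "'b::euclidean_space \<Rightarrow> 'c::real_normed_vector" and g :: "'a::euclidean_space \<Rightarrow> 'b"
  shows "Ck_on k UNIV f \<Longrightarrow> Ck_on k S g \<Longrightarrow> Ck_on k S (\<lambda>x. f (g x))"
proof (induction k arbitrary: f g)
  case 0
  then show ?case by (auto intro: continuous_on_compose2)
next
  case (Suc k)
  then obtain f' g' where
    f: "\<forall>x. (f has_derivative f' x) (at x)" "\<forall>v. Ck_on k UNIV (\<lambda>x. f' x v)" and
    g: "\<forall>x\<in>S. (g has_derivative g' x) (at x within S)" "\<forall>v. Ck_on k S (\<lambda>x. g' x v)"
    by auto
  \<comment> \<open>\<open>Ck_on\<close> controls derivatives in fixed directions only, whereas the
    direction \<open>g' x v\<close> varies with \<open>x\<close>. Expanding it in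
    \<open>Basis\<close> leaves fixed directions with scalar coefficients.\<close>
  have lin: "f' (g x) (g' x v) = (\<Sum>b\<in>Basis. (g' x v \<bullet> b) *\<^sub>R f' (g x) b)" for x v
  proof -
    have "f' (g x) (g' x v) = f' (g x) (\<Sum>b\<in>Basis. (g' x v \<bullet> b) *\<^sub>R b)"
      by (simp add: euclidean_representation)
    also have "\<dots> = (\<Sum>b\<in>Basis. (g' x v \<bullet> b) *\<^sub>R f' (g x) b)"
      using f(1)[rule_format, THEN has_derivative_linear] by (simp add: linear_sum linear_scale)
    finally show ?thesis .
  qed
  have der: "((\<lambda>x. f (g x)) has_derivative (\<lambda>v. f' (g x) (g' x v))) (at x within S)" if "x \<in> S" for x
    using g(1) that has_derivative_compose f(1) by blast
  have "Ck_on k S (\<lambda>x. f' (g x) (g' x v))" for v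
    unfolding lin using f(2) g(2) Suc.IH Ck_on_mono[OF Suc.prems(2)]
    by (intro Ck_on_sum Ck_on_bilinear[OF bounded_bilinear_scaleR]
        Ck_on_bounded_linear[OF bounded_linear_inner_left]) auto
  with der show ?case by (auto intro!: exI[of _ "\<lambda>x v. f' (g x) (g' x v)"])
qed

lemma smooth_const: "smooth_on S (\<lambda>x. a)"
  by (simp add: smooth_on_def Ck_on_const)

lemma smooth_id: "smooth_on S (\<lambda>x. x)"
  unfolding smooth_on_def
proof
  fix k show "Ck_on k S (\<lambda>x. x)"
    by (cases k) (auto intro!: exI[of _ "\<lambda>x v. v"] Ck_on_const)
qed

lemma smooth_bounded_linear: "bounded_linear h \<Longrightarrow> smooth_on S f \<Longrightarrow> smooth_on S (\<lambda>x. h (f x))"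
  by (simp add: smooth_on_def Ck_on_bounded_linear)

lemma smooth_linear: "linear h \<Longrightarrow> smooth_on S f \<Longrightarrow> smooth_on S (\<lambda>x. h (f x :: 'a::euclidean_space))"
  by (simp add: linear_conv_bounded_linear smooth_bounded_linear)

lemma smooth_add: "smooth_on S f \<Longrightarrow> smooth_on S g \<Longrightarrow> smooth_on S (\<lambda>x. f x + g x)"
  by (simp add: smooth_on_def Ck_on_add)

lemma smooth_bilinear:
  "bounded_bilinear h \<Longrightarrow> smooth_on S f \<Longrightarrow> smooth_on S g \<Longrightarrow> smooth_on S (\<lambda>x. h (f x) (g x))"
  by (simp add: smooth_on_def Ck_on_bilinear)

lemma smooth_compose:
  fixes f :: "'b::euclidean_space \<Rightarrow> 'c::real_normed_vector" and g :: "'a::euclidean_space \<Rightarrow> 'b"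
  shows "smooth f \<Longrightarrow> smooth_on S g \<Longrightarrow> smooth_on S (\<lambda>x. f (g x))"
  by (simp add: smooth_on_def Ck_on_compose)

lemmas smooth_scaleR = smooth_bilinear[OF bounded_bilinear_scaleR]
lemmas smooth_mult = smooth_bilinear[OF bounded_bilinear_mult]
lemmas smooth_inner_left = smooth_bounded_linear[OF bounded_linear_inner_left]
lemmas smooth_inner = smooth_bilinear[OF bounded_bilinear_inner]
lemmas smooth_fst = smooth_bounded_linear[OF bounded_linear_fst]
lemmas smooth_snd = smooth_bounded_linear[OF bounded_linear_snd]
lemmas smooth_minus = smooth_bounded_linear[OF bounded_linear_minus[OF bounded_linear_ident]]
lemmas smooth_vec_nth = smooth_bounded_linear[OF bounded_linear_vec_nth]

lemma smooth_diff: "smooth_on S f \<Longrightarrow> smooth_on S g \<Longrightarrow> smooth_on S (\<lambda>x. f x - g x)"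
  using smooth_add[OF _ smooth_minus] by fastforce

lemma smooth_sum: "(\<And>i. i \<in> I \<Longrightarrow> smooth_on S (f i)) \<Longrightarrow> smooth_on S (\<lambda>x. \<Sum>i\<in>I. f i x)"
  by (simp add: smooth_on_def Ck_on_sum)

lemma smooth_prod:
  fixes f :: "'i \<Rightarrow> 'a::euclidean_space \<Rightarrow> 'b::{real_normed_algebra_1, comm_monoid_mult}"
  shows "(\<And>i. i \<in> I \<Longrightarrow> smooth_on S (f i)) \<Longrightarrow> smooth_on S (\<lambda>x. \<Prod>i\<in>I. f i x)"
  by (induction I rule: infinite_finite_induct) (simp_all add: smooth_const smooth_mult)

lemma smooth_power:
  fixes f :: "'a::euclidean_space \<Rightarrow> real"
  shows "smooth_on S f \<Longrightarrow> smooth_on S (\<lambda>x. f x ^ n)"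
  by (induction n) (simp_all add: smooth_const smooth_mult)

lemma smooth_Pair:
  fixes f :: "'c::euclidean_space \<Rightarrow> 'a::real_normed_vector" and g :: "'c \<Rightarrow> 'b::real_normed_vector"
  assumes "smooth_on S f" "smooth_on S g"
  shows "smooth_on S (\<lambda>x. (f x, g x))"
proof -
  have "bounded_linear (\<lambda>a::'a. (a, 0::'b))" "bounded_linear (\<lambda>b::'b. (0::'a, b))"
    by (auto intro: bounded_linear_Pair bounded_linear_ident bounded_linear_zero)
  from this(1)[THEN smooth_bounded_linear, OF assms(1)] this(2)[THEN smooth_bounded_linear, OF assms(2)]
  show ?thesis using smooth_add by fastforce
qed

lemma smooth_vec:
  fixes f :: "'a::euclidean_space \<Rightarrow> 'i::finite \<Rightarrow> 'b::euclidean_space"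
  assumes "\<And>i. smooth_on S (\<lambda>x. f x i)"
  shows "smooth_on S (\<lambda>x. \<chi> i. f x i)"
proof -
  have "bounded_linear (axis i :: 'b \<Rightarrow> 'b^'i)" for i
    unfolding linear_conv_bounded_linear[symmetric]
    by (rule linearI) (simp_all add: axis_def vec_eq_iff)
  then have "smooth_on S (\<lambda>x. \<Sum>i\<in>UNIV. axis i (f x i))"
    by (rule smooth_sum[OF smooth_bounded_linear[OF _ assms]])
  moreover have "(\<Sum>i\<in>UNIV. axis i (f x i)) = (\<chi> i. f x i)" for x
    by (simp add: vec_eq_iff axis_def if_distrib cong: if_cong)
  ultimately show ?thesis by simp
qed

lemma smooth_inverse:
  fixes f :: "'a::euclidean_space \<Rightarrow> real"
  assumes "smooth_on S f" "\<And>x. x \<in> S \<Longrightarrow> f x \<noteq> 0"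
  shows "smooth_on S (\<lambda>x. inverse (f x))"
  unfolding smooth_on_def
proof
  fix k
  have f: "Ck_on k S f" for k using assms(1) by (simp add: smooth_on_def)
  show "Ck_on k S (\<lambda>x. inverse (f x))"
  proof (induction k)
    case 0
    then show ?case using f[of 0] assms(2) by (auto intro: continuous_on_inverse)
  next
    case (Suc k)
    obtain f' where "\<forall>x\<in>S. (f has_derivative f' x) (at x within S)" "\<forall>v. Ck_on k S (\<lambda>x. f' x v)"
      using f[of "Suc k"] by auto
    with Suc assms(2) show ?case
      by (auto intro!: exI[of _ "\<lambda>x v. - (inverse (f x) * f' x v * inverse (f x))"]
          Ck_on_bilinear[OF bounded_bilinear_mult]
          Ck_on_bounded_linear[OF bounded_linear_minus[OF bounded_linear_ident]] has_derivative_inverse)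
  qed
qed

lemma smooth_imp_has_derivative: "smooth f \<Longrightarrow> (f has_derivative D f x) (at x)"
  unfolding smooth_on_def
  by (drule spec[of _ 1]) (auto intro: differentiableI simp flip: frechet_derivative_works)

lemma smooth_imp_continuous_on: "smooth_on S f \<Longrightarrow> continuous_on S f"
  unfolding smooth_on_def by (metis Ck_on.simps(1))

lemma linear_D: "smooth f \<Longrightarrow> linear (D f x)"
  using smooth_imp_has_derivative has_derivative_linear by blast

text \<open>The derivative in \<open>Ck_on\<close> is existentially quantified; on the whole space
  it is unique, hence equal to \<open>D f\<close>, which thereby inherits the regularity.\<close>

lemma smooth_D: "smooth f \<Longrightarrow> smooth (\<lambda>x. D f x v)"
  unfolding smooth_on_def
proof
  fix k assume "\<forall>k. Ck_on k UNIV f"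
  then obtain f' where f': "\<forall>x. (f has_derivative f' x) (at x)" "\<forall>v. Ck_on k UNIV (\<lambda>x. f' x v)"
    by (metis Ck_on.simps(2) UNIV_I)
  then have "D f x = f' x" for x by (metis frechet_derivative_at)
  with f' show "Ck_on k UNIV (\<lambda>x. D f x v)" by simp
qed

lemma linear_euclidean_sum:
  "linear h \<Longrightarrow> h v = (\<Sum>b\<in>Basis. (v \<bullet> b) *\<^sub>R h b)" for v :: "'a::euclidean_space"
  by (metis (mono_tags, lifting) euclidean_representation linear_scale linear_sum sum.cong)

lemma smooth_D_apply:
  assumes "smooth f" "smooth_on S g" "smooth_on S h"
  shows "smooth_on S (\<lambda>x. D f (g x) (h x))"
proof -
  have "D f (g x) (h x) = (\<Sum>b\<in>Basis. (h x \<bullet> b) *\<^sub>R D f (g x) b)" for x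
    using linear_euclidean_sum linear_D assms(1) by blast
  then show ?thesis using assms
    by (auto intro!: smooth_sum smooth_scaleR smooth_inner_left smooth_compose[OF smooth_D])
qed

lemmas smooth_intros = smooth_const smooth_id smooth_add smooth_diff smooth_minus smooth_scaleR
  smooth_mult smooth_inner smooth_fst smooth_snd smooth_Pair smooth_sum smooth_power smooth_D_apply
  smooth_vec_nth smooth_prod smooth_vec

text \<open>If \<open>y\<close> is C^k, then so is its derivative \<open>h t (y t)\<close>, which
  makes \<open>y\<close> C^(k+1). Applied to the orbits \<open>\<Gamma> j\<close> and to fundamental
  matrices, which are given merely as differentiable solutions.\<close>

lemma smooth_bootstrap:
  fixes y :: "real \<Rightarrow> 'b::euclidean_space"
  assumes der: "\<And>t. (y has_vector_derivative h t (y t)) (at t)"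
    and h: "smooth (\<lambda>(t, x). h t x)"
  shows "smooth y"
  unfolding smooth_on_def
proof
  fix k show "Ck_on k UNIV y"
  proof (induction k)
    case 0
    show ?case using der
      by (auto intro!: continuous_at_imp_continuous_on has_vector_derivative_continuous)
  next
    case (Suc k)
    have id: "Ck_on k UNIV (\<lambda>t::real. t)" using smooth_id unfolding smooth_on_def by auto
    have "Ck_on k UNIV (\<lambda>t. (t, y t))"
    proof -
      have "bounded_linear (\<lambda>a::real. (a, 0::'b))" "bounded_linear (\<lambda>b::'b. (0::real, b))"
        by (auto intro: bounded_linear_Pair bounded_linear_ident bounded_linear_zero)
      from this(1)[THEN Ck_on_bounded_linear, OF id] this(2)[THEN Ck_on_bounded_linear, OF Suc]
      show ?thesis using Ck_on_add by fastforce
    qed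
    from Ck_on_compose[OF _ this, of "\<lambda>(t, x). h t x"] h
    have "Ck_on k UNIV (\<lambda>t. h t (y t))" by (auto simp: smooth_on_def)
    then have "Ck_on k UNIV (\<lambda>t. v *\<^sub>R h t (y t))" for v :: real
      by (intro Ck_on_bounded_linear[OF bounded_linear_scaleR_right]) 
    then show ?case using der unfolding has_vector_derivative_def
      by (auto intro!: exI[of _ "\<lambda>t v. v *\<^sub>R h t (y t)"])
  qed
qed

section \<open>Integrals and periodic maps\<close>

lemma smooth_D_curve:
  assumes "smooth u" "(g has_vector_derivative g') (at r)"
  shows "((\<lambda>r. u (g r)) has_vector_derivative D u (g r) g') (at r)"
proof -
  have "((\<lambda>r. u (g r)) has_derivative (\<lambda>h. D u (g r) (h *\<^sub>R g'))) (at r)"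
    using assms(2) smooth_imp_has_derivative[OF assms(1)] unfolding has_vector_derivative_def
    by (rule has_derivative_compose)
  then show ?thesis
    using linear_D[OF assms(1)] by (simp add: has_vector_derivative_def linear_scale)
qed

lemma D_eq: "(u has_derivative u') (at x) \<Longrightarrow> D u x = u'"
  by (metis frechet_derivative_at)

lemma D_compose_linear_affine:
  assumes "smooth u" "linear h"
  shows "D (\<lambda>x. u (a + h x)) x v = D u (a + h x) (h v)"
proof -
  have "(h has_derivative h) (at x)"
    using assms(2) by (simp add: linear_imp_has_derivative)
  then have "((\<lambda>x. a + h x) has_derivative h) (at x)"
    using has_derivative_add_const by (auto intro!: derivative_eq_intros)
  from has_derivative_compose[OF this smooth_imp_has_derivative[OF assms(1)]]
  show ?thesis by (simp add: D_eq)
qed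

text \<open>The residuals depend on \<epsilon> and s besides the phase. A general period vector such
  as \<open>(0, axis i (2 * pi), 0)\<close> covers these domains as well.\<close>

definition period :: "'a::euclidean_space \<Rightarrow> ('a \<Rightarrow> 'b) \<Rightarrow> bool" where
  "period p u \<longleftrightarrow> (\<forall>x. u (x + p) = u x)"

lemma period_D: "period p u \<Longrightarrow> smooth u \<Longrightarrow> period p (\<lambda>x. D u x v)"
  using D_compose_linear_affine[of u "\<lambda>x. x" p]
  by (simp add: period_def linear_iff add.commute)

lemma torus_map_iff_period: "torus_map u \<longleftrightarrow> (\<forall>j. period (axis j (2 * pi)) u)"
  by (auto simp: torus_map_def period_def)

lemma has_derivative_integral:
  fixes K :: "real \<times> 'a::euclidean_space \<Rightarrow> 'b::euclidean_space"
  assumes "smooth K"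
  shows "((\<lambda>x. integral {0..1} (\<lambda>r. K (r, x))) has_derivative
          (\<lambda>v. integral {0..1} (\<lambda>r. D K (r, x) (0, v)))) (at x)"
proof -
  define B where "B x r = Blinfun (\<lambda>v. D K (r, x) (0, v))" for x r
  have der: "((\<lambda>x. K (r, x)) has_derivative (\<lambda>v. D K (r, x) (0, v))) (at x)" for r x
    by (rule has_derivative_compose[OF _ smooth_imp_has_derivative[OF assms]])
      (auto intro!: derivative_eq_intros)
  then have B: "blinfun_apply (B x r) = (\<lambda>v. D K (r, x) (0, v))" for x r
    unfolding B_def by (intro bounded_linear_Blinfun_apply has_derivative_bounded_linear)
  \<comment> \<open>\<open>leibniz_rule\<close> asks for a continuous family of bounded linear maps;
    in finite dimension continuity can be tested on basis vectors.\<close>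
  have cont: "continuous_on UNIV (\<lambda>(x, r). B x r)"
  proof (rule continuous_on_blinfun_componentwise)
    fix i :: 'a
    have "smooth (\<lambda>z :: 'a \<times> real. D K (snd z, fst z) (0, i))"
      by (intro smooth_intros assms)
    then show "continuous_on UNIV (\<lambda>z. blinfun_apply (case z of (x, r) \<Rightarrow> B x r) i)"
      by (auto simp: B case_prod_beta dest: smooth_imp_continuous_on)
  qed
  have "smooth (\<lambda>r. K (r, x))" for x
    by (intro smooth_compose[OF assms] smooth_intros)
  then have int: "(\<lambda>r. K (r, x)) integrable_on cbox 0 1" for x
    by (intro integrable_continuous) (meson smooth_imp_continuous_on continuous_on_subset subset_UNIV)
  have "((\<lambda>x. integral (cbox 0 1) (\<lambda>r. K (r, x))) has_derivative integral (cbox 0 1) (B x)) (at x within UNIV)"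
    using der int continuous_on_subset[OF cont subset_UNIV]
    by (intro leibniz_rule) (auto simp: B)
  moreover have "blinfun_apply (integral (cbox 0 1) (B x)) v = integral (cbox 0 1) (\<lambda>r. D K (r, x) (0, v))" for v
  proof -
    have "continuous_on (cbox 0 1) (\<lambda>r. case (x, r) of (x, r) \<Rightarrow> B x r)"
      by (rule continuous_on_compose2[OF cont]) (auto intro!: continuous_intros)
    then have "B x integrable_on cbox 0 1" by (intro integrable_continuous) simp
    from integral_linear[OF this blinfun.bounded_linear_left, of v] show ?thesis
      by (simp add: o_def B)
  qed
  then have "blinfun_apply (integral (cbox 0 1) (B x)) = (\<lambda>v. integral (cbox 0 1) (\<lambda>r. D K (r, x) (0, v)))"
    by (rule ext)
  ultimately show ?thesis by (simp add: cbox_interval)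
qed

text \<open>Differentiation under the integral gives an integral of the same form with kernel
  \<open>D K z (0, v)\<close>, so the induction runs over all kernels at once. Keeping the interval
  [0,1] fixed puts all dependence on parameters into the kernel.\<close>

lemma smooth_integral:
  fixes K :: "real \<times> 'a::euclidean_space \<Rightarrow> 'b::euclidean_space"
  assumes "smooth K"
  shows "smooth (\<lambda>x. integral {0..1} (\<lambda>r. K (r, x)))"
  unfolding smooth_on_def
proof
  fix k show "Ck_on k UNIV (\<lambda>x. integral {0..1} (\<lambda>r. K (r, x)))"
    using assms
  proof (induction k arbitrary: K)
    case 0
    show ?case
      using has_derivative_continuous[OF has_derivative_integral[OF 0]]
      by (simp add: continuous_at_imp_continuous_on)
  next
    case (Suc k)
    show ?case
      unfolding Ck_on.simps
    proof (intro exI conjI ballI allI)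
      show "((\<lambda>x. integral {0..1} (\<lambda>r. K (r, x))) has_derivative
          (\<lambda>v. integral {0..1} (\<lambda>r. D K (r, x) (0, v)))) (at x)" for x
        by (rule has_derivative_integral[OF Suc.prems])
      show "Ck_on k UNIV (\<lambda>x. integral {0..1} (\<lambda>r. D K (r, x) (0, v)))" for v
        using Suc.IH[of "\<lambda>z. D K z (0, v)"] smooth_D[OF Suc.prems] by simp
    qed
  qed
qed

lemma D_integral:
  fixes K :: "real \<times> 'a::euclidean_space \<Rightarrow> 'b::euclidean_space"
  assumes "smooth K"
  shows "D (\<lambda>x. integral {0..1} (\<lambda>r. K (r, x))) x v = integral {0..1} (\<lambda>r. D K (r, x) (0, v))"
  using D_eq[OF has_derivative_integral[OF assms]] by simp

lemma integral_D_curve: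
  fixes u :: "'a::euclidean_space \<Rightarrow> 'b::euclidean_space"
  assumes "smooth u" "\<And>r. (g has_vector_derivative g' r) (at r)"
  shows "integral {0..1} (\<lambda>r. D u (g r) (g' r)) = u (g 1) - u (g 0)"
proof -
  have "((\<lambda>r. u (g r)) has_vector_derivative D u (g r) (g' r)) (at r within {0..1})" for r
    using smooth_D_curve[OF assms] by (rule has_vector_derivative_at_within)
  then have "((\<lambda>r. D u (g r) (g' r)) has_integral u (g 1) - u (g 0)) {0..1}"
    using fundamental_theorem_of_calculus[of 0 1 "\<lambda>r. u (g r)" "\<lambda>r. D u (g r) (g' r)"] by simp
  then show ?thesis by (rule integral_unique)
qed

text \<open>The quotient is the mean of the first partial derivative over the segment from
  \<open>(0, x)\<close> to \<open>(d, x)\<close>, hence smooth across \<open>d = 0\<close>. It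
  extracts a power of \<epsilon> from residuals that vanish at \<epsilon> = 0, and it splits off
  increments of the nonlinearity with an exact remainder.\<close>

lemma hadamard:
  fixes u :: "real \<times> 'a::euclidean_space \<Rightarrow> 'b::euclidean_space"
  assumes u: "smooth u"
  obtains q where "smooth q" "\<And>d x. u (d, x) = u (0, x) + d *\<^sub>R q (d, x)"
    "\<And>x. q (0, x) = D u (0, x) (1, 0)" "\<And>p. period (0, p) u \<Longrightarrow> period (0, p) q"
proof
  define q where "q z = integral {0..1} (\<lambda>r. D u (r * fst z, snd z) (1, 0))" for z :: "real \<times> 'a"
  show "smooth q"
  proof -
    have "smooth (\<lambda>y :: real \<times> real \<times> 'a. D u (fst y * fst (snd y), snd (snd y)) (1, 0))"
      by (intro smooth_intros u)
    from smooth_integral[OF this] show ?thesis by (simp add: q_def[abs_def])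
  qed
  show "u (d, x) = u (0, x) + d *\<^sub>R q (d, x)" for d x
  proof -
    have "integral {0..1} (\<lambda>r. D u (r * d, x) (d, 0)) = u (1 * d, x) - u (0 * d, x)"
      by (rule integral_D_curve[OF u, where g = "\<lambda>r. (r * d, x)"])
        (auto intro!: derivative_eq_intros has_vector_derivative_Pair)
    moreover have "D u (r * d, x) (d, 0) = d *\<^sub>R D u (r * d, x) (1, 0)" for r
      using linear_scale[OF linear_D[OF u], of "(r * d, x)" d "(1, 0)"] by simp
    ultimately show ?thesis by (simp add: q_def)
  qed
  show "q (0, x) = D u (0, x) (1, 0)" for x
    by (simp add: q_def)
  show "period (0, p) q" if "period (0, p) u" for p
    using period_D[OF that u] by (simp add: period_def q_def split_paired_all)
qed

lemma torus_map_shift: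
  assumes "torus_map u"
  shows "u (\<phi> + (\<Sum>j\<in>A. axis j (2 * pi * of_int (n j)))) = u \<phi>"
proof -
  have nat: "u (\<phi> + axis j (2 * pi * real k)) = u \<phi>" for \<phi> j k
  proof (induction k)
    case (Suc k)
    have "axis j (2 * pi * real (Suc k)) = axis j (2 * pi * real k) + axis j (2 * pi)"
      by (auto simp: axis_def vec_eq_iff algebra_simps)
    then show ?case using assms Suc by (metis (no_types, lifting) add.assoc torus_map_def)
  qed (simp add: axis_def zero_vec_def[symmetric])
  have int: "u (\<phi> + axis j (2 * pi * of_int i)) = u \<phi>" for \<phi> j i
  proof (cases "i \<ge> 0")
    case True
    then show ?thesis using nat[of \<phi> j "nat i"] by simp
  next
    case False
    have "u (\<phi> + axis j (2 * pi * of_int i)) =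
        u (\<phi> + axis j (2 * pi * of_int i) + axis j (2 * pi * real (nat (- i))))"
      using nat by metis
    also have "\<phi> + axis j (2 * pi * of_int i) + axis j (2 * pi * real (nat (- i))) = \<phi>"
      using False by (auto simp: axis_def vec_eq_iff)
    finally show ?thesis .
  qed
  show ?thesis
    by (induction A arbitrary: \<phi> rule: infinite_finite_induct)
      (simp_all add: int add.assoc[symmetric])
qed

text \<open>Whole turns move every phase into a compact cell, where continuity gives the bound. It
  is uniform for |\<epsilon>| <= 1, the range in which the residuals are estimated.\<close>

lemma periodic_bounded:
  fixes u :: "real \<times> (real^'m) \<times> real \<Rightarrow> 'b::real_normed_vector"
  assumes "continuous_on UNIV u" "\<And>j. period (0, axis j (2 * pi), 0) u"
  shows "\<exists>C. \<forall>\<epsilon> \<phi> s. \<bar>\<epsilon>\<bar> \<le> 1 \<longrightarrow> s \<in> {a..b} \<longrightarrow> norm (u (\<epsilon>, \<phi>, s)) \<le> C"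
proof -
  let ?K = "{-1..1} \<times> cbox 0 (\<chi> i. 2 * pi) \<times> {a..b} :: (real \<times> (real^'m) \<times> real) set"
  have "compact (u ` ?K)"
    by (intro compact_continuous_image continuous_on_subset[OF assms(1)] compact_Times) auto
  then obtain C where C: "\<And>y. y \<in> u ` ?K \<Longrightarrow> norm y \<le> C"
    using compact_imp_bounded bounded_iff by metis
  show ?thesis
  proof (intro exI allI impI)
    fix \<epsilon> :: real and \<phi> :: "real^'m" and s assume *: "\<bar>\<epsilon>\<bar> \<le> 1" "s \<in> {a..b}"
    define n where "n j = - \<lfloor>\<phi> $ j / (2 * pi)\<rfloor>" for j
    define \<psi> where "\<psi> = \<phi> + (\<Sum>j\<in>UNIV. axis j (2 * pi * of_int (n j)))"
    have "torus_map (\<lambda>\<phi>. u (\<epsilon>, \<phi>, s))"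
      using assms(2) by (force simp: torus_map_def period_def)
    from torus_map_shift[OF this] have same: "u (\<epsilon>, \<psi>, s) = u (\<epsilon>, \<phi>, s)"
      by (simp add: \<psi>_def)
    have "\<psi> $ j = 2 * pi * frac (\<phi> $ j / (2 * pi))" for j
      by (simp add: \<psi>_def axis_def if_distrib n_def frac_def algebra_simps cong: if_cong)
    then have "\<psi> \<in> cbox 0 (\<chi> i. 2 * pi)"
      by (auto simp: mem_box_cart frac_lt_1 less_imp_le)
    with * have "u (\<epsilon>, \<psi>, s) \<in> u ` ?K" by (intro imageI) auto
    then have "norm (u (\<epsilon>, \<psi>, s)) \<le> C" by (rule C)
    then show "norm (u (\<epsilon>, \<phi>, s)) \<le> C" by (simp add: same)
  qed
qed

lemma torus_map_bounded:
  fixes u :: "real^'m \<Rightarrow> 'b::real_normed_vector"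
  assumes "smooth u" "torus_map u"
  obtains C where "\<And>\<phi>. norm (u \<phi>) \<le> C"
proof -
  have "continuous_on UNIV (\<lambda>z :: real \<times> (real^'m) \<times> real. u (fst (snd z)))"
    by (rule continuous_on_compose2[OF smooth_imp_continuous_on[OF assms(1)]])
      (auto intro!: continuous_intros)
  moreover have "period (0, axis j (2 * pi), 0) (\<lambda>z :: real \<times> (real^'m) \<times> real. u (fst (snd z)))" for j
    using assms(2) by (simp add: period_def torus_map_def)
  ultimately obtain C where "\<forall>\<epsilon> \<phi> s. \<bar>\<epsilon>\<bar> \<le> 1 \<longrightarrow> s \<in> {0..0::real} \<longrightarrow> norm (u (fst (snd (\<epsilon> :: real, \<phi>, s)))) \<le> C"
    using periodic_bounded[of "\<lambda>z. u (fst (snd z))" 0 0] by blast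
  from this[rule_format, of 0 0] have "norm (u \<phi>) \<le> C" for \<phi> by simp
  then show ?thesis by (rule that)
qed

text \<open>The error is dominated by the remaining geometric series with \<open>C\<close> as a
  factor. For the differentiated series \<open>C\<close> is proportional to the norm of the
  direction, which is the uniformity required by \<open>has_derivative_series\<close>.\<close>

lemma geometric_tail_bound:
  fixes c :: complex and a :: "nat \<Rightarrow> complex"
  assumes c: "norm c < 1" and a: "\<And>k. norm (a k) \<le> C"
  shows "summable (\<lambda>k. c ^ k * a k)"
    "norm ((\<Sum>k<n. c ^ k * a k) - (\<Sum>k. c ^ k * a k)) \<le> norm c ^ n * (C / (1 - norm c))"
proof -
  have geo: "summable (\<lambda>k. norm c ^ k * C)"
    using c by (intro summable_mult2 summable_geometric) auto
  have le: "norm (c ^ k * a k) \<le> norm c ^ k * C" for k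
    using a by (simp add: norm_mult norm_power mult_left_mono)
  show s: "summable (\<lambda>k. c ^ k * a k)"
    by (rule summable_comparison_test'[OF geo]) (rule le)
  have "(\<Sum>k<n. c ^ k * a k) - (\<Sum>k. c ^ k * a k) = - (\<Sum>k. c ^ (k + n) * a (k + n))"
    using suminf_split_initial_segment[OF s, of n] by simp
  also have "norm \<dots> \<le> (\<Sum>k. norm c ^ (k + n) * C)"
    unfolding norm_minus_cancel
    using geo by (intro norm_suminf_le le) (simp add: summable_iff_shift[where f = "\<lambda>k. norm c ^ k * C"])
  also have "\<dots> = norm c ^ n * (C / (1 - norm c))"
    using c suminf_mult[of "\<lambda>k. norm c ^ k" "norm c ^ n * C"] 
    by (simp add: power_add mult_ac suminf_geometric divide_inverse summable_geometric)
  finally show "norm ((\<Sum>k<n. c ^ k * a k) - (\<Sum>k. c ^ k * a k)) \<le> norm c ^ n * (C / (1 - norm c))" .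
qed

section \<open>Shift equations on the torus\<close>

text \<open>The Neumann series for the inverse of 1 - c S, where S is the shift by \<theta>. Values
  are complex because the roots of the polynomials treated below are.\<close>

definition neumann :: "complex \<Rightarrow> 'a::real_vector \<Rightarrow> ('a \<Rightarrow> complex) \<Rightarrow> 'a \<Rightarrow> complex" where
  "neumann c \<theta> u x = (\<Sum>k. c ^ k * u (x + real k *\<^sub>R \<theta>))"

lemma torus_map_D: "torus_map u \<Longrightarrow> smooth u \<Longrightarrow> torus_map (\<lambda>\<phi>. D u \<phi> v)"
  using period_D by (auto simp: torus_map_iff_period)

lemma torus_D_bound:
  fixes u :: "real^'m \<Rightarrow> 'b::real_normed_vector"
  assumes u: "smooth u" "torus_map u"
  obtains C where "\<And>x h. norm (D u x h) \<le> C * norm h"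
proof -
  have "\<exists>C. \<forall>x. norm (D u x b) \<le> C" for b
    using torus_map_bounded[OF smooth_D[OF u(1)] torus_map_D[OF u(2,1)]] by metis
  then obtain C where C: "\<And>b x. norm (D u x b) \<le> C b" by metis
  have "norm (D u x h) \<le> (\<Sum>b\<in>Basis. C b) * norm h" for x h
  proof -
    have "norm (D u x h) = norm (\<Sum>b\<in>Basis. (h \<bullet> b) *\<^sub>R D u x b)"
      using linear_euclidean_sum[OF linear_D[OF u(1)]] by metis
    also have "\<dots> \<le> (\<Sum>b\<in>Basis. norm h * C b)"
      by (intro sum_norm_le) (simp add: C Basis_le_norm mult_mono)
    finally show ?thesis by (simp add: sum_distrib_left mult.commute)
  qed
  then show ?thesis by (rule that)
qed

text \<open>Shifts commute with directional derivatives, so termwise differentiation yields the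
  Neumann series of the derivative; boundedness of \<open>D u\<close> on the torus makes it converge
  uniformly.\<close>

lemma neumann_has_derivative:
  fixes u :: "real^'m \<Rightarrow> complex"
  assumes c: "norm c < 1" and u: "smooth u" "torus_map u"
  shows "(neumann c \<theta> u has_derivative (\<lambda>v. neumann c \<theta> (\<lambda>y. D u y v) x)) (at x)"
proof -
  obtain B where B: "\<And>x. norm (u x) \<le> B" using torus_map_bounded[OF u] by blast
  obtain C where C: "\<And>x h. norm (D u x h) \<le> C * norm h" using torus_D_bound[OF u] by blast
  have sums: "(\<lambda>k. c ^ k * u (x + real k *\<^sub>R \<theta>)) sums neumann c \<theta> u x" for x
    unfolding neumann_def using geometric_tail_bound(1)[OF c B] by (rule summable_sums)
  have der: "((\<lambda>x. c ^ k * u (x + real k *\<^sub>R \<theta>)) has_derivative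
      (\<lambda>v. c ^ k * D u (x + real k *\<^sub>R \<theta>) v)) (at x)" for k x
  proof -
    have "((\<lambda>x. u (x + real k *\<^sub>R \<theta>)) has_derivative D u (x + real k *\<^sub>R \<theta>)) (at x)"
      by (rule has_derivative_compose[OF _ smooth_imp_has_derivative[OF u(1)]])
        (auto intro!: derivative_eq_intros)
    then show ?thesis by (rule has_derivative_mult_right)
  qed
  have lim: "(\<lambda>n. norm c ^ n * (C / (1 - norm c))) \<longlonglongrightarrow> 0"
    using c by (intro tendsto_mult_left_zero LIMSEQ_power_zero) simp
  have "\<exists>g. \<forall>x\<in>UNIV. (\<lambda>k. c ^ k * u (x + real k *\<^sub>R \<theta>)) sums g x \<and>
      (g has_derivative (\<lambda>v. neumann c \<theta> (\<lambda>y. D u y v) x)) (at x within UNIV)"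
  proof (rule has_derivative_series[where f' = "\<lambda>k x v. c ^ k * D u (x + real k *\<^sub>R \<theta>) v" and x = 0
        and l = "neumann c \<theta> u 0"])
    show "(\<lambda>k. c ^ k * u (0 + real k *\<^sub>R \<theta>)) sums neumann c \<theta> u 0" by (rule sums)
  next
    fix e :: real assume "e > 0"
    with lim have "\<forall>\<^sub>F n in sequentially. norm c ^ n * (C / (1 - norm c)) < e"
      by (rule order_tendstoD)
    then show "\<forall>\<^sub>F n in sequentially. \<forall>x\<in>UNIV. \<forall>h. norm ((\<Sum>k<n. c ^ k * D u (x + real k *\<^sub>R \<theta>) h)
        - neumann c \<theta> (\<lambda>y. D u y h) x) \<le> e * norm h"
    proof eventually_elim
      case (elim n)
      show ?case
      proof (intro ballI allI)
        fix x h
        have "norm ((\<Sum>k<n. c ^ k * D u (x + real k *\<^sub>R \<theta>) h) - neumann c \<theta> (\<lambda>y. D u y h) x)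
            \<le> norm c ^ n * (C * norm h / (1 - norm c))"
          unfolding neumann_def by (rule geometric_tail_bound(2)[OF c C])
        also have "\<dots> = (norm c ^ n * (C / (1 - norm c))) * norm h" by simp
        also have "\<dots> \<le> e * norm h" using elim by (intro mult_right_mono) auto
        finally show "norm ((\<Sum>k<n. c ^ k * D u (x + real k *\<^sub>R \<theta>) h) - neumann c \<theta> (\<lambda>y. D u y h) x) \<le> e * norm h" .
      qed
    qed
  qed (use der in simp_all)
  then obtain g where g: "\<And>x. (\<lambda>k. c ^ k * u (x + real k *\<^sub>R \<theta>)) sums g x"
    "\<And>x. (g has_derivative (\<lambda>v. neumann c \<theta> (\<lambda>y. D u y v) x)) (at x)" by auto
  have "g = neumann c \<theta> u" using g(1) sums sums_unique2 by blast
  with g(2) show ?thesis by simp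
qed

lemma smooth_neumann:
  fixes u :: "real^'m \<Rightarrow> complex"
  assumes c: "norm c < 1" and u: "smooth u" "torus_map u"
  shows "smooth (neumann c \<theta> u)"
  unfolding smooth_on_def
proof
  fix k show "Ck_on k UNIV (neumann c \<theta> u)"
    using u
  proof (induction k arbitrary: u)
    case 0
    show ?case
      using has_derivative_continuous[OF neumann_has_derivative[OF c 0]]
      by (simp add: continuous_at_imp_continuous_on)
  next
    case (Suc k)
    show ?case
      unfolding Ck_on.simps
    proof (intro exI conjI ballI allI)
      show "(neumann c \<theta> u has_derivative (\<lambda>v. neumann c \<theta> (\<lambda>y. D u y v) x)) (at x)" for x
        by (rule neumann_has_derivative[OF c Suc.prems])
      show "Ck_on k UNIV (\<lambda>x. neumann c \<theta> (\<lambda>y. D u y v) x)" for v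
        using Suc.IH[OF smooth_D torus_map_D] Suc.prems by simp
    qed
  qed
qed

lemma torus_map_compose_shift: "torus_map u \<Longrightarrow> torus_map (\<lambda>\<phi>. u (\<phi> + a))"
  unfolding torus_map_def by (metis add.assoc add.commute)

lemma neumann_equation:
  fixes u :: "real^'m \<Rightarrow> complex"
  assumes c: "norm c < 1" and u: "smooth u" "torus_map u"
  shows "neumann c \<theta> u x = u x + c * neumann c \<theta> u (x + \<theta>)"
proof -
  obtain B where B: "\<And>x. norm (u x) \<le> B" using torus_map_bounded[OF u] by blast
  have sm: "summable (\<lambda>k. c ^ k * u (x + real k *\<^sub>R \<theta>))" for x
    using geometric_tail_bound(1)[OF c B] .
  have "(\<Sum>k. c ^ Suc k * u (x + real (Suc k) *\<^sub>R \<theta>)) = c * neumann c \<theta> u (x + \<theta>)"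
    unfolding neumann_def
    by (subst suminf_mult[OF sm, symmetric]) (simp add: algebra_simps)
  with suminf_split_head[OF sm[of x]] show ?thesis
    by (simp add: neumann_def algebra_simps)
qed

lemma torus_map_neumann:
  assumes "torus_map u"
  shows "torus_map (neumann c \<theta> u)"
  unfolding torus_map_def neumann_def
proof (intro allI)
  fix \<phi> j
  have "u (\<phi> + axis j (2 * pi) + a) = u (\<phi> + a)" for a
    using torus_map_compose_shift[OF assms, of a] unfolding torus_map_def by blast
  then show "(\<Sum>k. c ^ k * u (\<phi> + axis j (2 * pi) + real k *\<^sub>R \<theta>)) = (\<Sum>k. c ^ k * u (\<phi> + real k *\<^sub>R \<theta>))"
    by presburger
qed

text \<open>For |\<mu>| < 1 the equation is read as w(\<phi>) = u(\<phi> - \<theta>) + \<mu>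
  w(\<phi> - \<theta>), for |\<mu>| > 1 as w(\<phi>) = - u(\<phi>)/\<mu> + w(\<phi> +
  \<theta>)/\<mu>. Either way the shifted term carries a factor of modulus below 1 and the Neumann
  series converges.\<close>

lemma shift_equation_linear:
  fixes u :: "real^'m \<Rightarrow> complex"
  assumes \<mu>: "norm \<mu> \<noteq> 1" and u: "smooth u" "torus_map u"
  obtains w where "smooth w" "torus_map w" "\<And>\<phi>. w (\<phi> + \<theta>) - \<mu> * w \<phi> = u \<phi>"
proof (cases "norm \<mu> < 1")
  case True
  define u' where "u' \<phi> = u (\<phi> - \<theta>)" for \<phi>
  have u': "smooth u'" "torus_map u'"
    using torus_map_compose_shift[OF u(2), of "- \<theta>"]
    unfolding u'_def by (auto intro!: smooth_compose[OF u(1)] smooth_intros)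
  show ?thesis
  proof
    show "smooth (neumann \<mu> (- \<theta>) u')" by (rule smooth_neumann[OF True u'])
    show "torus_map (neumann \<mu> (- \<theta>) u')"
      by (rule torus_map_neumann[OF u'(2)])
    show "neumann \<mu> (- \<theta>) u' (\<phi> + \<theta>) - \<mu> * neumann \<mu> (- \<theta>) u' \<phi> = u \<phi>" for \<phi>
      using neumann_equation[OF True u', of "- \<theta>" "\<phi> + \<theta>"] by (simp add: u'_def)
  qed
next
  case False
  with \<mu> have c: "norm (inverse \<mu>) < 1" "\<mu> \<noteq> 0" by (auto simp: norm_inverse inverse_less_1_iff)
  define u' where "u' \<phi> = - inverse \<mu> * u \<phi>" for \<phi>
  have u': "smooth u'" "torus_map u'"
    using u(2) unfolding u'_def by (auto intro!: smooth_intros u(1) simp: torus_map_def)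
  show ?thesis
  proof
    show "smooth (neumann (inverse \<mu>) \<theta> u')" by (rule smooth_neumann[OF c(1) u'])
    show "torus_map (neumann (inverse \<mu>) \<theta> u')"
      by (rule torus_map_neumann[OF u'(2)])
    show "neumann (inverse \<mu>) \<theta> u' (\<phi> + \<theta>) - \<mu> * neumann (inverse \<mu>) \<theta> u' \<phi> = u \<phi>" for \<phi>
      using neumann_equation[OF c(1) u', of \<theta> "\<phi>"] c(2) by (simp add: u'_def divide_simps)
        (simp add: algebra_simps)
  qed
qed

text \<open>A polynomial in an operator, seen through the values \<open>a k\<close> of the iterates.
  The same calculus serves polynomials in the shift and in a matrix; \<open>polysum_mult\<close> is
  the law of composition, since iterates add their indices.\<close>

definition polysum :: "'a::comm_ring_1 poly \<Rightarrow> (nat \<Rightarrow> 'a) \<Rightarrow> 'a" where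
  "polysum p a = (\<Sum>k\<le>degree p. coeff p k * a k)"

lemma polysum_le: "degree p \<le> N \<Longrightarrow> polysum p a = (\<Sum>k\<le>N. coeff p k * a k)"
  unfolding polysum_def by (rule sum.mono_neutral_left) (auto simp: coeff_eq_0)

lemma polysum_add: "polysum (p + q) a = polysum p a + polysum q a"
proof -
  let ?N = "max (degree p) (degree q)"
  have "polysum (p + q) a = (\<Sum>k\<le>?N. coeff (p + q) k * a k)"
    by (rule polysum_le[OF degree_add_le_max])
  then show ?thesis
    using polysum_le[of p ?N a] polysum_le[of q ?N a] by (simp add: algebra_simps sum.distrib)
qed

lemma polysum_smult: "polysum (smult c p) a = c * polysum p a"
  using polysum_le[OF degree_smult_le, of c p a] by (simp add: polysum_def sum_distrib_left mult.assoc)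

lemma polysum_pCons: "polysum (pCons c p) a = c * a 0 + polysum p (\<lambda>k. a (Suc k))"
  using polysum_le[OF degree_pCons_le, of c p a]
  by (simp add: polysum_def sum.atMost_Suc_shift del: sum.atMost_Suc)

lemma polysum_0: "polysum 0 a = 0"
  by (simp add: polysum_def)

lemma polysum_mult: "polysum (p * q) a = polysum p (\<lambda>k. polysum q (\<lambda>l. a (k + l)))"
  by (induction p arbitrary: a)
    (simp_all add: polysum_0 mult_pCons_left polysum_add polysum_smult polysum_pCons)

lemma polysum_cmult: "polysum p (\<lambda>k. c * a k) = c * polysum p a"
  by (simp add: polysum_def sum_distrib_left mult.left_commute)

lemma polysum_linear_mult:
  "polysum ([:- \<mu>, 1:] * q) a = polysum q (\<lambda>k. a (Suc k) - \<mu> * a k)"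
  by (subst mult.commute, subst polysum_mult)
    (simp add: polysum_pCons polysum_0 algebra_simps)

text \<open>Over the complex numbers a linear factor splits off. The cofactor is inverted by
  induction, and the linear factor by \<open>shift_equation_linear\<close>, as its root is off the
  unit circle.\<close>

lemma shift_equation_poly:
  fixes u :: "real^'m \<Rightarrow> complex" and p :: "complex poly"
  assumes "\<And>\<mu>. norm \<mu> = 1 \<Longrightarrow> poly p \<mu> \<noteq> 0" "smooth u" "torus_map u"
  shows "\<exists>w. smooth w \<and> torus_map w \<and> (\<forall>\<phi>. polysum p (\<lambda>k. w (\<phi> + real k *\<^sub>R \<theta>)) = u \<phi>)"
  using assms
proof (induction "degree p" arbitrary: p u)
  case 0
  then obtain c where p: "p = [:c:]" by (metis degree_eq_zeroE)
  with 0(2)[of 1] have "c \<noteq> 0" by simp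
  with p 0(3,4) show ?case
    by (intro exI[of _ "\<lambda>\<phi>. inverse c * u \<phi>"])
      (auto simp: polysum_pCons polysum_0 torus_map_def intro!: smooth_intros)
next
  case (Suc n)
  then obtain \<mu> where "poly p \<mu> = 0"
    by (metis constant_degree fundamental_theorem_of_algebra nat.distinct(1))
  then obtain q where p: "p = [:- \<mu>, 1:] * q" by (metis dvdE poly_eq_0_iff_dvd)
  have "p \<noteq> 0" using Suc.prems(1)[of 1] by auto
  then have "n = degree q" using Suc(2) by (auto simp: p degree_mult_eq simp del: mult_pCons_left)
  moreover have "poly q \<nu> \<noteq> 0" if "norm \<nu> = 1" for \<nu> using Suc.prems(1)[OF that] by (simp add: p)
  ultimately obtain w1 where w1: "smooth w1" "torus_map w1"
      "\<And>\<phi>. polysum q (\<lambda>k. w1 (\<phi> + real k *\<^sub>R \<theta>)) = u \<phi>"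
    using Suc.hyps(1)[of q u] Suc.prems by blast
  have "norm \<mu> \<noteq> 1" using \<open>poly p \<mu> = 0\<close> Suc.prems(1) by blast
  then obtain w where w: "smooth w" "torus_map w" "\<And>\<phi>. w (\<phi> + \<theta>) - \<mu> * w \<phi> = w1 \<phi>"
    using shift_equation_linear w1 by blast
  have "w (\<phi> + real (Suc k) *\<^sub>R \<theta>) - \<mu> * w (\<phi> + real k *\<^sub>R \<theta>) = w1 (\<phi> + real k *\<^sub>R \<theta>)" for \<phi> k
    using w(3)[of "\<phi> + real k *\<^sub>R \<theta>"] by (simp add: algebra_simps)
  then show ?case using w w1(3) unfolding p polysum_linear_mult by auto
qed

text \<open>Each component is solved over the complex numbers, where \<open>p\<close> splits. As
  \<open>p\<close> and \<open>u\<close> are real, the real part of a solution is a solution.\<close>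

lemma shift_equation_real:
  fixes u :: "real^'m \<Rightarrow> real^'n" and p :: "real poly"
  assumes "\<And>\<mu>::complex. norm \<mu> = 1 \<Longrightarrow> poly (map_poly of_real p) \<mu> \<noteq> 0" "smooth u" "torus_map u"
  obtains w :: "real^'m \<Rightarrow> real^'n" where "smooth w" "torus_map w"
    "\<And>\<phi>. (\<Sum>k\<le>degree p. coeff p k *\<^sub>R w (\<phi> + real k *\<^sub>R \<theta>)) = u \<phi>"
proof -
  have "\<exists>w. smooth w \<and> torus_map w \<and>
      (\<forall>\<phi>. polysum (map_poly of_real p) (\<lambda>k. w (\<phi> + real k *\<^sub>R \<theta>)) = complex_of_real (u \<phi> $ i))" for i
    using assms by (intro shift_equation_poly)
      (auto simp: torus_map_def intro!: smooth_bounded_linear[OF bounded_linear_of_real] smooth_vec_nth)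
  then obtain w where w: "\<And>i. smooth (w i)" "\<And>i. torus_map (w i)"
    "\<And>i \<phi>. polysum (map_poly of_real p) (\<lambda>k. w i (\<phi> + real k *\<^sub>R \<theta>)) = complex_of_real (u \<phi> $ i)"
    by metis
  show ?thesis
  proof (rule that[of "\<lambda>\<phi>. \<chi> i. Re (w i \<phi>)"])
    show "smooth (\<lambda>\<phi>. \<chi> i. Re (w i \<phi>))"
      by (intro smooth_vec smooth_bounded_linear[OF bounded_linear_Re] w)
    show "torus_map (\<lambda>\<phi>. \<chi> i. Re (w i \<phi>))" using w(2) by (simp add: torus_map_def)
    show "(\<Sum>k\<le>degree p. coeff p k *\<^sub>R (\<chi> i. Re (w i (\<phi> + real k *\<^sub>R \<theta>)))) = u \<phi>" for \<phi>
    proof (rule vec_eq_iff[THEN iffD2], intro allI)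
      fix i
      have "Re (polysum (map_poly of_real p) (\<lambda>k. w i (\<phi> + real k *\<^sub>R \<theta>))) = u \<phi> $ i"
        using w(3) by simp
      then show "(\<Sum>k\<le>degree p. coeff p k *\<^sub>R (\<chi> i. Re (w i (\<phi> + real k *\<^sub>R \<theta>)))) $ i = u \<phi> $ i"
        by (simp add: polysum_def coeff_map_poly degree_map_poly)
    qed
  qed
qed

section \<open>Annihilating polynomials of the monodromy matrix\<close>

lemma poly_det:
  fixes A :: "('a::comm_ring_1 poly)^'n::finite^'n"
  shows "poly (det A) z = det (\<chi> i k. poly (A $ i $ k) z)"
proof -
  have "poly (of_int i) z = of_int i" for i :: int
    by (cases i rule: int_cases2) (simp_all add: of_nat_poly)
  then show ?thesis
    by (simp add: det_def poly_sum poly_prod)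
qed

lemma det_nonzero_imp_injective:
  fixes A :: "'a::field^'n^'n"
  assumes "det A \<noteq> 0" "A *v x = 0"
  shows "x = 0"
proof -
  obtain B where "B ** A = mat 1"
    using assms(1) invertible_det_nz[of A] unfolding invertible_def by blast
  then show ?thesis
    using assms(2) by (metis matrix_vector_mul_assoc matrix_vector_mul_lid matrix_vector_mult_0_right)
qed

lemma injective_imp_det_nonzero:
  fixes A :: "'a::field^'n^'n"
  assumes "\<And>x. A *v x = 0 \<Longrightarrow> x = 0"
  shows "det A \<noteq> 0"
proof -
  have "\<exists>B. B ** A = mat 1" using assms unfolding matrix_left_invertible_ker by simp
  then show ?thesis by (simp add: invertible_left_inverse flip: invertible_det_nz)
qed

text \<open>DIM + 1 vectors are dependent. Dependence is a property of sets, so a repetition in the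
  sequence is treated apart, with coefficients 1 and -1.\<close>

lemma finite_dim_sequence_dependent:
  fixes f :: "nat \<Rightarrow> 'a::euclidean_space"
  shows "\<exists>N a. (\<exists>k\<le>N. a k \<noteq> 0) \<and> (\<Sum>k\<le>N. a k *\<^sub>R f k) = 0"
proof (cases "inj_on f {..DIM('a)}")
  case True
  have "dependent (f ` {..DIM('a)})"
    by (rule dependent_biggerset) (simp add: card_image True)
  then obtain u where u: "\<exists>v\<in>f ` {..DIM('a)}. u v \<noteq> 0" "(\<Sum>v\<in>f ` {..DIM('a)}. u v *\<^sub>R v) = 0"
    by (auto simp: real_vector.dependent_finite)
  then show ?thesis
    by (intro exI[of _ "DIM('a)"] exI[of _ "\<lambda>k. u (f k)"])
      (auto simp: sum.reindex[OF True])
next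
  case False
  then obtain i k where ik: "f i = f k" "i \<noteq> k" by (auto simp: inj_on_def)
  let ?a = "\<lambda>l. of_bool (l = i) - of_bool (l = k) :: real"
  have "?a l *\<^sub>R f l = (if l = i then f l else 0) - (if l = k then f l else 0)" for l
    by auto
  then have "(\<Sum>l\<le>max i k. ?a l *\<^sub>R f l) = 0"
    using ik by (simp add: sum_subtractf del: scaleR_left_diff_distrib)
  then show ?thesis
    using ik by (intro exI[of _ "max i k"] exI[of _ ?a]) (auto intro!: exI[of _ i])
qed

text \<open>Iterates acting on vectors: the form in which the propagator over \<open>k\<close>
  periods appears in \<open>fundamental_solution_matpow\<close>.\<close>

definition matpow :: "'a::semiring_1^'n^'n \<Rightarrow> nat \<Rightarrow> 'a^'n \<Rightarrow> 'a^'n::finite" where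
  "matpow A k = ((*v) A) ^^ k"

definition polymat :: "'a::comm_ring_1 poly \<Rightarrow> 'a^'n^'n \<Rightarrow> 'a^'n \<Rightarrow> 'a^'n::finite" where
  "polymat p A x = (\<chi> i. polysum p (\<lambda>k. matpow A k x $ i))"

lemma matpow_linear: "Vector_Spaces.linear (*s) (*s) (matpow (A :: 'a::field^'n^'n::finite) k)"
proof (induction k)
  case 0
  then show ?case by (simp add: matpow_def vec.linear_id[unfolded id_def] id_def)
next
  case (Suc k)
  have "matpow A (Suc k) = (*v) A \<circ> matpow A k" by (simp add: matpow_def)
  with Vector_Spaces.linear_compose[OF Suc matrix_vector_mul_linear_gen] show ?case by metis
qed

lemma polymat_sum: "polymat p A x = (\<Sum>k\<le>degree p. coeff p k *s matpow A k x)"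
  by (simp add: polymat_def polysum_def vec_eq_iff)

lemma polymat_mult:
  fixes A :: "'a::field^'n^'n::finite"
  shows "polymat (p * q) A x = polymat p A (polymat q A x)"
proof -
  have "matpow A k (polymat q A x) $ i = polysum q (\<lambda>l. matpow A (k + l) x $ i)" for k i
  proof -
    have "matpow A k (polymat q A x) = (\<Sum>l\<le>degree q. coeff q l *s matpow A k (matpow A l x))"
      by (simp add: polymat_sum vec.linear_sum[OF matpow_linear] vec.linear_scale[OF matpow_linear])
    then show ?thesis by (simp add: polysum_def matpow_def funpow_add)
  qed
  then show ?thesis
    by (subst (1 2) polymat_def) (simp add: polysum_mult)
qed

lemma polymat_linear_factor:
  fixes A :: "'a::field^'n^'n::finite"
  shows "polymat [:- \<mu>, 1:] A x = A *v x - \<mu> *s x"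
  by (simp add: polymat_def polysum_pCons polysum_0 matpow_def vec_eq_iff)

lemma polymat_scale:
  fixes A :: "'a::field^'n^'n::finite"
  shows "polymat p A (a *s x) = a *s polymat p A x"
  by (simp add: polymat_def vec.linear_scale[OF matpow_linear] vec_eq_iff polysum_cmult)

lemma polymat_eigenvector:
  fixes A :: "'a::field^'n^'n::finite"
  assumes "A *v x = x"
  shows "polymat p A x = poly p 1 *s x"
proof -
  have "matpow A k x = x" for k by (induction k) (simp_all add: matpow_def assms)
  then show ?thesis by (simp add: polymat_def vec_eq_iff polysum_def poly_altdef sum_distrib_right)
qed

lemma annihilating_poly:
  fixes A :: "complex^'n^'n::finite"
  shows "\<exists>p. p \<noteq> 0 \<and> (\<forall>x. polymat p A x = 0)"
proof -
  define B where "B k = (((**) A) ^^ k) (mat 1)" for k :: nat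
  have B: "B k *v x = matpow A k x" for k x
    by (induction k) (simp_all add: B_def matpow_def matrix_vector_mul_assoc[symmetric])
  \<comment> \<open>The powers of \<open>A\<close> form an infinite sequence in a space of finite
    real dimension, so they satisfy a nontrivial relation, even with real coefficients.\<close>
  obtain N a where a: "\<exists>k\<le>N. a k \<noteq> 0" "(\<Sum>k\<le>N. a k *\<^sub>R B k) = 0"
    using finite_dim_sequence_dependent by blast
  define p where "p = (\<Sum>k\<le>N. monom (complex_of_real (a k)) k)"
  have coeff: "coeff p k = (if k \<le> N then complex_of_real (a k) else 0)" for k
    by (simp add: p_def coeff_sum)
  have "p \<noteq> 0" using a(1) coeff by (metis coeff_0 of_real_eq_0_iff)
  moreover have "polymat p A x = 0" for x
  proof -
    have "degree p \<le> N" by (rule degree_le) (simp add: coeff)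
    then have "polymat p A x = (\<chi> i. \<Sum>k\<le>N. a k *\<^sub>R (matpow A k x $ i))"
      by (simp add: polymat_def polysum_le coeff scaleR_conv_of_real)
    also have "\<dots> = (\<Sum>k\<le>N. a k *\<^sub>R B k) *v x"
      by (simp add: B[symmetric] vec_eq_iff matrix_vector_mult_def sum_distrib_right scaleR_sum_right sum.swap[of _ "{..N}"])
    finally show ?thesis using a(2) by simp
  qed
  ultimately show ?thesis by blast
qed

text \<open>If \<open>v\<close> and \<open>y\<close> are independent with \<open>M v = v\<close> and \<open>M y = y + \<alpha> v\<close>, replacing two rows of
  the identity by \<open>v\<close> and \<open>y\<close> gives an invertible \<open>Q\<close> for which two rows of
  \<open>Q (z I - M)\<^sup>T\<close> produce the factor \<open>(z - 1)\<^sup>2\<close> of the determinant.\<close>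

lemma two_rows_det:
  fixes P :: "(complex poly)^'n^'n::finite"
  assumes v: "v $ i1 \<noteq> 0" and y: "y $ i2 \<noteq> 0" "y $ i1 = 0"
    and Pv: "P *v (\<chi> i. [:v $ i:]) = [:-1, 1:] *s (\<chi> i. [:v $ i:])"
    and Py: "P *v (\<chi> i. [:y $ i:]) = [:-1, 1:] *s (\<chi> i. [:y $ i:]) - [:\<alpha>:] *s (\<chi> i. [:v $ i:])"
  shows "[:-1, 1:] ^ 2 dvd det P"
proof -
  have ne: "i1 \<noteq> i2" using y by auto
  define Q :: "complex^'n^'n" where
    "Q = (\<chi> i. if i = i1 then v else if i = i2 then y else axis i 1)"
  define Qp where "Qp = (\<chi> i k. [:Q $ i $ k:])"
  have detQ: "det Q \<noteq> 0"
  proof (rule injective_imp_det_nonzero)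
    fix x assume x: "Q *v x = 0"
    have row: "(Q *v x) $ i = (\<Sum>k\<in>UNIV. Q $ i $ k * x $ k)" for i
      by (simp add: matrix_vector_mult_def)
    \<comment> \<open>The remaining rows are unit vectors, so \<open>x\<close> is supported on
      \<open>i1\<close> and \<open>i2\<close>; there \<open>y $ i1 = 0\<close> makes the system
      triangular.\<close>
    have *: "x $ i = 0" if "i \<noteq> i1" "i \<noteq> i2" for i
      using row[of i] that x by (simp add: Q_def axis_def if_distrib[of "\<lambda>a. a * _"] cong: if_cong)
    have "(\<Sum>k\<in>UNIV. y $ k * x $ k) = (\<Sum>k\<in>{i2}. y $ k * x $ k)"
    proof (intro sum.mono_neutral_right ballI)
      show "y $ i * x $ i = 0" if "i \<in> UNIV - {i2}" for i
        using * y(2) that by (cases "i = i1") auto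
    qed auto
    then have 2: "x $ i2 = 0" using row[of i2] ne x y(1) by (simp add: Q_def)
    have "(\<Sum>k\<in>UNIV. v $ k * x $ k) = (\<Sum>k\<in>{i1}. v $ k * x $ k)"
      using * 2 by (intro sum.mono_neutral_right) auto
    then have "x $ i1 = 0" using row[of i1] x v by (simp add: Q_def)
    with * 2 show "x = 0" by (metis vec_eq_iff zero_index)
  qed
  have detQp: "det Qp = [:det Q:]"
    by (rule poly_eq_poly_eq_iff[THEN iffD1]) (simp add: fun_eq_iff poly_det Qp_def)
  let ?v = "\<chi> i. [:v $ i:]" and ?y = "\<chi> i. [:y $ i:]"
  define N where "N = Qp ** transpose P"
  define rest where "rest i = N $ i" for i
  have row1: "N $ i1 = [:-1, 1:] *s ?v"
    unfolding Pv[symmetric]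
    by (simp add: N_def Qp_def Q_def vec_eq_iff matrix_matrix_mult_def transpose_def matrix_vector_mult_def mult.commute)
  have row2: "N $ i2 = [:-1, 1:] *s ?y - [:\<alpha>:] *s ?v"
    unfolding Py[symmetric] using ne
    by (simp add: N_def Qp_def Q_def vec_eq_iff matrix_matrix_mult_def transpose_def matrix_vector_mult_def mult.commute)
  define N1 where "N1 = (\<chi> i. if i = i1 then ?v else N $ i)"
  define N2 where "N2 = (\<chi> i. if i = i2 then ?y else N1 $ i)"
  have "N = (\<chi> i. if i = i1 then [:-1, 1:] *s ?v else N $ i)"
    using row1 by (subst vec_eq_iff) simp
  then have "det N = det (\<chi> i. if i = i1 then [:-1, 1:] *s ?v else N $ i)" by metis
  also have "\<dots> = [:-1, 1:] * det N1"
    unfolding N1_def by (rule det_row_mul)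
  \<comment> \<open>Row \<open>i1\<close> has already lost its factor z - 1 and equals
    \<open>v\<close>. Adding \<alpha> times this row to row \<open>i2\<close> cancels - \<alpha> v
    and leaves z - 1 times \<open>y\<close>.\<close>
  also have "det N1 = det (\<chi> i. if i = i2 then row i2 N1 + [:\<alpha>:] *s row i1 N1 else row i N1)"
    using det_row_operation[of i2 i1 N1 "[:\<alpha>:]"] ne by simp
  also have "(\<chi> i. if i = i2 then row i2 N1 + [:\<alpha>:] *s row i1 N1 else row i N1) =
      (\<chi> i. if i = i2 then [:-1, 1:] *s ?y else N1 $ i)"
  proof (subst vec_eq_iff, intro allI)
    fix i
    have r: "row i N1 = N1 $ i" for i by (simp add: row_def vec_eq_iff)
    have "N1 $ i2 + [:\<alpha>:] *s N1 $ i1 = [:-1, 1:] *s ?y"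
      using ne row2 by (simp add: N1_def)
    then show "(\<chi> i. if i = i2 then row i2 N1 + [:\<alpha>:] *s row i1 N1 else row i N1) $ i =
      (\<chi> i. if i = i2 then [:-1, 1:] *s ?y else N1 $ i) $ i"
      by (simp only: vec_lambda_beta r split: if_split)
  qed
  also have "det \<dots> = [:-1, 1:] * det N2"
    unfolding N2_def by (rule det_row_mul)
  finally have "det N = [:-1, 1:] ^ 2 * det N2" by (simp only: power2_eq_square mult.assoc)
  moreover have "det N = smult (det Q) (det P)"
    by (simp add: N_def det_mul detQp)
  ultimately have "[:-1, 1:] ^ 2 dvd smult (det Q) (det P)" by (metis dvd_triv_left)
  then show ?thesis using detQ by (rule dvd_smult_cancel)
qed

section \<open>Complexification and the characteristic matrix of a block\<close>

definition cmat :: "real^'n^'m \<Rightarrow> complex^'n^'m" where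
  "cmat M = (\<chi> i k. complex_of_real (M $ i $ k))"

definition cvec :: "real^'n \<Rightarrow> complex^'n" where
  "cvec x = (\<chi> i. complex_of_real (x $ i))"

lemma cmat_mult_cvec: "cmat M *v cvec x = cvec (M *v x)"
  by (simp add: cmat_def cvec_def vec_eq_iff matrix_vector_mult_def)

lemma matpow_cmat: "matpow (cmat M) k (cvec x) = cvec (matpow M k x)"
  by (induction k) (simp_all add: matpow_def cmat_mult_cvec)

definition charmat :: "('n::finite \<Rightarrow> 'm) \<Rightarrow> 'm \<Rightarrow> real^'n^'n \<Rightarrow> (complex poly)^'n^'n" where
  "charmat c j M = (\<chi> i i'. if c i = j \<and> c i' = j
                  then (if i = i' then [:0, 1:] else 0) - [:complex_of_real (M $ i $ i'):]
                  else if i = i' then 1 else 0)"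

lemma charpoly_blk_det: "charpoly_blk c j M = det (charmat c j M)"
  by (simp add: charpoly_blk_def charmat_def)

lemma factor_invariant_entry:
  assumes "\<And>x. x \<in> factor c j \<Longrightarrow> M *v x \<in> factor c j" "c i \<noteq> j" "c k = j"
  shows "M $ i $ k = 0"
proof -
  have "axis k 1 \<in> factor c j" using assms(3) by (auto simp: factor_def axis_def)
  from assms(1)[OF this] assms(2) have "(M *v axis k 1) $ i = 0" by (auto simp: factor_def)
  then show ?thesis by (simp add: matrix_vector_mult_basis column_def)
qed

text \<open>On vectors supported in the block the completed matrix acts like z - M. Off the block
  both sides vanish, because \<open>M\<close> leaves the factor invariant.\<close>

lemma charmat_mult:
  assumes inv: "\<And>x. x \<in> factor c j \<Longrightarrow> M *v x \<in> factor c j"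
    and x: "\<And>i. c i \<noteq> j \<Longrightarrow> x $ i = 0"
  shows "charmat c j M *v (\<chi> i. [:x $ i:]) = [:0, 1:] *s (\<chi> i. [:x $ i:]) - (\<chi> i. [:(cmat M *v x) $ i:])"
proof (subst vec_eq_iff, intro allI)
  fix i
  have const_sum: "[:\<Sum>k\<in>UNIV. f k:] = (\<Sum>k\<in>UNIV. [:f k:])" for f :: "'a \<Rightarrow> complex"
    by (rule poly_eqI) (simp add: coeff_sum coeff_pCons split: nat.split)
  show "(charmat c j M *v (\<chi> i. [:x $ i:])) $ i =
      ([:0, 1:] *s (\<chi> i. [:x $ i:]) - (\<chi> i. [:(cmat M *v x) $ i:])) $ i"
  proof (cases "c i = j")
    case True
    have "charmat c j M $ i $ k * [:x $ k:] =
        (if i = k then [:0, 1:] * [:x $ k:] else 0) - [:cmat M $ i $ k * x $ k:]" for k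
      using x[of k] True by (cases "c k = j") (auto simp: charmat_def cmat_def algebra_simps)
    then show ?thesis
      by (simp add: matrix_vector_mult_def const_sum sum_subtractf)
  next
    case False
    have "charmat c j M $ i $ k * [:x $ k:] = 0" "cmat M $ i $ k * x $ k = 0" for k
      using x[of k] x[of i] factor_invariant_entry[OF inv, of i k] False
      by (auto simp: charmat_def cmat_def)
    then have "(\<Sum>k\<in>UNIV. charmat c j M $ i $ k * [:x $ k:]) = 0" "(\<Sum>k\<in>UNIV. cmat M $ i $ k * x $ k) = 0"
      by (auto intro!: sum.neutral simp del: mult_eq_0_iff mult_pCons_right)
    then show ?thesis using x[OF False] by (simp add: matrix_vector_mult_def del: mult_pCons_right)
  qed
qed

lemma charpoly_blk_eigenvalue:
  assumes inv: "\<And>x. x \<in> factor c j \<Longrightarrow> M *v x \<in> factor c j"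
    and x: "\<And>i. c i \<noteq> j \<Longrightarrow> x $ i = 0" "x \<noteq> 0" "cmat M *v x = \<mu> *s x"
  shows "poly (charpoly_blk c j M) \<mu> = 0"
proof (rule ccontr)
  define K where "K = (\<chi> i k. poly (charmat c j M $ i $ k) \<mu>)"
  assume "poly (charpoly_blk c j M) \<mu> \<noteq> 0"
  then have "det K \<noteq> 0" by (simp add: charpoly_blk_det poly_det K_def)
  moreover have "K *v x = 0"
  proof (subst vec_eq_iff, intro allI)
    fix i
    have "(K *v x) $ i = poly ((charmat c j M *v (\<chi> i. [:x $ i:])) $ i) \<mu>"
      by (simp add: K_def matrix_vector_mult_def poly_sum mult.commute)
    also have "\<dots> = 0" by (simp add: charmat_mult[OF inv x(1)] x(3))
    finally show "(K *v x) $ i = 0 $ i" by simp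
  qed
  ultimately have "x = 0" by (rule det_nonzero_imp_injective)
  with x(2) show False by simp
qed

text \<open>A multiple of \<open>v\<close> may be subtracted from \<open>y\<close>. For \<mu>
  \<noteq> 1 this leaves 0 or an eigenvector for \<mu>, and the latter is excluded by
  \<open>unit\<close>. For \<mu> = 1 a \<open>y\<close> independent of \<open>v\<close> would be a
  second eigenvector or the end of a Jordan chain, and 1 would be a multiple root. Thus modulo
  \<open>v\<close> there is no eigenvalue on the unit circle.\<close>

lemma hyperbolic_quotient:
  assumes inv: "\<And>x. x \<in> factor c j \<Longrightarrow> M *v x \<in> factor c j"
    and v: "v \<in> factor c j" "v \<noteq> 0" "M *v v = v"
    and simple: "order 1 (charpoly_blk c j M) = 1"
    and unit: "\<And>\<mu>. poly (charpoly_blk c j M) \<mu> = 0 \<Longrightarrow> cmod \<mu> = 1 \<Longrightarrow> \<mu> = 1"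
    and y: "\<And>i. c i \<noteq> j \<Longrightarrow> y $ i = 0" "cmod \<mu> = 1" "cmat M *v y - \<mu> *s y = \<alpha> *s cvec v"
  shows "\<exists>\<beta>. y = \<beta> *s cvec v"
proof -
  have cv: "cmat M *v cvec v = cvec v" by (simp add: cmat_mult_cvec v(3))
  have cv0: "cvec v $ i = 0" if "c i \<noteq> j" for i using v(1) that by (simp add: cvec_def factor_def)
  show ?thesis
  proof (cases "\<mu> = 1")
    case False
    \<comment> \<open>The solution of \<beta> = \<mu> \<beta> + \<alpha>, by which the tangential
      term disappears for \<open>y'\<close>.\<close>
    define \<beta> where "\<beta> = - \<alpha> / (\<mu> - 1)"
    define y' where "y' = y - \<beta> *s cvec v"
    have "cmat M *v y' = cmat M *v y - \<beta> *s cvec v"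
      by (simp add: y'_def matrix_vector_mult_diff_distrib vector_scalar_commute cv)
    also have "cmat M *v y = \<mu> *s y + \<alpha> *s cvec v" using y(3) by (simp add: algebra_simps)
    also have "\<mu> *s y + \<alpha> *s cvec v - \<beta> *s cvec v = \<mu> *s y'"
    proof -
      have "\<beta> * (\<mu> - 1) = - \<alpha>" using False by (simp add: \<beta>_def)
      then have "\<alpha> = \<beta> - \<mu> * \<beta>" by (simp add: algebra_simps)
      then show ?thesis by (simp only:) (simp add: y'_def vec_eq_iff algebra_simps)
    qed
    finally have "cmat M *v y' = \<mu> *s y'" .
    moreover have "y' $ i = 0" if "c i \<noteq> j" for i using y(1) cv0 that by (simp add: y'_def)
    ultimately have "y' = 0" using charpoly_blk_eigenvalue[OF inv, of y' \<mu>] unit y(2) False by blast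
    then show ?thesis by (auto simp: y'_def)
  next
    case True
    obtain i1 where i1: "cvec v $ i1 \<noteq> 0" using v(2) by (auto simp: cvec_def vec_eq_iff)
    \<comment> \<open>Normalized to vanish at \<open>i1\<close>, where \<open>v\<close> does not, so
      that \<open>y'\<close> is either 0 or independent of \<open>v\<close>.\<close>
    define y' where "y' = y - (y $ i1 / cvec v $ i1) *s cvec v"
    have y'0: "y' $ i = 0" if "c i \<noteq> j" for i using y(1) cv0 that by (simp add: y'_def)
    have "cmat M *v y' = cmat M *v y - (y $ i1 / cvec v $ i1) *s cvec v"
      by (simp add: y'_def matrix_vector_mult_diff_distrib vector_scalar_commute cv)
    also have "cmat M *v y = y + \<alpha> *s cvec v" using y(3) True by (simp add: algebra_simps)
    finally have My': "cmat M *v y' = y' + \<alpha> *s cvec v" by (simp add: y'_def algebra_simps)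
    have "y' = 0"
    proof (rule ccontr)
      assume "y' \<noteq> 0"
      then obtain i2 where i2: "y' $ i2 \<noteq> 0" by (auto simp: vec_eq_iff)
      have "[:-1, 1:] ^ 2 dvd det (charmat c j M)"
      proof (rule two_rows_det[OF i1 i2])
        show "y' $ i1 = 0" using i1 by (simp add: y'_def)
        show "charmat c j M *v (\<chi> i. [:cvec v $ i:]) = [:-1, 1:] *s (\<chi> i. [:cvec v $ i:])"
          by (simp add: charmat_mult[OF inv cv0] cv vec_eq_iff)
        show "charmat c j M *v (\<chi> i. [:y' $ i:]) =
            [:-1, 1:] *s (\<chi> i. [:y' $ i:]) - [:\<alpha>:] *s (\<chi> i. [:cvec v $ i:])"
          by (simp add: charmat_mult[OF inv y'0] My' vec_eq_iff)
      qed
      \<comment> \<open>\<open>order 1 0\<close> is unspecified, so \<open>simple\<close> does not exclude the zero polynomial.\<close>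
      moreover have "charpoly_blk c j M \<noteq> 0" using unit[of "- 1"] by auto
      ultimately have "2 \<le> order 1 (charpoly_blk c j M)"
        unfolding charpoly_blk_det by (simp add: order_divides)
      then show False using simple by simp
    qed
    then show ?thesis by (auto simp: y'_def)
  qed
qed

text \<open>The polynomial arises from an annihilating one by dividing out the zeros on the unit circle.\<close>

lemma hyperbolic_complex_polynomial:
  assumes inv: "\<And>x. x \<in> factor c j \<Longrightarrow> M *v x \<in> factor c j"
    and v: "v \<in> factor c j" "v \<noteq> 0" "M *v v = v"
    and simple: "order 1 (charpoly_blk c j M) = 1"
    and unit: "\<And>\<mu>. poly (charpoly_blk c j M) \<mu> = 0 \<Longrightarrow> cmod \<mu> = 1 \<Longrightarrow> \<mu> = 1"
  shows "\<exists>p. (\<forall>\<mu>. cmod \<mu> = 1 \<longrightarrow> poly p \<mu> \<noteq> 0) \<and>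
    (\<forall>x. (\<forall>i. c i \<noteq> j \<longrightarrow> x $ i = 0) \<longrightarrow> (\<exists>\<alpha>. polymat p (cmat M) x = \<alpha> *s cvec v))"
proof -
  have pow: "matpow (cmat M) k x $ i = 0" if "\<And>i. c i \<noteq> j \<Longrightarrow> x $ i = 0" "c i \<noteq> j" for x k i
    using that
  proof (induction k arbitrary: i)
    case (Suc k)
    have "cmat M $ i $ l * matpow (cmat M) k x $ l = 0" for l
      using Suc factor_invariant_entry[OF inv, of i l] by (cases "c l = j") (auto simp: cmat_def)
    then have "(\<Sum>l\<in>UNIV. cmat M $ i $ l * matpow (cmat M) k x $ l) = 0"
      by (intro sum.neutral) blast
    then show ?case by (simp add: matpow_def matrix_vector_mult_def)
  qed (simp add: matpow_def)
  obtain p0 where p0: "p0 \<noteq> 0" "\<And>x. polymat p0 (cmat M) x = 0" using annihilating_poly by blast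
  \<comment> \<open>The induction works with polynomials that map the block into the line of
    \<open>v\<close> instead of to 0: this weaker property survives the cancellation of a factor z -
    1.\<close>
  have "\<exists>p'. (\<forall>\<mu>. cmod \<mu> = 1 \<longrightarrow> poly p' \<mu> \<noteq> 0) \<and>
    (\<forall>x. (\<forall>i. c i \<noteq> j \<longrightarrow> x $ i = 0) \<longrightarrow> (\<exists>\<alpha>. polymat p' (cmat M) x = \<alpha> *s cvec v))"
    if "p \<noteq> 0" "\<forall>x. (\<forall>i. c i \<noteq> j \<longrightarrow> x $ i = 0) \<longrightarrow> (\<exists>\<alpha>. polymat p (cmat M) x = \<alpha> *s cvec v)" for p
    using that
  proof (induction "degree p" arbitrary: p rule: less_induct)
    case less
    show ?case
    proof (cases "\<forall>\<mu>. cmod \<mu> = 1 \<longrightarrow> poly p \<mu> \<noteq> 0")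
      case True
      then show ?thesis using less.prems(2) by blast
    next
      case False
      then obtain \<mu> where \<mu>: "cmod \<mu> = 1" "poly p \<mu> = 0" by blast
      then obtain q where q: "p = [:- \<mu>, 1:] * q" by (metis dvdE poly_eq_0_iff_dvd)
      with less.prems(1) have "q \<noteq> 0" by auto
      then have "degree q < degree p" by (simp add: q degree_mult_eq del: mult_pCons_left)
      moreover have "\<exists>\<beta>. polymat q (cmat M) x = \<beta> *s cvec v" if x: "\<forall>i. c i \<noteq> j \<longrightarrow> x $ i = 0" for x
      proof -
        obtain \<alpha> where "polymat p (cmat M) x = \<alpha> *s cvec v" using less.prems(2) x by blast
        then have "cmat M *v polymat q (cmat M) x - \<mu> *s polymat q (cmat M) x = \<alpha> *s cvec v"
          by (simp only: q polymat_mult polymat_linear_factor)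
        moreover have "polymat q (cmat M) x $ i = 0" if "c i \<noteq> j" for i
          using pow x that by (simp add: polymat_def polysum_def)
        ultimately show ?thesis using hyperbolic_quotient[OF inv v simple unit _ \<mu>(1)] by blast
      qed
      ultimately show ?thesis using less.hyps \<open>q \<noteq> 0\<close> by blast
    qed
  qed
  from this[OF p0(1)] p0(2) show ?thesis by (metis vec.scale_zero_left)
qed

text \<open>Multiplication by the conjugate polynomial makes the coefficients real. The new zeros
  are conjugates of old ones and so avoid the unit circle, and on the fixed vector \<open>v\<close>
  the additional factor acts as a scalar.\<close>

lemma hyperbolic_polynomial:
  fixes M :: "real^'n::finite^'n"
  assumes inv: "\<And>x. x \<in> factor c j \<Longrightarrow> M *v x \<in> factor c j"
    and v: "v \<in> factor c j" "v \<noteq> 0" "M *v v = v"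
    and simple: "order 1 (charpoly_blk c j M) = 1"
    and unit: "\<And>\<mu>. poly (charpoly_blk c j M) \<mu> = 0 \<Longrightarrow> cmod \<mu> = 1 \<Longrightarrow> \<mu> = 1"
  obtains r :: "real poly" where "\<And>\<mu>. cmod \<mu> = 1 \<Longrightarrow> poly (map_poly of_real r) \<mu> \<noteq> 0"
    "\<And>x. x \<in> factor c j \<Longrightarrow> \<exists>\<alpha>. (\<Sum>k\<le>degree r. coeff r k *\<^sub>R matpow M k x) = \<alpha> *\<^sub>R v"
proof -
  obtain p where p: "\<And>\<mu>. cmod \<mu> = 1 \<Longrightarrow> poly p \<mu> \<noteq> 0"
    "\<And>x. (\<And>i. c i \<noteq> j \<Longrightarrow> x $ i = 0) \<Longrightarrow> \<exists>\<alpha>. polymat p (cmat M) x = \<alpha> *s cvec v"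
    using hyperbolic_complex_polynomial[OF assms] by metis
  define q where "q = map_poly cnj p * p"
  define r where "r = map_poly Re q"
  have "map_poly cnj q = q"
    by (rule poly_eq_poly_eq_iff[THEN iffD1]) (simp add: fun_eq_iff q_def mult.commute)
  then have "cnj (coeff q k) = coeff q k" for k
    by (metis coeff_map_poly complex_cnj_zero)
  then have real: "complex_of_real (Re (coeff q k)) = coeff q k" for k
    by (simp add: complex_eq_iff)
  then have q: "map_poly of_real r = q"
    by (simp add: r_def poly_eq_iff coeff_map_poly)
  show ?thesis
  proof
    fix \<mu> :: complex assume "cmod \<mu> = 1"
    then show "poly (map_poly of_real r) \<mu> \<noteq> 0" using p(1)[of \<mu>] p(1)[of "cnj \<mu>"]
      by (simp add: q) (simp add: q_def)
  next
    fix x assume x: "x \<in> factor c j"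
    then obtain \<alpha> where \<alpha>: "polymat p (cmat M) (cvec x) = \<alpha> *s cvec v"
      using p(2)[of "cvec x"] by (auto simp: factor_def cvec_def)
    have "polymat q (cmat M) (cvec x) = (\<alpha> * poly (map_poly cnj p) 1) *s cvec v"
      using polymat_eigenvector[of "cmat M" "cvec v" "map_poly cnj p"]
      by (simp add: q_def polymat_mult \<alpha> polymat_scale cmat_mult_cvec v(3) vector_smult_assoc del: poly_map_poly_cnj)
    then have "polymat q (cmat M) (cvec x) $ i = (\<alpha> * poly (map_poly cnj p) 1) * complex_of_real (v $ i)" for i
      by (simp add: cvec_def)
    moreover have "Re (polymat q (cmat M) (cvec x) $ i) = (\<Sum>k\<le>degree r. coeff r k *\<^sub>R matpow M k x) $ i" for i
      unfolding q[symmetric] polymat_def polysum_def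
      by (simp add: coeff_map_poly degree_map_poly matpow_cmat) (simp add: cvec_def)
    ultimately have "(\<Sum>k\<le>degree r. coeff r k *\<^sub>R matpow M k x) $ i = Re (\<alpha> * poly (map_poly cnj p) 1) * v $ i" for i
      by (metis Re_complex_of_real mult.commute times_complex.sel(1) Im_complex_of_real mult_zero_left diff_0_right)
    then show "\<exists>\<alpha>. (\<Sum>k\<le>degree r. coeff r k *\<^sub>R matpow M k x) = \<alpha> *\<^sub>R v"
      by (auto simp: vec_eq_iff)
  qed
qed

section \<open>Linear differential equations\<close>

lemma bounded_bilinear_matrix_vector: "bounded_bilinear ((*v) :: real^'n^'m \<Rightarrow> _)"
  unfolding bilinear_conv_bounded_bilinear[symmetric] bilinear_def
  by (auto intro!: linearI simp: matrix_vector_mult_add_rdistrib scaleR_matrix_vector_assoc)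

lemma bounded_bilinear_matrix_matrix: "bounded_bilinear ((**) :: real^'n^'m \<Rightarrow> real^'k^'n \<Rightarrow> _)"
  unfolding bilinear_conv_bounded_bilinear[symmetric] bilinear_def
  by (auto intro!: linearI simp: matrix_add_ldistrib vec_eq_iff matrix_matrix_mult_def
      sum.distrib algebra_simps sum_distrib_left)

lemmas smooth_matrix_vector = smooth_bilinear[OF bounded_bilinear_matrix_vector]
lemmas smooth_matrix_matrix = smooth_bilinear[OF bounded_bilinear_matrix_matrix]

text \<open>Gronwall in energy form: if \<open>K\<close> bounds the operators \<open>A t\<close> on
  [0, b], then |y|^2 exp(- 2 K t) is nonincreasing there, and it starts at 0.\<close>

lemma linear_ode_zero_forward:
  fixes A :: "real \<Rightarrow> real^'n^'n"
  assumes A: "continuous_on UNIV A"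
    and y: "\<And>t. (y has_vector_derivative A t *v y t) (at t)" "y 0 = 0" and b: "b \<ge> 0"
  shows "y b = 0"
proof -
  obtain K0 where K0: "K0 \<ge> 0" "\<And>(B::real^'n^'n) x. norm (B *v x) \<le> norm B * norm x * K0"
    using bounded_bilinear.nonneg_bounded[OF bounded_bilinear_matrix_vector] by blast
  have "compact (A ` {0..b})"
    by (intro compact_continuous_image continuous_on_subset[OF A]) auto
  then obtain K1 where K1: "\<And>t. t \<in> {0..b} \<Longrightarrow> norm (A t) \<le> K1"
    by (metis bounded_iff compact_imp_bounded image_eqI)
  define K where "K = K0 * K1"
  define f where "f t = (y t \<bullet> y t) * exp (- (2 * K * t))" for t
  have "f b \<le> f 0"
  proof (rule DERIV_nonpos_imp_nonincreasing[OF b])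
    fix t assume t: "0 \<le> t" "t \<le> b"
    have "norm (A t *v y t) \<le> norm (A t) * norm (y t) * K0" by (rule K0)
    also have "\<dots> \<le> K1 * norm (y t) * K0" using K1[of t] t K0(1) by (intro mult_right_mono) auto
    finally have "norm (A t *v y t) \<le> K * norm (y t)" by (simp add: K_def mult_ac)
    then have "norm (y t) * norm (A t *v y t) \<le> norm (y t) * (K * norm (y t))"
      by (intro mult_left_mono) auto
    then have "y t \<bullet> (A t *v y t) \<le> K * (y t \<bullet> y t)"
      using norm_cauchy_schwarz[of "y t" "A t *v y t"] by (simp add: dot_square_norm power2_eq_square mult_ac)
    then have le: "(2 * (y t \<bullet> (A t *v y t)) - 2 * K * (y t \<bullet> y t)) * exp (- (2 * K * t)) \<le> 0"
      by (intro mult_nonpos_nonneg) auto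
    have "((\<lambda>t. y t \<bullet> y t) has_vector_derivative (y t \<bullet> (A t *v y t) + (A t *v y t) \<bullet> y t)) (at t)"
      by (rule bounded_bilinear.has_vector_derivative[OF bounded_bilinear_inner y(1) y(1)])
    then have "((\<lambda>t. y t \<bullet> y t) has_real_derivative 2 * (y t \<bullet> (A t *v y t))) (at t)"
      by (simp add: has_real_derivative_iff_has_vector_derivative inner_commute)
    then have "(f has_real_derivative (2 * (y t \<bullet> (A t *v y t)) - 2 * K * (y t \<bullet> y t)) * exp (- (2 * K * t))) (at t)"
      unfolding f_def by (auto intro!: derivative_eq_intros simp: algebra_simps)
    with le show "\<exists>d. (f has_real_derivative d) (at t) \<and> d \<le> 0" by blast
  qed
  then have "(y b \<bullet> y b) * exp (- (2 * K * b)) \<le> 0" by (simp add: f_def y(2))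
  then have "y b \<bullet> y b \<le> 0" by (simp add: mult_le_0_iff)
  then show ?thesis by (metis inner_ge_zero inner_eq_zero_iff order_antisym)
qed

lemma linear_ode_zero:
  fixes A :: "real \<Rightarrow> real^'n^'n"
  assumes A: "continuous_on UNIV A"
    and y: "\<And>t. (y has_vector_derivative A t *v y t) (at t)" "y 0 = 0"
  shows "y t = 0"
proof (cases "t \<ge> 0")
  case True
  then show ?thesis by (rule linear_ode_zero_forward[OF A y])
next
  case False
  have "(\<lambda>t. y (- t)) (- t) = 0"
  proof (rule linear_ode_zero_forward[where A = "\<lambda>t. - A (- t)" and y = "\<lambda>t. y (- t)"])
    show "continuous_on UNIV (\<lambda>t. - A (- t))"
      by (intro continuous_intros continuous_on_compose2[OF A]) auto
    show "((\<lambda>t. y (- t)) has_vector_derivative (- A (- t)) *v y (- t)) (at t)" for t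
    proof -
      have "((\<lambda>t. - t) has_vector_derivative - 1) (at t)" by (auto intro!: derivative_eq_intros)
      moreover have "(- A (- t)) *v y (- t) = - (A (- t) *v y (- t))"
        by (simp add: matrix_vector_mult_def vec_eq_iff sum_negf)
      ultimately show ?thesis using vector_diff_chain_at[OF _ y(1)] by (fastforce simp: o_def)
    qed
  qed (use False y(2) in auto)
  then show ?thesis by simp
qed

lemma linear_ode_unique:
  fixes A :: "real \<Rightarrow> real^'n^'n"
  assumes A: "continuous_on UNIV A"
    and y: "\<And>t. (y has_vector_derivative A t *v y t) (at t)"
    and z: "\<And>t. (z has_vector_derivative A t *v z t) (at t)" and "y 0 = z 0"
  shows "y t = z t"
proof -
  have "(\<lambda>t. y t - z t) t = 0"
    by (rule linear_ode_zero[OF A])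
      (use assms(4) in \<open>auto intro!: has_vector_derivative_diff[OF y z, THEN has_vector_derivative_eq_rhs]
        simp: matrix_vector_mult_diff_distrib\<close>)
  then show ?thesis by simp
qed

lemma fundamental_solution_derivative:
  assumes "principal_fundamental_solution A \<Phi>"
  shows "((\<lambda>t. \<Phi> t *v x) has_vector_derivative A t *v (\<Phi> t *v x)) (at t)"
  using bounded_linear.has_vector_derivative[OF
      bounded_bilinear.bounded_linear_left[OF bounded_bilinear_matrix_vector], of \<Phi> _ "at t" x] assms
  by (auto simp: principal_fundamental_solution_def matrix_vector_mul_assoc)

lemma smooth_fundamental_solution:
  assumes "smooth A" "principal_fundamental_solution A \<Phi>"
  shows "smooth \<Phi>"
proof (rule smooth_bootstrap)
  show "(\<Phi> has_vector_derivative A t ** \<Phi> t) (at t)" for t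
    using assms(2) by (simp add: principal_fundamental_solution_def)
  have "smooth (\<lambda>z :: real \<times> _. A (fst z) ** snd z)"
    by (intro smooth_matrix_matrix smooth_compose[OF assms(1)] smooth_intros)
  then show "smooth (\<lambda>(t, X). A t ** X)" by (simp add: case_prod_unfold)
qed

lemma smooth_det:
  fixes A :: "'a::euclidean_space \<Rightarrow> real^'n^'n"
  assumes "\<And>i k. smooth (\<lambda>x. A x $ i $ k)"
  shows "smooth (\<lambda>x. det (A x))"
  unfolding det_def by (intro smooth_sum smooth_mult smooth_prod smooth_const assms)

text \<open>By Cramer's rule the entries of the inverse are quotients of determinants, which are
  polynomials in the entries of \<open>A x\<close>.\<close>

lemma smooth_matrix_inverse:
  fixes A :: "'a::euclidean_space \<Rightarrow> real^'n^'n"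
  assumes A: "smooth A" and det: "\<And>x. det (A x) \<noteq> 0"
  obtains B where "smooth B" "\<And>x. A x ** B x = mat 1" "\<And>x. B x ** A x = mat 1"
proof -
  define N where "N k l x = (\<chi> a b. if b = l then axis k 1 $ a else A x $ a $ b)" for k l x
  define B where "B x = (\<chi> l k. det (N k l x) * inverse (det (A x)))" for x
  have entry: "smooth (\<lambda>x. A x $ i $ k)" for i k by (intro smooth_vec_nth A)
  have "smooth (\<lambda>x. N k l x $ i $ m)" for k l i m
    by (cases "m = l") (simp_all add: N_def smooth_const entry)
  then have "smooth B"
    unfolding B_def by (intro smooth_vec smooth_mult smooth_det smooth_inverse det entry) auto
  moreover have AB: "A x ** B x = mat 1" for x
  proof -
    have "A x *v column k (B x) = axis k 1" for k
      using cramer[OF det[of x], of "column k (B x)" "axis k 1"]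
      by (simp add: B_def N_def column_def divide_inverse)
    then have "(A x ** B x) $ i $ k = mat 1 $ i $ k" for i k
      by (auto simp: matrix_matrix_mult_def matrix_vector_mult_def column_def vec_eq_iff axis_def mat_def)
    then show ?thesis by (simp add: vec_eq_iff)
  qed
  moreover have "B x ** A x = mat 1" for x using AB matrix_left_right_inverse by blast
  ultimately show ?thesis by (rule that)
qed

text \<open>By uniqueness a vector that is mapped to 0 at time \<open>t\<close> is mapped to 0 at
  every time, also at time 0, where \<Phi> is the identity.\<close>

lemma fundamental_solution_det:
  assumes "continuous_on UNIV A" "principal_fundamental_solution A \<Phi>"
  shows "det (\<Phi> t) \<noteq> 0"
proof (rule injective_imp_det_nonzero)
  fix x assume x: "\<Phi> t *v x = 0"
  have "(\<lambda>s. \<Phi> (s + t) *v x) (- t) = 0"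
  proof (rule linear_ode_zero[where A = "\<lambda>s. A (s + t)" and y = "\<lambda>s. \<Phi> (s + t) *v x"])
    show "continuous_on UNIV (\<lambda>s. A (s + t))"
      by (intro continuous_on_compose2[OF assms(1)] continuous_intros) auto
    show "((\<lambda>s. \<Phi> (s + t) *v x) has_vector_derivative A (s + t) *v (\<Phi> (s + t) *v x)) (at s)" for s
    proof -
      have "((\<lambda>s. s + t) has_vector_derivative 1) (at s)" by (auto intro!: derivative_eq_intros)
      from vector_diff_chain_at[OF this fundamental_solution_derivative[OF assms(2)]] show ?thesis
        by (simp add: o_def)
    qed
  qed (simp add: x)
  then show "x = 0" using assms(2) by (simp add: principal_fundamental_solution_def)
qed

lemma fundamental_solution_period:
  assumes "continuous_on UNIV A" "\<And>t. A (t + T) = A t" "principal_fundamental_solution A \<Phi>"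
  shows "\<Phi> (t + T) *v x = \<Phi> t *v (\<Phi> T *v x)"
proof (rule linear_ode_unique[OF assms(1), where y = "\<lambda>t. \<Phi> (t + T) *v x" and z = "\<lambda>t. \<Phi> t *v (\<Phi> T *v x)"])
  show "((\<lambda>t. \<Phi> (t + T) *v x) has_vector_derivative A t *v (\<Phi> (t + T) *v x)) (at t)" for t
  proof -
    have "((\<lambda>s. s + T) has_vector_derivative 1) (at t)" by (auto intro!: derivative_eq_intros)
    from vector_diff_chain_at[OF this fundamental_solution_derivative[OF assms(3)]] show ?thesis
      by (simp add: o_def assms(2))
  qed
  show "((\<lambda>t. \<Phi> t *v (\<Phi> T *v x)) has_vector_derivative A t *v (\<Phi> t *v (\<Phi> T *v x))) (at t)" for t
    by (rule fundamental_solution_derivative[OF assms(3)])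
qed (use assms(3) in \<open>simp add: principal_fundamental_solution_def\<close>)

lemma fundamental_solution_matpow:
  assumes "continuous_on UNIV A" "\<And>t. A (t + T) = A t" "principal_fundamental_solution A \<Phi>"
  shows "\<Phi> (t + real k * T) *v x = \<Phi> t *v matpow (\<Phi> T) k x"
proof (induction k arbitrary: x)
  case (Suc k)
  have "\<Phi> (t + real (Suc k) * T) *v x = \<Phi> ((t + real k * T) + T) *v x"
    by (simp add: algebra_simps)
  also have "\<dots> = \<Phi> t *v matpow (\<Phi> T) k (\<Phi> T *v x)"
    by (simp only: fundamental_solution_period[OF assms] Suc)
  finally show ?case by (simp add: matpow_def funpow_swap1)
qed (simp add: matpow_def)

text \<open>A vanishing row of \<open>A\<close> makes this component of every solution constant.
  Consequently \<Phi> leaves the factor invariant.\<close>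

lemma fundamental_solution_outside_block:
  assumes "principal_fundamental_solution A \<Phi>" "\<And>t k. A t $ i $ k = 0"
  shows "(\<Phi> t *v x) $ i = x $ i"
proof -
  have "((\<lambda>t. (\<Phi> t *v x) $ i) has_real_derivative 0) (at t)" for t
    using bounded_linear.has_vector_derivative[OF bounded_linear_vec_nth[of i]
        fundamental_solution_derivative[OF assms(1), of x t]]
    by (simp add: has_real_derivative_iff_has_vector_derivative matrix_vector_mult_def[of "A t"] assms(2))
  then have "(\<Phi> t *v x) $ i = (\<Phi> 0 *v x) $ i" by (intro DERIV_isconst_all) auto
  then show ?thesis using assms(1) by (simp add: principal_fundamental_solution_def)
qed

section \<open>The linearized state equation\<close>

lemma linear_blk: "linear (blk c j)"
  by (auto intro!: linearI simp: blk_def vec_eq_iff)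

lemma blk_in_factor: "blk c j x \<in> factor c j"
  by (simp add: blk_def factor_def)

lemma blk_factor: "x \<in> factor c j \<Longrightarrow> blk c j x = x"
  by (auto simp: blk_def factor_def vec_eq_iff)

text \<open>\<Phi> alone need not be periodic, but moving both times by one period inserts \<Phi> T
  and its inverse, which cancel. The Duhamel integrals below are functions on the torus for this
  reason.\<close>

lemma fundamental_solution_kernel_period:
  assumes A: "continuous_on UNIV A" "\<And>t. A (t + T) = A t" "principal_fundamental_solution A \<Phi>"
    and \<Psi>: "\<And>t. \<Phi> t ** \<Psi> t = mat 1" "\<And>t. \<Psi> t ** \<Phi> t = mat 1"
  shows "\<Phi> (s + T) *v (\<Psi> (t + T) *v x) = \<Phi> s *v (\<Psi> t *v x)"
proof -
  have "\<Phi> t *v (\<Phi> T *v (\<Psi> (t + T) *v x)) = x"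
    using fundamental_solution_period[OF A, of t "\<Psi> (t + T) *v x"]
    by (simp add: matrix_vector_mul_assoc \<Psi>(1))
  then have "\<Phi> T *v (\<Psi> (t + T) *v x) = \<Psi> t *v x"
    using \<Psi>(2) by (metis matrix_vector_mul_assoc matrix_vector_mul_lid)
  then show ?thesis by (simp add: fundamental_solution_period[OF A])
qed

text \<open>Write \<open>t = \<phi> $ j / \<omega> $ j\<close>, let \<open>S\<close> be the shift by \<open>T \<omega>\<close> and \<open>U\<close> the propagator
  \<open>\<Phi> (t + T) \<Phi> t\<^sup>-\<^sup>1\<close> over one period. The Duhamel integral
  \<open>B\<^sub>k w = \<integral> \<Phi> (t + k T) \<Phi> (t + r)\<^sup>-\<^sup>1 w (\<phi> + r \<omega>) dr\<close> over \<open>0 \<le> r \<le> k T\<close> satisfies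
  \<open>(\<partial>\<^sub>\<omega> - A) B\<^sub>k w = S\<^sup>k w - U\<^sup>k w\<close>. Hence for a polynomial \<open>p\<close> with coefficients \<open>a\<^sub>k\<close> that maps
  the fibres of \<open>U\<close> to the tangent direction and for a solution \<open>w\<close> of \<open>p(S) w = g\<close>, the function
  \<open>e = \<Sum> a\<^sub>k B\<^sub>k w\<close> solves the equation up to the tangential term \<open>p(U) w\<close>.\<close>

lemma block_linear_equation:
  fixes A :: "real \<Rightarrow> real^'n::finite^'n" and g :: "real^'m::finite \<Rightarrow> real^'n" and \<omega> :: "real^'m"
  assumes A: "smooth A" "\<And>t. A (t + T) = A t" "principal_fundamental_solution A \<Phi>"
    and rows: "\<And>t i k. c i \<noteq> j \<Longrightarrow> A t $ i $ k = 0"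
    and v: "v \<in> factor c j" "v \<noteq> 0" "\<Phi> T *v v = v"
    and simple: "order 1 (charpoly_blk c j (\<Phi> T)) = 1"
    and unit: "\<And>\<mu>. poly (charpoly_blk c j (\<Phi> T)) \<mu> = 0 \<Longrightarrow> cmod \<mu> = 1 \<Longrightarrow> \<mu> = 1"
    and \<omega>: "\<omega> $ j \<noteq> 0" "T = 2 * pi / \<omega> $ j"
    and g: "smooth g" "torus_map g" "\<And>\<phi>. g \<phi> \<in> factor c j"
  obtains e :: "real^'m \<Rightarrow> real^'n" and a :: "real^'m \<Rightarrow> real"
  where "smooth e" "torus_map e" "smooth a" "torus_map a"
    "\<And>\<phi>. D e \<phi> \<omega> = A (\<phi> $ j / \<omega> $ j) *v e \<phi> + g \<phi> - a \<phi> *\<^sub>R (\<Phi> (\<phi> $ j / \<omega> $ j) *v v)"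
proof -
  have Acont: "continuous_on UNIV A" by (rule smooth_imp_continuous_on[OF A(1)])
  have \<Phi>: "smooth \<Phi>" by (rule smooth_fundamental_solution[OF A(1,3)])
  obtain \<Psi> where \<Psi>: "smooth \<Psi>" "\<And>t. \<Phi> t ** \<Psi> t = mat 1" "\<And>t. \<Psi> t ** \<Phi> t = mat 1"
    using smooth_matrix_inverse[OF \<Phi> fundamental_solution_det[OF Acont A(3)]] by blast
  have outside: "(\<Phi> t *v x) $ i = x $ i" if "c i \<noteq> j" for t x i
    by (rule fundamental_solution_outside_block[OF A(3)]) (use rows that in blast)
  have \<Phi>_factor: "\<Phi> t *v x \<in> factor c j" if "x \<in> factor c j" for t x
    using that outside by (simp add: factor_def)
  have \<Psi>_factor: "\<Psi> t *v x \<in> factor c j" if "x \<in> factor c j" for t x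
    using that outside[of _ t "\<Psi> t *v x"] by (simp add: factor_def matrix_vector_mul_assoc \<Psi>(2))
  obtain p :: "real poly" where p: "\<And>\<mu>. cmod \<mu> = 1 \<Longrightarrow> poly (map_poly of_real p) \<mu> \<noteq> 0"
    "\<And>x. x \<in> factor c j \<Longrightarrow> \<exists>\<alpha>. (\<Sum>k\<le>degree p. coeff p k *\<^sub>R matpow (\<Phi> T) k x) = \<alpha> *\<^sub>R v"
    using hyperbolic_polynomial[of c j "\<Phi> T" v, OF \<Phi>_factor v simple unit] by blast
  obtain w' :: "real^'m \<Rightarrow> real^'n" where w': "smooth w'" "torus_map w'"
    "\<And>\<phi>. (\<Sum>k\<le>degree p. coeff p k *\<^sub>R w' (\<phi> + real k *\<^sub>R (T *\<^sub>R \<omega>))) = g \<phi>"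
    using shift_equation_real[OF p(1) g(1,2), of "T *\<^sub>R \<omega>"] by blast
  \<comment> \<open>The shift equation is solved without regard to the factor. Projection preserves
    it, since \<open>blk\<close> commutes with shifts and fixes \<open>g\<close>.\<close>
  define w where "w \<phi> = blk c j (w' \<phi>)" for \<phi>
  have w: "smooth w" "torus_map w" "\<And>\<phi>. w \<phi> \<in> factor c j"
    using w'(2) smooth_linear[OF linear_blk w'(1)] by (auto simp: w_def[abs_def] blk_in_factor torus_map_def)
  have pw: "(\<Sum>k\<le>degree p. coeff p k *\<^sub>R w (\<phi> + (real k * T) *\<^sub>R \<omega>)) = g \<phi>" for \<phi>
  proof -
    have "blk c j (\<Sum>k\<le>degree p. coeff p k *\<^sub>R w' (\<phi> + real k *\<^sub>R (T *\<^sub>R \<omega>))) = g \<phi>"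
      unfolding w'(3) by (rule blk_factor[OF g(3)])
    then show ?thesis by (simp add: w_def linear_sum[OF linear_blk] linear_scale[OF linear_blk])
  qed
  define ph where "ph \<phi> = \<phi> $ j / \<omega> $ j" for \<phi> :: "real^'m"
  have ph1: "smooth ph"
    unfolding ph_def divide_inverse by (rule smooth_mult[OF smooth_vec_nth[OF smooth_id] smooth_const])
  have ph2: "ph (\<phi> + s *\<^sub>R \<omega>) = ph \<phi> + s" for \<phi> s
    using \<omega>(1) by (simp add: ph_def add_divide_distrib)
  have ph3: "ph (\<phi> + axis i (2 * pi)) = ph \<phi> + (if i = j then T else 0)" for \<phi> i
    by (simp add: ph_def add_divide_distrib \<omega>(2) axis_def)
  note ph = ph1 ph2 ph3
  define H where "H \<phi> = \<Psi> (ph \<phi>) *v w \<phi>" for \<phi>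
  have H: "smooth H"
    unfolding H_def by (intro smooth_matrix_vector smooth_compose[OF \<Psi>(1)] ph w)
  \<comment> \<open>The Duhamel integrand with r = s k T, rescaled to 0 <= s <= 1 for every
    \<open>k\<close>; \<open>H\<close> contains the inverse propagator. The Jacobian k T is supplied
    in the definition of \<open>e\<close>.\<close>
  define Z where "Z k z = coeff p k *\<^sub>R (\<Phi> (ph (snd z) + real k * T) *v
    H (snd z + (fst z * (real k * T)) *\<^sub>R \<omega>))" for k and z :: "real \<times> (real^'m)"
  have Z: "smooth (Z k)" for k
    unfolding Z_def
    by (intro smooth_scaleR smooth_matrix_vector smooth_compose[OF \<Phi>] smooth_compose[OF H] smooth_add
        smooth_compose[OF ph(1)] smooth_mult smooth_const smooth_fst smooth_snd smooth_id)
  have Z_period: "Z k (s, \<phi> + axis i (2 * pi)) = Z k (s, \<phi>)" for k s \<phi> i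
  proof -
    have per: "w (\<phi> + axis i (2 * pi) + x) = w (\<phi> + x)" for x
      using w(2) by (metis add.assoc add.commute torus_map_def)
    have H': "H (\<phi> + axis i (2 * pi) + x) = \<Psi> (ph (\<phi> + x) + (if i = j then T else 0)) *v w (\<phi> + x)" for x
    proof -
      have "\<phi> + axis i (2 * pi) + x = \<phi> + x + axis i (2 * pi)" by simp
      then show ?thesis unfolding H_def per by (simp only: ph3)
    qed
    show ?thesis
    proof (cases "i = j")
      case True
      have "ph \<phi> + T + real k * T = (ph \<phi> + real k * T) + T" by simp
      then show ?thesis
        unfolding Z_def snd_conv fst_conv H' ph3 if_P[OF True] unfolding H_def
        by (simp only: fundamental_solution_kernel_period[OF Acont A(2,3) \<Psi>(2,3)])
    next
      case False
      then show ?thesis unfolding Z_def snd_conv fst_conv H' ph3 unfolding H_def by simp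
    qed
  qed
  \<comment> \<open>Moving along \<omega> advances the propagator and the argument of
    \<open>H\<close>; moving in \<open>s\<close> advances only the latter, with speed k T. The two
    derivatives therefore differ by the term with \<open>A\<close>, evaluated at
    \<open>ph \<phi>\<close> by periodicity.\<close>
  have Z_eq: "(real k * T) *\<^sub>R D (Z k) (s, \<phi>) (0, \<omega>) =
      (real k * T) *\<^sub>R (A (ph \<phi>) *v Z k (s, \<phi>)) + D (Z k) (s, \<phi>) (1, 0)" for k s \<phi>
  proof -
    let ?\<psi> = "\<phi> + (s * (real k * T)) *\<^sub>R \<omega>"
    let ?P = "\<Phi> (ph \<phi> + real k * T)"
    have shift: "A (t + real k * T) = A t" for t
      using A(2) by (induction k) (simp_all add: algebra_simps, metis add.assoc add.commute)
    have c1: "((\<lambda>h. (s, \<phi> + h *\<^sub>R \<omega>)) has_vector_derivative (0, \<omega>)) (at 0)"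
      by (auto intro!: derivative_eq_intros has_vector_derivative_Pair)
    have c2: "((\<lambda>h. (s + h, \<phi>)) has_vector_derivative (1, 0)) (at 0)"
      by (auto intro!: derivative_eq_intros has_vector_derivative_Pair)
    have c3: "((\<lambda>h. ?\<psi> + h *\<^sub>R \<omega>) has_vector_derivative \<omega>) (at 0)"
      by (auto intro!: derivative_eq_intros)
    have c4: "((\<lambda>h. ?\<psi> + (h * (real k * T)) *\<^sub>R \<omega>) has_vector_derivative (real k * T) *\<^sub>R \<omega>) (at 0)"
      by (auto intro!: derivative_eq_intros)
    have c5: "((\<lambda>h. ph \<phi> + real k * T + h) has_vector_derivative 1) (at 0)"
      by (auto intro!: derivative_eq_intros)
    have d\<Phi>: "((\<lambda>h. \<Phi> (ph \<phi> + real k * T + h)) has_vector_derivative A (ph \<phi>) ** ?P) (at 0)"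
      using vector_diff_chain_at[OF c5, of \<Phi> "A (ph \<phi>) ** ?P"] A(3) shift
      by (simp add: principal_fundamental_solution_def o_def) (metis shift)
    have dH: "((\<lambda>h. H (?\<psi> + h *\<^sub>R \<omega>)) has_vector_derivative D H ?\<psi> \<omega>) (at 0)"
      using smooth_D_curve[OF H c3] by simp
    have dH': "((\<lambda>h. H (?\<psi> + (h * (real k * T)) *\<^sub>R \<omega>)) has_vector_derivative (real k * T) *\<^sub>R D H ?\<psi> \<omega>) (at 0)"
      using smooth_D_curve[OF H c4] linear_scale[OF linear_D[OF H]] by simp
    have "((\<lambda>h. coeff p k *\<^sub>R (\<Phi> (ph \<phi> + real k * T + h) *v H (?\<psi> + h *\<^sub>R \<omega>))) has_vector_derivative
        coeff p k *\<^sub>R (?P *v D H ?\<psi> \<omega> + (A (ph \<phi>) ** ?P) *v H ?\<psi>)) (at 0)"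
      using bounded_linear.has_vector_derivative[OF bounded_linear_scaleR_right
          bounded_bilinear.has_vector_derivative[OF bounded_bilinear_matrix_vector d\<Phi> dH]] by simp
    moreover have "Z k (s, \<phi> + h *\<^sub>R \<omega>) = coeff p k *\<^sub>R (\<Phi> (ph \<phi> + real k * T + h) *v H (?\<psi> + h *\<^sub>R \<omega>))" for h
      by (simp add: Z_def ph algebra_simps)
    ultimately have 1: "D (Z k) (s, \<phi>) (0, \<omega>) = coeff p k *\<^sub>R (?P *v D H ?\<psi> \<omega> + (A (ph \<phi>) ** ?P) *v H ?\<psi>)"
      using smooth_D_curve[OF Z[of k] c1] by (auto intro: vector_derivative_unique_at)
    have "((\<lambda>h. coeff p k *\<^sub>R (?P *v H (?\<psi> + (h * (real k * T)) *\<^sub>R \<omega>))) has_vector_derivative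
        coeff p k *\<^sub>R (?P *v ((real k * T) *\<^sub>R D H ?\<psi> \<omega>))) (at 0)"
      by (intro bounded_linear.has_vector_derivative[OF bounded_linear_scaleR_right]
          bounded_linear.has_vector_derivative[OF matrix_vector_mul_bounded_linear] dH')
    moreover have "Z k (s + h, \<phi>) = coeff p k *\<^sub>R (?P *v H (?\<psi> + (h * (real k * T)) *\<^sub>R \<omega>))" for h
      by (simp add: Z_def algebra_simps)
    ultimately have 2: "D (Z k) (s, \<phi>) (1, 0) = coeff p k *\<^sub>R (?P *v ((real k * T) *\<^sub>R D H ?\<psi> \<omega>))"
      using smooth_D_curve[OF Z[of k] c2] by (auto intro: vector_derivative_unique_at)
    show ?thesis
      unfolding 1 2 by (simp add: Z_def matrix_vector_mul_assoc[symmetric] algebra_simps)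
  qed
  define I where "I k \<phi> = integral {0..1} (\<lambda>s. Z k (s, \<phi>))" for k \<phi>
  have I: "smooth (I k)" for k unfolding I_def by (rule smooth_integral[OF Z])
  have int: "(\<lambda>s. u (s, \<phi>)) integrable_on {0..1}" if "smooth u" for u :: "real \<times> (real^'m) \<Rightarrow> real^'n" and \<phi>
  proof -
    have "continuous_on UNIV (\<lambda>s. u (s, \<phi>))"
      by (intro smooth_imp_continuous_on smooth_compose[OF that] smooth_Pair smooth_id smooth_const)
    then show ?thesis by (intro integrable_continuous_real) (metis continuous_on_subset subset_UNIV)
  qed
  have I_eq: "(real k * T) *\<^sub>R D (I k) \<phi> \<omega> =
      (real k * T) *\<^sub>R (A (ph \<phi>) *v I k \<phi>) + (Z k (1, \<phi>) - Z k (0, \<phi>))" for k \<phi>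
  proof -
    have "(real k * T) *\<^sub>R D (I k) \<phi> \<omega> = integral {0..1} (\<lambda>s. (real k * T) *\<^sub>R D (Z k) (s, \<phi>) (0, \<omega>))"
      unfolding I_def D_integral[OF Z] by simp
    also have "\<dots> = integral {0..1} (\<lambda>s. (real k * T) *\<^sub>R (A (ph \<phi>) *v Z k (s, \<phi>)) + D (Z k) (s, \<phi>) (1, 0))"
      unfolding Z_eq ..
    also have "\<dots> = integral {0..1} (\<lambda>s. (real k * T) *\<^sub>R (A (ph \<phi>) *v Z k (s, \<phi>))) +
        integral {0..1} (\<lambda>s. D (Z k) (s, \<phi>) (1, 0))"
      by (intro integral_add int[of "\<lambda>z. (real k * T) *\<^sub>R (A (ph \<phi>) *v Z k z)"] int[of "\<lambda>z. D (Z k) z (1, 0)"]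
          smooth_scaleR smooth_matrix_vector smooth_const smooth_D Z)
    also have "integral {0..1} (\<lambda>s. (real k * T) *\<^sub>R (A (ph \<phi>) *v Z k (s, \<phi>))) = (real k * T) *\<^sub>R (A (ph \<phi>) *v I k \<phi>)"
      using integral_linear[OF int[OF Z[of k], of \<phi>] matrix_vector_mul_bounded_linear[of "A (ph \<phi>)"]]
      by (simp add: I_def o_def)
    also have "integral {0..1} (\<lambda>s. D (Z k) (s, \<phi>) (1, 0)) = Z k (1, \<phi>) - Z k (0, \<phi>)"
      by (rule integral_D_curve[OF Z, where g = "\<lambda>s. (s, \<phi>)"])
        (auto intro!: derivative_eq_intros has_vector_derivative_Pair)
    finally show ?thesis .
  qed
  define e where "e \<phi> = (\<Sum>k\<le>degree p. (real k * T) *\<^sub>R I k \<phi>)" for \<phi>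
  have e: "smooth e" unfolding e_def by (intro smooth_sum smooth_scaleR smooth_const I)
  have De: "D e \<phi> \<omega> = (\<Sum>k\<le>degree p. (real k * T) *\<^sub>R D (I k) \<phi> \<omega>)" for \<phi>
  proof -
    have "(e has_derivative (\<lambda>v. \<Sum>k\<le>degree p. (real k * T) *\<^sub>R D (I k) \<phi> v)) (at \<phi>)"
      unfolding e_def by (intro has_derivative_sum has_derivative_scaleR_right smooth_imp_has_derivative I)
    then show ?thesis by (simp add: D_eq)
  qed
  define x where "x \<phi> = (\<Sum>k\<le>degree p. coeff p k *\<^sub>R matpow (\<Phi> T) k (\<Psi> (ph \<phi>) *v w \<phi>))" for \<phi>
  \<comment> \<open>\<open>p(2)\<close> provides a coefficient for each point separately; the inner
    product with \<open>v\<close> expresses it as a smooth function.\<close>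
  define a where "a \<phi> = (v \<bullet> x \<phi>) / (v \<bullet> v)" for \<phi>
  have x: "x \<phi> = a \<phi> *\<^sub>R v" for \<phi>
    using p(2)[OF \<Psi>_factor[OF w(3)], of "ph \<phi>" \<phi>] v(2) by (auto simp: x_def[symmetric] a_def)
  have sum0: "(\<Sum>k\<le>degree p. Z k (0, \<phi>)) = a \<phi> *\<^sub>R (\<Phi> (ph \<phi>) *v v)" for \<phi>
  proof -
    have "(\<Sum>k\<le>degree p. Z k (0, \<phi>)) = \<Phi> (ph \<phi>) *v x \<phi>"
      by (simp add: Z_def H_def x_def fundamental_solution_matpow[OF Acont A(2,3)]
          linear_sum[OF matrix_vector_mul_linear] linear_scale[OF matrix_vector_mul_linear])
    then show ?thesis by (simp add: x algebra_simps)
  qed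
  have sum1: "(\<Sum>k\<le>degree p. Z k (1, \<phi>)) = g \<phi>" for \<phi>
    unfolding pw[symmetric] by (simp add: Z_def H_def ph matrix_vector_mul_assoc \<Psi>(2))
  show ?thesis
  proof (rule that[OF e])
    show "torus_map e" by (simp add: torus_map_def e_def I_def Z_period)
    have "smooth (\<lambda>\<phi>. matpow (\<Phi> T) k (\<Psi> (ph \<phi>) *v w \<phi>))" for k
      using H unfolding H_def by (induction k) (auto simp: matpow_def intro!: smooth_matrix_vector smooth_const)
    then show "smooth a"
      unfolding a_def x_def divide_inverse by (intro smooth_intros)
    show "torus_map a"
      unfolding torus_map_def
    proof (intro allI)
      fix \<phi> :: "real^'m" and i
      let ?\<phi>' = "\<phi> + axis i (2 * pi)"
      \<comment> \<open>Periodicity of \<open>a\<close> is read off from the tangential vector in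
        \<open>sum0\<close>, which is periodic because \<open>Z\<close> is and whose direction is
        periodic and nowhere zero.\<close>
      have "\<Phi> (ph ?\<phi>') *v v = \<Phi> (ph \<phi>) *v v"
        using fundamental_solution_period[OF Acont A(2,3), of "ph \<phi>" v] by (simp add: ph v(3))
      then have "a ?\<phi>' *\<^sub>R (\<Phi> (ph \<phi>) *v v) = a \<phi> *\<^sub>R (\<Phi> (ph \<phi>) *v v)"
        using sum0[of ?\<phi>'] sum0[of \<phi>] by (auto simp: Z_period)
      moreover have "\<Phi> (ph \<phi>) *v v \<noteq> 0"
        using v(2) \<Psi>(3) by (metis matrix_vector_mul_assoc matrix_vector_mul_lid matrix_vector_mult_0_right)
      ultimately show "a ?\<phi>' = a \<phi>" by simp
    qed
    show "D e \<phi> \<omega> = A (\<phi> $ j / \<omega> $ j) *v e \<phi> + g \<phi> - a \<phi> *\<^sub>R (\<Phi> (\<phi> $ j / \<omega> $ j) *v v)" for \<phi>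
      unfolding ph_def[symmetric] De I_eq
      by (simp add: sum.distrib sum_subtractf sum0 sum1 e_def linear_sum[OF matrix_vector_mul_linear]
          linear_scale[OF matrix_vector_mul_linear])
  qed
qed

text \<open>The differentiated integrand is the r-derivative of r \<kappa>(x r). This is the
  fundamental theorem for the integral of \<kappa> from 0 to \<open>x\<close>, rescaled to [0,1] so
  that negative history times are covered and \<open>smooth_integral\<close> applies.\<close>

lemma scaled_integral_derivative:
  fixes \<kappa> :: "real \<Rightarrow> 'b::euclidean_space"
  assumes \<kappa>: "smooth \<kappa>"
  shows "((\<lambda>x. x *\<^sub>R integral {0..1} (\<lambda>r. \<kappa> (x * r))) has_vector_derivative \<kappa> x) (at x)"
proof -
  define K where "K z = \<kappa> (snd z * fst z)" for z :: "real \<times> real"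
  have K: "smooth K" unfolding K_def by (intro smooth_compose[OF \<kappa>] smooth_mult smooth_fst smooth_snd smooth_id)
  have DK: "D K (r, x) (0, 1) = r *\<^sub>R D \<kappa> (x * r) 1" for r
  proof -
    have "((\<lambda>h. K (r, x + h)) has_vector_derivative D K (r, x) (0, 1)) (at 0)"
    proof -
      have "((\<lambda>h. (r, x + h)) has_vector_derivative (0, 1)) (at 0)"
        by (intro has_vector_derivative_Pair) (auto intro!: derivative_eq_intros)
      from smooth_D_curve[OF K this] show ?thesis by simp
    qed
    moreover have "((\<lambda>h. \<kappa> ((x + h) * r)) has_vector_derivative D \<kappa> (x * r) r) (at 0)"
    proof -
      have "((\<lambda>h. (x + h) * r) has_vector_derivative r) (at 0)"
        by (auto intro!: derivative_eq_intros)
      from smooth_D_curve[OF \<kappa> this] show ?thesis by simp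
    qed
    ultimately have "D K (r, x) (0, 1) = D \<kappa> (x * r) r"
      by (simp add: K_def vector_derivative_unique_at)
    then show ?thesis using linear_scale[OF linear_D[OF \<kappa>], of "x * r" r 1] by simp
  qed
  have "((\<lambda>x. integral {0..1} (\<lambda>r. K (r, x))) has_vector_derivative integral {0..1} (\<lambda>r. D K (r, x) (0, 1))) (at x)"
    using smooth_D_curve[OF smooth_integral[OF K], of "\<lambda>x. x" 1 x] D_integral[OF K, of x 1]
    by (simp add: has_vector_derivative_id)
  from has_vector_derivative_scaleR[OF DERIV_ident this]
  have *: "((\<lambda>x. x *\<^sub>R integral {0..1} (\<lambda>r. \<kappa> (x * r))) has_vector_derivative
      x *\<^sub>R integral {0..1} (\<lambda>r. r *\<^sub>R D \<kappa> (x * r) 1) + integral {0..1} (\<lambda>r. \<kappa> (x * r))) (at x)"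
    by (simp add: K_def[abs_def] DK[unfolded K_def[abs_def]])
  have int: "u integrable_on {0..1}" if "smooth u" for u :: "real \<Rightarrow> 'b"
    by (intro integrable_continuous_real continuous_on_subset[OF smooth_imp_continuous_on[OF that]]) simp
  have sm: "smooth (\<lambda>r. r *\<^sub>R D \<kappa> (x * r) 1)" "smooth (\<lambda>r. \<kappa> (x * r))"
    by (intro smooth_scaleR smooth_id smooth_D_apply \<kappa> smooth_mult smooth_const smooth_compose[OF \<kappa>])+
  have "x *\<^sub>R integral {0..1} (\<lambda>r. r *\<^sub>R D \<kappa> (x * r) 1) + integral {0..1} (\<lambda>r. \<kappa> (x * r)) =
      integral {0..1} (\<lambda>r. x *\<^sub>R (r *\<^sub>R D \<kappa> (x * r) 1) + \<kappa> (x * r))"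
    unfolding integral_add[OF integrable_cmul[OF int[OF sm(1)]] int[OF sm(2)]] integral_cmul ..
  also have "((\<lambda>r. x *\<^sub>R (r *\<^sub>R D \<kappa> (x * r) 1) + \<kappa> (x * r)) has_integral 1 *\<^sub>R \<kappa> (x * 1) - 0 *\<^sub>R \<kappa> (x * 0)) {0..1}"
  proof (rule fundamental_theorem_of_calculus)
    fix r :: real
    have "((\<lambda>r. \<kappa> (x * r)) has_vector_derivative D \<kappa> (x * r) x) (at r)"
      by (rule smooth_D_curve[OF \<kappa>]) (auto intro!: derivative_eq_intros)
    then have "((\<lambda>r. \<kappa> (x * r)) has_vector_derivative x *\<^sub>R D \<kappa> (x * r) 1) (at r)"
      using linear_scale[OF linear_D[OF \<kappa>], of "x * r" x 1] by simp
    from has_vector_derivative_scaleR[OF DERIV_ident this]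
    show "((\<lambda>r. r *\<^sub>R \<kappa> (x * r)) has_vector_derivative x *\<^sub>R (r *\<^sub>R D \<kappa> (x * r) 1) + \<kappa> (x * r)) (at r within {0..1})"
      by (simp add: has_vector_derivative_at_within mult.commute)
  qed simp
  then have "integral {0..1} (\<lambda>r. x *\<^sub>R (r *\<^sub>R D \<kappa> (x * r) 1) + \<kappa> (x * r)) = \<kappa> x"
    by (simp add: integral_unique)
  finally show ?thesis using * by simp
qed

text \<open>The transport equation is solved along its characteristics
  \<open>h \<mapsto> (\<phi> + h \<omega>, s - h)\<close>.\<close>

lemma transport_equation:
  fixes k :: "'a::euclidean_space \<times> real \<Rightarrow> 'b::euclidean_space"
  assumes k: "smooth k" and e: "smooth e"
  obtains E where "smooth E" "\<And>\<phi>. E (\<phi>, 0) = e \<phi>" "\<And>\<phi> s. D E (\<phi>, s) (\<omega>, - 1) = - k (\<phi>, s)"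
    "\<And>p. period p e \<Longrightarrow> period (p, 0) k \<Longrightarrow> period (p, 0) E"
proof
  \<comment> \<open>Variation of constants on the characteristic through \<open>(\<phi>, s)\<close>:
    the boundary value where it meets s = 0, plus the integral of \<open>k\<close> over the piece in
    between, rescaled to [0,1].\<close>
  define E where "E z = e (fst z + snd z *\<^sub>R \<omega>) +
    snd z *\<^sub>R integral {0..1} (\<lambda>r. k (fst z + (snd z * (1 - r)) *\<^sub>R \<omega>, snd z * r))" for z
  show E: "smooth E"
  proof -
    have "smooth (\<lambda>y :: real \<times> 'a \<times> real. k (fst (snd y) + (snd (snd y) * (1 - fst y)) *\<^sub>R \<omega>, snd (snd y) * fst y))"
      by (intro smooth_compose[OF k] smooth_intros)
    from smooth_integral[OF this]
    show ?thesis unfolding E_def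
      by (intro smooth_add smooth_scaleR smooth_compose[OF e] smooth_intros) simp
  qed
  show "E (\<phi>, 0) = e \<phi>" for \<phi> by (simp add: E_def)
  show "D E (\<phi>, s) (\<omega>, - 1) = - k (\<phi>, s)" for \<phi> s
  proof -
    define \<kappa> where "\<kappa> r = k (\<phi> + (s - r) *\<^sub>R \<omega>, r)" for r
    have \<kappa>: "smooth \<kappa>" unfolding \<kappa>_def by (intro smooth_compose[OF k] smooth_intros)
    have "((\<lambda>h. (\<phi> + h *\<^sub>R \<omega>, s - h)) has_vector_derivative (\<omega>, - 1)) (at 0)"
      by (auto intro!: derivative_eq_intros has_vector_derivative_Pair)
    from smooth_D_curve[OF E this]
    have 1: "((\<lambda>h. E (\<phi> + h *\<^sub>R \<omega>, s - h)) has_vector_derivative D E (\<phi>, s) (\<omega>, - 1)) (at 0)" by simp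
    have "((\<lambda>h. s - h) has_vector_derivative - 1) (at 0)" by (auto intro!: derivative_eq_intros)
    from vector_diff_chain_at[OF this scaled_integral_derivative[OF \<kappa>]]
    have "((\<lambda>h. (s - h) *\<^sub>R integral {0..1} (\<lambda>r. \<kappa> ((s - h) * r))) has_vector_derivative - \<kappa> s) (at 0)"
      by (simp add: o_def)
    then have "((\<lambda>h. e (\<phi> + s *\<^sub>R \<omega>) + (s - h) *\<^sub>R integral {0..1} (\<lambda>r. \<kappa> ((s - h) * r)))
        has_vector_derivative - \<kappa> s) (at 0)"
      using has_vector_derivative_add[OF has_vector_derivative_const] by fastforce
    \<comment> \<open>On a characteristic, \<open>h\<close> survives only in the upper limit
      \<open>s - h\<close> of the integral.\<close>
    moreover have "E (\<phi> + h *\<^sub>R \<omega>, s - h) =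
        e (\<phi> + s *\<^sub>R \<omega>) + (s - h) *\<^sub>R integral {0..1} (\<lambda>r. \<kappa> ((s - h) * r))" for h
    proof -
      have "\<phi> + h *\<^sub>R \<omega> + ((s - h) * (1 - r)) *\<^sub>R \<omega> = \<phi> + (s - (s - h) * r) *\<^sub>R \<omega>" for r
        by (simp add: algebra_simps)
      moreover have "\<phi> + h *\<^sub>R \<omega> + (s - h) *\<^sub>R \<omega> = \<phi> + s *\<^sub>R \<omega>" by (simp add: algebra_simps)
      ultimately show ?thesis unfolding E_def \<kappa>_def fst_conv snd_conv by presburger
    qed
    ultimately have "D E (\<phi>, s) (\<omega>, - 1) = - \<kappa> s"
      using 1 by (simp add: vector_derivative_unique_at)
    then show ?thesis by (simp add: \<kappa>_def)
  qed
  show "period (p, 0) E" if p: "period p e" "period (p, 0) k" for p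
  proof -
    have "e (\<phi> + p + x) = e (\<phi> + x)" for \<phi> x
      using p(1) unfolding period_def by (metis add.assoc add.commute)
    moreover have "k (\<phi> + p + x, s) = k (\<phi> + x, s)" for \<phi> x s
    proof -
      have "k ((\<phi> + x, s) + (p, 0)) = k (\<phi> + x, s)" using p(2) unfolding period_def by blast
      then show ?thesis by (simp add: algebra_simps)
    qed
    ultimately show ?thesis by (simp add: period_def E_def)
  qed
qed

section \<open>Decomposition of the phase space into factors\<close>

lemma blk_other_factor: "x \<in> factor c k \<Longrightarrow> j \<noteq> k \<Longrightarrow> blk c j x = 0"
  by (auto simp: blk_def factor_def vec_eq_iff)

lemma blk_sum_factors:
  fixes c :: "'n::finite \<Rightarrow> 'm::finite"
  assumes "\<And>k. x k \<in> factor c k"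
  shows "blk c j (\<Sum>k\<in>UNIV. x k) = x j"
proof -
  have "blk c j (\<Sum>k\<in>UNIV. x k) = (\<Sum>k\<in>UNIV. blk c j (x k))"
    by (rule linear_sum[OF linear_blk])
  also have "\<dots> = (\<Sum>k\<in>UNIV. if k = j then x j else 0)"
    by (intro sum.cong refl) (simp add: blk_factor blk_other_factor[OF assms] assms)
  finally show ?thesis by simp
qed

lemma sum_blk: "(\<Sum>j\<in>UNIV. blk c j x) = x" for c :: "'n::finite \<Rightarrow> 'm::finite"
  by (simp add: blk_def vec_eq_iff)

lemma factor_combination:
  assumes "x \<in> factor c j" "y \<in> factor c j"
  shows "x + y \<in> factor c j" "x - y \<in> factor c j"
  using assms by (auto simp: factor_def)

lemma factor_scaleR: "x \<in> factor c j \<Longrightarrow> a *\<^sub>R x \<in> factor c j"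
  by (simp add: factor_def)

lemma factor_sum: "(\<And>i. i \<in> I \<Longrightarrow> f i \<in> factor c j) \<Longrightarrow> (\<Sum>i\<in>I. f i) \<in> factor c j"
  by (simp add: factor_def)

lemma D_linear_compose:
  assumes "smooth u" "linear h"
  shows "D (\<lambda>x. h (u x :: 'b::euclidean_space)) x v = h (D u x v)"
  using D_eq[OF bounded_linear.has_derivative[OF _ smooth_imp_has_derivative[OF assms(1)]], of h x] assms(2)
  by (simp add: linear_conv_bounded_linear)

lemma D_sum:
  assumes "\<And>i. i \<in> I \<Longrightarrow> smooth (u i)"
  shows "D (\<lambda>x. \<Sum>i\<in>I. u i x) x v = (\<Sum>i\<in>I. D (u i) x v)"
proof -
  have "((\<lambda>x. \<Sum>i\<in>I. u i x) has_derivative (\<lambda>v. \<Sum>i\<in>I. D (u i) x v)) (at x)"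
    by (intro has_derivative_sum smooth_imp_has_derivative assms)
  then show ?thesis by (simp add: D_eq)
qed

section \<open>Expansion in the coupling strength\<close>

locale delay_network =
  fixes c :: "'n::finite \<Rightarrow> 'm::finite"
    and F :: "'m \<Rightarrow> real^'n \<Rightarrow> real^'n"
    and G :: "'m \<Rightarrow> 'm \<Rightarrow> real^'n \<Rightarrow> real^'n \<Rightarrow> real^'n"
    and \<tau> :: "'m \<Rightarrow> 'm \<Rightarrow> real"
    and \<Gamma> :: "'m \<Rightarrow> real \<Rightarrow> real^'n"
    and T :: "'m \<Rightarrow> real"
  assumes F_range: "\<And>j x. x \<in> factor c j \<Longrightarrow> F j x \<in> factor c j"
    and F_smooth: "\<And>j. smooth (\<lambda>x. F j (blk c j x))"
    and G_range: "\<And>j k x y. x \<in> factor c j \<Longrightarrow> y \<in> factor c k \<Longrightarrow> G j k x y \<in> factor c j"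
    and G_smooth: "\<And>j k. smooth (\<lambda>(x, y). G j k (blk c j x) (blk c k y))"
    and delay_pos: "\<And>j k. 0 < \<tau> j k"
    and periodic: "\<And>j. nonconstant_periodic_solution c j (F j) (T j) (\<Gamma> j)"
    and hyperbolic: "\<And>j. normally_hyperbolic c j (F j) (T j) (\<Gamma> j)"
begin

definition \<omega> :: "real^'m" where "\<omega> = freq T"

definition phase :: "'m \<Rightarrow> real^'m \<Rightarrow> real" where "phase j \<phi> = \<phi> $ j / \<omega> $ j"

text \<open>The factors are complementary coordinate subspaces, so the m component equations can be
  added up to a single equation without loss; \<open>network_rhs_blk\<close> recovers the
  components.\<close>

definition FF :: "real^'n \<Rightarrow> real^'n" where "FF x = (\<Sum>j\<in>UNIV. F j (blk c j x))"

definition GG :: "((real^'m) \<times> real \<Rightarrow> real^'n) \<Rightarrow> real^'m \<Rightarrow> real^'n" where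
  "GG E \<phi> = (\<Sum>j\<in>UNIV. \<Sum>k\<in>UNIV. G j k (blk c j (E (\<phi>, 0))) (blk c k (E (\<phi>, - \<tau> j k))))"

definition E0 :: "(real^'m) \<times> real \<Rightarrow> real^'n" where
  "E0 z = (\<Sum>j\<in>UNIV. \<Gamma> j (phase j (fst z) + snd z))"

lemma T_pos: "0 < T j"
  and \<Gamma>_factor: "\<Gamma> j t \<in> factor c j"
  and \<Gamma>_der: "(\<Gamma> j has_vector_derivative F j (\<Gamma> j t)) (at t)"
  and \<Gamma>_period: "\<Gamma> j (t + T j) = \<Gamma> j t"
  and \<Gamma>_nonconst: "\<exists>s t. \<Gamma> j s \<noteq> \<Gamma> j t"
  using periodic[of j] by (auto simp: nonconstant_periodic_solution_def)

lemma \<omega>_nonzero: "\<omega> $ j \<noteq> 0" and T_\<omega>: "T j = 2 * pi / \<omega> $ j"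
  using T_pos[of j] by (auto simp: \<omega>_def freq_def)

lemma blk_\<Gamma>: "blk c j (\<Gamma> j t) = \<Gamma> j t"
  by (rule blk_factor[OF \<Gamma>_factor])

lemma smooth_\<Gamma>: "smooth (\<Gamma> j)"
proof (rule smooth_bootstrap[where h = "\<lambda>t x. F j (blk c j x)"])
  show "(\<Gamma> j has_vector_derivative F j (blk c j (\<Gamma> j t))) (at t)" for t
    using \<Gamma>_der by (simp add: blk_\<Gamma>)
  show "smooth (\<lambda>(t :: real, x). F j (blk c j x))"
    unfolding case_prod_unfold by (rule smooth_compose[OF F_smooth smooth_snd[OF smooth_id]])
qed

lemma smooth_phase: "smooth (phase j)"
  unfolding phase_def divide_inverse by (rule smooth_mult[OF smooth_vec_nth[OF smooth_id] smooth_const])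

lemma phase_axis: "phase j (\<phi> + axis i (2 * pi)) = phase j \<phi> + (if i = j then T j else 0)"
  by (simp add: phase_def add_divide_distrib T_\<omega> axis_def)

lemma smooth_FF: "smooth FF"
  unfolding FF_def by (intro smooth_sum F_smooth)

lemma smooth_E0: "smooth E0"
  unfolding E0_def
  by (intro smooth_sum smooth_compose[OF smooth_\<Gamma>] smooth_add smooth_compose[OF smooth_phase]
      smooth_fst smooth_snd smooth_id)

lemma E0_period: "period (axis i (2 * pi), 0) E0"
proof -
  have "\<Gamma> j (phase j \<phi> + (if i = j then T j else 0) + s) = \<Gamma> j (phase j \<phi> + s)" for j \<phi> s
    using \<Gamma>_period[of j "phase j \<phi> + s"] by (simp add: algebra_simps)
  then show ?thesis by (simp add: period_def E0_def phase_axis)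
qed

lemma blk_E0: "blk c j (E0 (\<phi>, s)) = \<Gamma> j (phase j \<phi> + s)"
  unfolding E0_def by (subst blk_sum_factors) (simp_all add: \<Gamma>_factor)

lemma D_E0: "D E0 (\<phi>, s) (x, r) = (\<Sum>j\<in>UNIV. (x $ j / \<omega> $ j + r) *\<^sub>R F j (\<Gamma> j (phase j \<phi> + s)))"
proof -
  have "((\<lambda>h. (\<phi> + h *\<^sub>R x, s + h * r)) has_vector_derivative (x, r)) (at 0)"
    by (intro has_vector_derivative_Pair) (auto intro!: derivative_eq_intros)
  from smooth_D_curve[OF smooth_E0 this]
  have 1: "((\<lambda>h. E0 (\<phi> + h *\<^sub>R x, s + h * r)) has_vector_derivative D E0 (\<phi>, s) (x, r)) (at 0)" by simp
  have "((\<lambda>h. \<Sum>j\<in>UNIV. \<Gamma> j (phase j (\<phi> + h *\<^sub>R x) + (s + h * r))) has_vector_derivative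
      (\<Sum>j\<in>UNIV. (x $ j / \<omega> $ j + r) *\<^sub>R F j (\<Gamma> j (phase j \<phi> + s)))) (at 0)"
  proof (rule has_vector_derivative_sum)
    fix j
    have "((\<lambda>h. phase j (\<phi> + h *\<^sub>R x) + (s + h * r)) has_vector_derivative (x $ j / \<omega> $ j + r)) (at 0)"
      unfolding phase_def by (auto intro!: derivative_eq_intros simp: add_divide_distrib \<omega>_nonzero)
    from vector_diff_chain_at[OF this \<Gamma>_der]
    show "((\<lambda>h. \<Gamma> j (phase j (\<phi> + h *\<^sub>R x) + (s + h * r))) has_vector_derivative
        (x $ j / \<omega> $ j + r) *\<^sub>R F j (\<Gamma> j (phase j \<phi> + s))) (at 0)"
      by (simp add: o_def)
  qed
  with 1 show ?thesis by (simp add: E0_def vector_derivative_unique_at)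
qed

lemma jacobian_mult: "jacobian_blk c j (F j) x *v y = D (\<lambda>x. F j (blk c j x)) x y"
  unfolding jacobian_blk_def using matrix_vector_mul(2)[OF linear_D[OF F_smooth]] by metis

lemma block_equation:
  fixes g :: "real^'m \<Rightarrow> real^'n"
  assumes g: "smooth g" "torus_map g" "\<And>\<phi>. g \<phi> \<in> factor c j"
  shows "\<exists>e a. smooth e \<and> torus_map e \<and> smooth a \<and> torus_map a \<and>
    (\<forall>\<phi>. D e \<phi> \<omega> = D (\<lambda>x. F j (blk c j x)) (\<Gamma> j (phase j \<phi>)) (e \<phi>) + g \<phi>
      - a \<phi> *\<^sub>R F j (\<Gamma> j (phase j \<phi>)))"
proof -
  define A where "A t = jacobian_blk c j (F j) (\<Gamma> j t)" for t
  define v where "v = F j (\<Gamma> j 0)"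
  obtain \<Phi> where \<Phi>: "principal_fundamental_solution A \<Phi>"
    "order 1 (charpoly_blk c j (\<Phi> (T j))) = 1"
    "\<And>\<mu>. poly (charpoly_blk c j (\<Phi> (T j))) \<mu> = 0 \<Longrightarrow> cmod \<mu> = 1 \<Longrightarrow> \<mu> = 1"
    using hyperbolic[of j] unfolding normally_hyperbolic_def A_def by blast
  have entry: "A t $ i $ k = D (\<lambda>x. F j (blk c j x)) (\<Gamma> j t) (axis k 1) $ i" for t i k
    unfolding jacobian_mult[symmetric] A_def by (simp add: matrix_vector_mult_basis column_def)
  have "smooth (\<lambda>t. \<chi> i k. D (\<lambda>x. F j (blk c j x)) (\<Gamma> j t) (axis k 1) $ i)"
    by (intro smooth_vec smooth_vec_nth smooth_D_apply F_smooth smooth_\<Gamma> smooth_const)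
  moreover have "(\<chi> i k. D (\<lambda>x. F j (blk c j x)) (\<Gamma> j t) (axis k 1) $ i) = A t" for t
    by (simp add: vec_eq_iff entry)
  ultimately have A: "smooth A" by simp
  have rows: "A t $ i $ k = 0" if "c i \<noteq> j" for t i k
  proof -
    have "D (\<lambda>x. F j (blk c j x) $ i) x y = D (\<lambda>x. F j (blk c j x)) x y $ i" for x y
      using D_eq[OF bounded_linear.has_derivative[OF bounded_linear_vec_nth[of i]
            smooth_imp_has_derivative[OF F_smooth[of j]]], of x] by simp
    moreover have "F j (blk c j x) $ i = 0" for x
      using F_range[OF blk_in_factor[of c j x]] that by (simp add: factor_def)
    ultimately have "D (\<lambda>x. F j (blk c j x)) x y $ i = D (\<lambda>x. 0 :: real) x y" for x y
      by simp
    also have "D (\<lambda>x. 0 :: real) x y = 0" for x y :: "real^'n"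
      by (simp add: D_eq[OF has_derivative_const])
    finally show ?thesis by (simp add: entry)
  qed
  \<comment> \<open>The velocity of the orbit solves the variational equation, so \<Phi> transports
    it. After one period it returns to \<open>v\<close>, which is the trivial multiplier.\<close>
  have sol: "((\<lambda>t. F j (\<Gamma> j t)) has_vector_derivative A t *v F j (\<Gamma> j t)) (at t)" for t
    using smooth_D_curve[OF F_smooth \<Gamma>_der, of j j t] by (simp add: blk_\<Gamma> A_def jacobian_mult)
  have tangent: "\<Phi> t *v v = F j (\<Gamma> j t)" for t
    by (rule linear_ode_unique[OF smooth_imp_continuous_on[OF A] fundamental_solution_derivative[OF \<Phi>(1)] sol])
      (use \<Phi>(1) in \<open>simp add: principal_fundamental_solution_def v_def\<close>)
  have "v \<noteq> 0"
  \<comment> \<open>A velocity that vanishes at time 0 vanishes always by \<open>tangent\<close>,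
    and the orbit would be constant.\<close>
  proof
    assume "v = 0"
    then have "(\<Gamma> j has_vector_derivative 0) (at t)" for t using \<Gamma>_der[of j t] tangent[of t] by simp
    then have "(\<Gamma> j has_derivative (\<lambda>h. 0)) (at t within UNIV)" for t
      by (simp add: has_vector_derivative_def)
    then obtain y where "\<And>t. \<Gamma> j t = y"
      using has_derivative_zero_constant[OF convex_UNIV, of "\<Gamma> j"] by blast
    with \<Gamma>_nonconst[of j] show False by simp
  qed
  have "A (t + T j) = A t" for t by (simp add: A_def \<Gamma>_period)
  moreover have "v \<in> factor c j" by (simp add: v_def F_range \<Gamma>_factor)
  moreover have "\<Phi> (T j) *v v = v" using \<Gamma>_period[of j 0] tangent[of "T j"] by (simp add: v_def)
  ultimately obtain e :: "real^'m \<Rightarrow> real^'n" and a :: "real^'m \<Rightarrow> real"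
    where "smooth e" "torus_map e" "smooth a" "torus_map a"
    "\<And>\<phi>. D e \<phi> \<omega> = A (\<phi> $ j / \<omega> $ j) *v e \<phi> + g \<phi> - a \<phi> *\<^sub>R (\<Phi> (\<phi> $ j / \<omega> $ j) *v v)"
    using block_linear_equation[OF A _ \<Phi>(1) rows _ \<open>v \<noteq> 0\<close> _ \<Phi>(2,3) \<omega>_nonzero T_\<omega> g] by blast
  then show ?thesis by (auto simp: A_def jacobian_mult tangent phase_def)
qed

lemma D_F_blk:
  "D (\<lambda>x. F j (blk c j x)) x y = D (\<lambda>x. F j (blk c j x)) (blk c j x) (blk c j y)"
proof -
  have "blk c j (blk c j x) = blk c j x" for x by (rule blk_factor[OF blk_in_factor])
  then show ?thesis using D_compose_linear_affine[OF F_smooth[of j] linear_blk, of 0 c j x y] by simp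
qed

lemma linear_equation:
  fixes g :: "real^'m \<Rightarrow> real^'n"
  assumes g: "smooth g" "torus_map g"
  obtains f :: "real^'m \<Rightarrow> real^'m" and e :: "real^'m \<Rightarrow> real^'n"
  where "smooth f" "torus_map f" "smooth e" "torus_map e"
    "\<And>\<phi>. D e \<phi> \<omega> - D FF (E0 (\<phi>, 0)) (e \<phi>) + D E0 (\<phi>, 0) (f \<phi>, 0) = g \<phi>"
proof -
  have "\<exists>e a. smooth e \<and> torus_map e \<and> smooth a \<and> torus_map a \<and>
    (\<forall>\<phi>. D e \<phi> \<omega> = D (\<lambda>x. F j (blk c j x)) (\<Gamma> j (phase j \<phi>)) (e \<phi>) + blk c j (g \<phi>)
      - a \<phi> *\<^sub>R F j (\<Gamma> j (phase j \<phi>)))" for j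
    using g by (intro block_equation) (auto simp: torus_map_def blk_in_factor intro: smooth_linear[OF linear_blk])
  then obtain e a where ea: "\<And>j. smooth (e j)" "\<And>j. torus_map (e j)" "\<And>j. smooth (a j)" "\<And>j. torus_map (a j)"
    "\<And>j \<phi>. D (e j) \<phi> \<omega> = D (\<lambda>x. F j (blk c j x)) (\<Gamma> j (phase j \<phi>)) (e j \<phi>) + blk c j (g \<phi>)
      - a j \<phi> *\<^sub>R F j (\<Gamma> j (phase j \<phi>))"
    by metis
  \<comment> \<open>A frequency change f' moves \<open>E0\<close> with velocity (f'_j / \<omega>_j)
    times the orbit velocity in factor j, so the factor \<omega>_j produces the coefficient
    \<open>a j\<close>.\<close>
  define f' where "f' \<phi> = (\<chi> j. \<omega> $ j * a j \<phi>)" for \<phi>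
  define e' where "e' \<phi> = (\<Sum>j\<in>UNIV. blk c j (e j \<phi>))" for \<phi>
  have e': "smooth e'" unfolding e'_def by (intro smooth_sum smooth_linear[OF linear_blk] ea)
  show ?thesis
  proof (rule that[of f' e'])
    show "smooth f'" unfolding f'_def by (intro smooth_vec smooth_mult smooth_const ea)
    show "torus_map f'" "torus_map e'" using ea by (simp_all add: torus_map_def f'_def e'_def)
    show "smooth e'" by (rule e')
    fix \<phi>
    have DF_range: "D (\<lambda>x. F j (blk c j x)) x y \<in> factor c j" for j x y
    proof -
      have "blk c j (F j (blk c j x)) = F j (blk c j x)" for x
        by (intro blk_factor F_range blk_in_factor)
      then have "blk c j (D (\<lambda>x. F j (blk c j x)) x y) = D (\<lambda>x. F j (blk c j x)) x y"
        using D_linear_compose[OF F_smooth linear_blk, of c j j x y] by simp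
      then show ?thesis by (metis blk_in_factor)
    qed
    have "D e' \<phi> \<omega> = (\<Sum>j\<in>UNIV. D (\<lambda>\<phi>. blk c j (e j \<phi>)) \<phi> \<omega>)"
      unfolding e'_def by (intro D_sum smooth_linear[OF linear_blk] ea)
    also have "\<dots> = (\<Sum>j\<in>UNIV. blk c j (D (e j) \<phi> \<omega>))"
      by (intro sum.cong refl D_linear_compose ea linear_blk)
    also have "\<dots> = (\<Sum>j\<in>UNIV. D (e j) \<phi> \<omega>)"
      unfolding ea(5) by (intro sum.cong refl blk_factor factor_combination factor_scaleR DF_range blk_in_factor F_range \<Gamma>_factor)
    finally have 1: "D e' \<phi> \<omega> = (\<Sum>j\<in>UNIV. D (\<lambda>x. F j (blk c j x)) (\<Gamma> j (phase j \<phi>)) (e j \<phi>))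
        + g \<phi> - (\<Sum>j\<in>UNIV. a j \<phi> *\<^sub>R F j (\<Gamma> j (phase j \<phi>)))"
      by (simp add: ea(5) sum.distrib sum_subtractf sum_blk)
    have "D FF (E0 (\<phi>, 0)) (e' \<phi>) = (\<Sum>j\<in>UNIV. D (\<lambda>x. F j (blk c j x)) (E0 (\<phi>, 0)) (e' \<phi>))"
      unfolding FF_def[abs_def] by (rule D_sum[OF F_smooth])
    also have "\<dots> = (\<Sum>j\<in>UNIV. D (\<lambda>x. F j (blk c j x)) (\<Gamma> j (phase j \<phi>)) (e j \<phi>))"
    proof (intro sum.cong refl)
      fix j
      have "blk c j (e' \<phi>) = blk c j (e j \<phi>)"
        unfolding e'_def by (rule blk_sum_factors[OF blk_in_factor])
      then show "D (\<lambda>x. F j (blk c j x)) (E0 (\<phi>, 0)) (e' \<phi>) = D (\<lambda>x. F j (blk c j x)) (\<Gamma> j (phase j \<phi>)) (e j \<phi>)"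
        using D_F_blk[of j "E0 (\<phi>, 0)" "e' \<phi>"] D_F_blk[of j "\<Gamma> j (phase j \<phi>)" "e j \<phi>"]
        by (simp add: blk_E0 blk_\<Gamma>)
    qed
    finally have 2: "D FF (E0 (\<phi>, 0)) (e' \<phi>) = (\<Sum>j\<in>UNIV. D (\<lambda>x. F j (blk c j x)) (\<Gamma> j (phase j \<phi>)) (e j \<phi>))" .
    have 3: "D E0 (\<phi>, 0) (f' \<phi>, 0) = (\<Sum>j\<in>UNIV. a j \<phi> *\<^sub>R F j (\<Gamma> j (phase j \<phi>)))"
      by (simp add: D_E0 f'_def \<omega>_nonzero)
    show "D e' \<phi> \<omega> - D FF (E0 (\<phi>, 0)) (e' \<phi>) + D E0 (\<phi>, 0) (f' \<phi>, 0) = g \<phi>"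
      unfolding 1 2 3 by simp
  qed
qed

end

section \<open>Truncated expansions and their derivatives\<close>

lemma trunc_0: "trunc L 0 u x = u 0 x"
  by (simp add: trunc_def power_0_left if_distrib[of "\<lambda>a. a *\<^sub>R _"] cong: if_cong)

lemma trunc_update: "trunc (Suc L) \<epsilon> (u(Suc L := u')) x = trunc L \<epsilon> u x + \<epsilon> ^ Suc L *\<^sub>R u' x"
  by (simp add: trunc_def)

lemma smooth_trunc: "(\<And>l. smooth (u l)) \<Longrightarrow> smooth (trunc L \<epsilon> u)"
  unfolding trunc_def by (intro smooth_sum smooth_scaleR smooth_const) auto

lemma smooth_trunc_joint:
  assumes "\<And>l. smooth (u l)" "smooth_on S a" "smooth_on S g"
  shows "smooth_on S (\<lambda>x. trunc L (a x) u (g x))"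
  unfolding trunc_def by (intro smooth_sum smooth_scaleR smooth_power smooth_compose[OF assms(1)] assms)

lemma D_trunc:
  assumes "\<And>l. smooth (u l)"
  shows "D (trunc L \<epsilon> u) x v = (\<Sum>l\<le>L. \<epsilon> ^ l *\<^sub>R D (u l) x v)"
proof -
  have "(trunc L \<epsilon> u has_derivative (\<lambda>v. \<Sum>l\<le>L. \<epsilon> ^ l *\<^sub>R D (u l) x v)) (at x)"
    unfolding trunc_def
    by (intro has_derivative_sum has_derivative_scaleR_right smooth_imp_has_derivative assms)
  then show ?thesis by (simp add: D_eq)
qed

lemma smooth_D_trunc_joint:
  assumes "\<And>l. smooth (u l)" "smooth_on S a" "smooth_on S g" "smooth_on S h"
  shows "smooth_on S (\<lambda>x. D (trunc L (a x) u) (g x) (h x))"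
  unfolding D_trunc[OF assms(1)]
  by (intro smooth_sum smooth_scaleR smooth_power smooth_D_apply assms)

lemma period_trunc: "(\<And>l. period p (u l)) \<Longrightarrow> period p (trunc L \<epsilon> u)"
  by (simp add: period_def trunc_def)

lemma D_add_scaled:
  assumes "smooth U" "smooth V"
  shows "D (\<lambda>x. U x + a *\<^sub>R V x) x v = D U x v + a *\<^sub>R D V x v"
  by (rule fun_cong[OF D_eq])
    (intro has_derivative_add has_derivative_scaleR_right smooth_imp_has_derivative assms)

lemma D_slice:
  assumes "smooth E"
  shows "D (\<lambda>\<phi>. E (\<phi>, s)) \<phi> v = D E (\<phi>, s) (v, 0)"
proof -
  have "((\<lambda>\<phi>. E (\<phi>, s)) has_derivative (\<lambda>v. D E (\<phi>, s) (v, 0))) (at \<phi>)"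
    by (rule has_derivative_compose[OF _ smooth_imp_has_derivative[OF assms]])
      (auto intro!: derivative_eq_intros)
  then show ?thesis by (simp add: D_eq)
qed

context delay_network
begin

text \<open>The residuals are given exactly, for all real \<epsilon> and s, so that they can be
  divided by powers of \<epsilon>. The direction \<open>(f, - 1)\<close> packs both sides of the
  history equation into one derivative, and the state is the history at s = 0.\<close>

definition order_solution ::
  "nat \<Rightarrow> (nat \<Rightarrow> real^'m \<Rightarrow> real^'m) \<Rightarrow> (nat \<Rightarrow> (real^'m) \<times> real \<Rightarrow> real^'n) \<Rightarrow>
   (real \<times> (real^'m) \<Rightarrow> real^'n) \<Rightarrow> (real \<times> (real^'m) \<times> real \<Rightarrow> real^'n) \<Rightarrow> bool" where
  "order_solution L f E \<rho> \<sigma> \<longleftrightarrow>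
    (\<forall>l. smooth (f l)) \<and> (\<forall>l. torus_map (f l)) \<and>
    (\<forall>l. smooth (E l)) \<and> (\<forall>l i. period (axis i (2 * pi), 0) (E l)) \<and>
    (\<forall>\<phi>. f 0 \<phi> = \<omega>) \<and> E 0 = E0 \<and>
    smooth \<rho> \<and> (\<forall>i. period (0, axis i (2 * pi)) \<rho>) \<and>
    smooth \<sigma> \<and> (\<forall>i. period (0, axis i (2 * pi), 0) \<sigma>) \<and>
    (\<forall>\<epsilon> \<phi>. D (trunc L \<epsilon> E) (\<phi>, 0) (trunc L \<epsilon> f \<phi>, 0) - FF (trunc L \<epsilon> E (\<phi>, 0)) - \<epsilon> *\<^sub>R GG (trunc L \<epsilon> E) \<phi>
      = \<epsilon> ^ Suc L *\<^sub>R \<rho> (\<epsilon>, \<phi>)) \<and>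
    (\<forall>\<epsilon> \<phi> s. D (trunc L \<epsilon> E) (\<phi>, s) (trunc L \<epsilon> f \<phi>, - 1) = \<epsilon> ^ Suc L *\<^sub>R \<sigma> (\<epsilon>, \<phi>, s))"

lemma smooth_GG_joint:
  assumes "\<And>s. smooth (\<lambda>z. U z (g z, s))" "smooth g"
  shows "smooth (\<lambda>z. GG (U z) (g z))"
  unfolding GG_def
proof (intro smooth_sum)
  fix j k
  show "smooth (\<lambda>z. G j k (blk c j (U z (g z, 0))) (blk c k (U z (g z, - \<tau> j k))))"
    using smooth_compose[OF G_smooth smooth_Pair[OF assms(1) assms(1)], of j k 0 "- \<tau> j k"] by simp
qed

lemma period_GG: "period (p, 0) E \<Longrightarrow> period p (GG E)"
  by (simp add: period_def GG_def)

text \<open>The uncoupled torus with its linear flow solves both equations without coupling, so the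
  residual is the coupling term alone: \<rho> is - GG E0 and \<sigma> is 0.\<close>

lemma order_solution_0: "\<exists>f E \<rho> \<sigma>. order_solution 0 f E \<rho> \<sigma>"
proof -
  define f where "f l \<phi> = \<omega>" for l :: nat and \<phi> :: "real^'m"
  define E where "E l = E0" for l :: nat
  have t: "trunc 0 \<epsilon> E = E0" "trunc 0 \<epsilon> f = (\<lambda>\<phi>. \<omega>)" for \<epsilon>
    by (auto simp: trunc_def E_def f_def)
  have "smooth (\<lambda>z :: real \<times> (real^'m). - GG E0 (snd z))"
    by (intro smooth_minus smooth_GG_joint smooth_compose[OF smooth_E0] smooth_intros)
  moreover have "D E0 (\<phi>, 0) (\<omega>, 0) = FF (E0 (\<phi>, 0))" for \<phi>
    by (simp add: D_E0 FF_def blk_E0 \<omega>_nonzero)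
  moreover have "D E0 (\<phi>, s) (\<omega>, - 1) = 0" for \<phi> s
    by (simp add: D_E0 \<omega>_nonzero)
  ultimately have "order_solution 0 f E (\<lambda>z. - GG E0 (snd z)) (\<lambda>z. 0)"
    unfolding order_solution_def t using period_GG[OF E0_period] E0_period
    by (simp add: f_def[abs_def] E_def smooth_const smooth_E0 torus_map_def period_def)
  then show ?thesis by blast
qed

text \<open>After \<epsilon>^N with N = Suc L is factored out, the new residuals become smooth
  functions \<open>Q1\<close> and \<open>Q2\<close>. The linear equations for the corrections say
  exactly that these vanish at \<epsilon> = 0, and \<open>hadamard\<close> turns this into the
  missing factor \<epsilon>.\<close>

lemma order_solution_Suc:
  assumes "order_solution L f E \<rho> \<sigma>"
  shows "\<exists>f E \<rho> \<sigma>. order_solution (Suc L) f E \<rho> \<sigma>"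
proof -
  let ?N = "Suc L"
  have f: "\<And>l. smooth (f l)" "\<And>l. torus_map (f l)"
    and E: "\<And>l. smooth (E l)" "\<And>l i. period (axis i (2 * pi), 0) (E l)"
    and zero: "\<And>\<phi>. f 0 \<phi> = \<omega>" "E 0 = E0"
    and \<rho>: "smooth \<rho>" "\<And>i. period (0, axis i (2 * pi)) \<rho>"
    and \<sigma>: "smooth \<sigma>" "\<And>i. period (0, axis i (2 * pi), 0) \<sigma>"
    and R1: "\<And>\<epsilon> \<phi>. D (trunc L \<epsilon> E) (\<phi>, 0) (trunc L \<epsilon> f \<phi>, 0) - FF (trunc L \<epsilon> E (\<phi>, 0))
      - \<epsilon> *\<^sub>R GG (trunc L \<epsilon> E) \<phi> = \<epsilon> ^ ?N *\<^sub>R \<rho> (\<epsilon>, \<phi>)"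
    and R2: "\<And>\<epsilon> \<phi> s. D (trunc L \<epsilon> E) (\<phi>, s) (trunc L \<epsilon> f \<phi>, - 1) = \<epsilon> ^ ?N *\<^sub>R \<sigma> (\<epsilon>, \<phi>, s)"
    using assms unfolding order_solution_def by blast+
  have tE0: "trunc L 0 E = E0" by (simp add: fun_eq_iff trunc_0 zero)
  have tf0: "trunc L 0 f \<phi> = \<omega>" for \<phi> by (simp add: trunc_0 zero)
  have tE: "smooth (trunc L \<epsilon> E)" for \<epsilon> by (rule smooth_trunc[OF E(1)])
  have tE_period: "period (axis i (2 * pi), 0) (trunc L \<epsilon> E)" for i \<epsilon> by (rule period_trunc[OF E(2)])
  have tf_period: "period (axis i (2 * pi)) (trunc L \<epsilon> f)" for i \<epsilon>
    by (rule period_trunc) (use f(2) in \<open>simp add: torus_map_iff_period\<close>)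

  have "smooth (\<lambda>\<phi>. - \<rho> (0, \<phi>))" by (intro smooth_minus smooth_compose[OF \<rho>(1)] smooth_intros)
  moreover have "torus_map (\<lambda>\<phi>. - \<rho> (0, \<phi>))"
    unfolding torus_map_iff_period
  proof
    fix i show "period (axis i (2 * pi)) (\<lambda>\<phi>. - \<rho> (0, \<phi>))" using \<rho>(2)[of i] by (auto simp: period_def)
  qed
  ultimately obtain f' e' where f': "smooth f'" "torus_map f'" and e': "smooth e'" "torus_map e'"
    and lin: "\<And>\<phi>. D e' \<phi> \<omega> - D FF (E0 (\<phi>, 0)) (e' \<phi>) + D E0 (\<phi>, 0) (f' \<phi>, 0) = - \<rho> (0, \<phi>)"
    using linear_equation by metis
  have f'_period: "period (axis i (2 * pi)) f'" for i using f'(2) by (simp add: torus_map_iff_period)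

  \<comment> \<open>The source of the transport equation contains the effect of the phase correction
    on \<open>E0\<close>, so the state equation has to be solved before the history
    equation.\<close>
  define k where "k z = \<sigma> (0, z) + D E0 z (f' (fst z), 0)" for z
  have k: "smooth k"
    unfolding k_def by (intro smooth_add smooth_compose[OF \<sigma>(1)] smooth_D_apply smooth_E0 smooth_compose[OF f'(1)] smooth_intros)
  have k_period: "period (axis i (2 * pi), 0) k" for i
    using \<sigma>(2)[of i] f'_period[of i] period_D[OF E0_period smooth_E0, of i] by (simp add: k_def period_def split_paired_all)
  obtain E' where E': "smooth E'" "\<And>\<phi>. E' (\<phi>, 0) = e' \<phi>" "\<And>\<phi> s. D E' (\<phi>, s) (\<omega>, - 1) = - k (\<phi>, s)"
    "\<And>p. period p e' \<Longrightarrow> period (p, 0) k \<Longrightarrow> period (p, 0) E'"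
    using transport_equation[OF k e'(1), of \<omega>] by blast
  have E'_period: "period (axis i (2 * pi), 0) E'" for i
    using E'(4) k_period e'(2) by (simp add: torus_map_iff_period)

  define Q2 where "Q2 y = \<sigma> y + D (trunc L (fst y) E) (snd y) (f' (fst (snd y)), 0)
      + D E' (snd y) (trunc L (fst y) f (fst (snd y)), - 1) + fst y ^ ?N *\<^sub>R D E' (snd y) (f' (fst (snd y)), 0)" for y
  have Q2: "smooth Q2"
    unfolding Q2_def
    by (intro smooth_add \<sigma>(1) smooth_D_trunc_joint smooth_trunc_joint smooth_scaleR smooth_power smooth_D_apply
        E E'(1) smooth_compose[OF f'(1)] f smooth_Pair smooth_fst smooth_snd smooth_id smooth_const)
  have Q2_period: "period (0, axis i (2 * pi), 0) Q2" for i
    using \<sigma>(2)[of i] f'_period[of i] tf_period[of i] period_D[OF tE_period tE, of i] period_D[OF E'_period E'(1), of i]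
    by (simp add: Q2_def period_def split_paired_all)
  have Q2_0: "Q2 (0, z) = 0" for z
    using E'(3)[of "fst z" "snd z"] by (simp add: Q2_def tE0 tf0 k_def)
  obtain q2 where q2: "smooth q2" "\<And>\<epsilon> z. Q2 (\<epsilon>, z) = Q2 (0, z) + \<epsilon> *\<^sub>R q2 (\<epsilon>, z)"
    "\<And>p. period (0, p) Q2 \<Longrightarrow> period (0, p) q2"
    using hadamard[OF Q2] by metis

  \<comment> \<open>The first variable \<delta> stands for \<epsilon>^N and is kept independent of
    \<epsilon>, so that \<open>hadamard\<close> in \<delta> isolates the increment of the
    nonlinearity. At \<delta> = \<epsilon> = 0 its coefficient is the derivative of
    \<open>FF\<close> alone, since the coupling carries a factor \<epsilon>.\<close>
  define u where "u y = FF (trunc L (fst (snd y)) E (snd (snd y), 0) + fst y *\<^sub>R E' (snd (snd y), 0))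
    + fst (snd y) *\<^sub>R GG (\<lambda>z. trunc L (fst (snd y)) E z + fst y *\<^sub>R E' z) (snd (snd y))" for y
  have u: "smooth u"
    unfolding u_def
    by (intro smooth_add smooth_compose[OF smooth_FF] smooth_scaleR smooth_GG_joint smooth_trunc_joint E
        smooth_compose[OF E'(1)] smooth_Pair smooth_fst smooth_snd smooth_id smooth_const)
  have u_period: "period (0, 0, axis i (2 * pi)) u" for i
    using tE_period[of i] E'_period[of i] by (simp add: u_def period_def GG_def split_paired_all)
  obtain q where q: "smooth q" "\<And>\<delta> y. u (\<delta>, y) = u (0, y) + \<delta> *\<^sub>R q (\<delta>, y)"
    "\<And>y. q (0, y) = D u (0, y) (1, 0)" "\<And>p. period (0, p) u \<Longrightarrow> period (0, p) q"
    using hadamard[OF u] by metis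
  have q_0: "q (0, 0, \<phi>) = D FF (E0 (\<phi>, 0)) (e' \<phi>)" for \<phi>
  proof -
    have "((\<lambda>\<delta>. (\<delta>, 0, \<phi>)) has_vector_derivative (1, 0)) (at 0)"
      unfolding zero_prod_def by (intro has_vector_derivative_Pair) (auto intro!: derivative_eq_intros)
    from smooth_D_curve[OF u this]
    have "((\<lambda>\<delta>. FF (E0 (\<phi>, 0) + \<delta> *\<^sub>R e' \<phi>)) has_vector_derivative D u (0, 0, \<phi>) (1, 0)) (at 0)"
      by (simp add: u_def tE0 E'(2))
    moreover have "((\<lambda>\<delta>. E0 (\<phi>, 0) + \<delta> *\<^sub>R e' \<phi>) has_vector_derivative e' \<phi>) (at 0)"
      by (auto intro!: derivative_eq_intros)
    from smooth_D_curve[OF smooth_FF this]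
    have "((\<lambda>\<delta>. FF (E0 (\<phi>, 0) + \<delta> *\<^sub>R e' \<phi>)) has_vector_derivative D FF (E0 (\<phi>, 0)) (e' \<phi>)) (at 0)" by simp
    ultimately show ?thesis by (simp add: q(3) vector_derivative_unique_at)
  qed

  define Q1 where "Q1 y = \<rho> y + D (trunc L (fst y) E) (snd y, 0) (f' (snd y), 0)
      + D E' (snd y, 0) (trunc L (fst y) f (snd y), 0) + fst y ^ ?N *\<^sub>R D E' (snd y, 0) (f' (snd y), 0)
      - q (fst y ^ ?N, y)" for y
  have Q1: "smooth Q1"
    unfolding Q1_def
    by (intro smooth_add smooth_diff \<rho>(1) smooth_D_trunc_joint smooth_trunc_joint smooth_scaleR smooth_power smooth_D_apply
        smooth_compose[OF q(1)] E E'(1) smooth_compose[OF f'(1)] f smooth_Pair smooth_fst smooth_snd smooth_id smooth_const)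
  have Q1_period: "period (0, axis i (2 * pi)) Q1" for i
    using \<rho>(2)[of i] f'_period[of i] tf_period[of i] period_D[OF tE_period tE, of i] period_D[OF E'_period E'(1), of i]
      q(4)[OF u_period, of i]
    by (simp add: Q1_def period_def split_paired_all)
  have Q1_0: "Q1 (0, \<phi>) = 0" for \<phi>
  proof -
    have "e' = (\<lambda>\<phi>. E' (\<phi>, 0))" by (simp add: E'(2))
    then have "D e' \<phi> \<omega> = D E' (\<phi>, 0) (\<omega>, 0)" using D_slice[OF E'(1)] by metis
    with lin[of \<phi>] show ?thesis by (simp add: Q1_def tE0 tf0 q_0 algebra_simps)
  qed
  obtain q1 where q1: "smooth q1" "\<And>\<epsilon> z. Q1 (\<epsilon>, z) = Q1 (0, z) + \<epsilon> *\<^sub>R q1 (\<epsilon>, z)"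
    "\<And>p. period (0, p) Q1 \<Longrightarrow> period (0, p) q1"
    using hadamard[OF Q1] by metis

  define fN where "fN = f(?N := f')"
  define EN where "EN = E(?N := E')"
  have EN_fun: "trunc ?N \<epsilon> EN = (\<lambda>z. trunc L \<epsilon> E z + \<epsilon> ^ ?N *\<^sub>R E' z)" for \<epsilon>
    by (simp add: fun_eq_iff EN_def trunc_update)
  have fN_fun: "trunc ?N \<epsilon> fN \<phi> = trunc L \<epsilon> f \<phi> + \<epsilon> ^ ?N *\<^sub>R f' \<phi>" for \<epsilon> \<phi>
    by (simp add: fN_def trunc_update)
  \<comment> \<open>The derivative is linear in the map and in the direction, so both corrections
    expand exactly, including their product of order 2 N.\<close>
  have expand: "D (trunc ?N \<epsilon> EN) z (trunc ?N \<epsilon> fN \<phi>, r) = D (trunc L \<epsilon> E) z (trunc L \<epsilon> f \<phi>, r)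
      + \<epsilon> ^ ?N *\<^sub>R (D (trunc L \<epsilon> E) z (f' \<phi>, 0) + D E' z (trunc L \<epsilon> f \<phi>, r) + \<epsilon> ^ ?N *\<^sub>R D E' z (f' \<phi>, 0))" for \<epsilon> \<phi> r z
  proof -
    have "(trunc ?N \<epsilon> fN \<phi>, r) = (trunc L \<epsilon> f \<phi>, r) + \<epsilon> ^ ?N *\<^sub>R (f' \<phi>, 0)" by (simp add: fN_fun)
    then show ?thesis
      unfolding EN_fun D_add_scaled[OF tE E'(1)]
      by (simp only: linear_add[OF linear_D[OF tE]] linear_add[OF linear_D[OF E'(1)]]
          linear_scale[OF linear_D[OF tE]] linear_scale[OF linear_D[OF E'(1)]] scaleR_add_right add.assoc add.left_commute)
  qed
  have S1: "D (trunc ?N \<epsilon> EN) (\<phi>, 0) (trunc ?N \<epsilon> fN \<phi>, 0) - FF (trunc ?N \<epsilon> EN (\<phi>, 0)) - \<epsilon> *\<^sub>R GG (trunc ?N \<epsilon> EN) \<phi>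
      = \<epsilon> ^ Suc ?N *\<^sub>R q1 (\<epsilon>, \<phi>)" for \<epsilon> \<phi>
  proof -
    have nl: "FF (trunc ?N \<epsilon> EN (\<phi>, 0)) + \<epsilon> *\<^sub>R GG (trunc ?N \<epsilon> EN) \<phi> = FF (trunc L \<epsilon> E (\<phi>, 0)) + \<epsilon> *\<^sub>R GG (trunc L \<epsilon> E) \<phi>
        + \<epsilon> ^ ?N *\<^sub>R q (\<epsilon> ^ ?N, \<epsilon>, \<phi>)"
      using q(2)[of "\<epsilon> ^ ?N" "(\<epsilon>, \<phi>)"] unfolding EN_fun by (simp add: u_def)
    have "D (trunc ?N \<epsilon> EN) (\<phi>, 0) (trunc ?N \<epsilon> fN \<phi>, 0) - (FF (trunc ?N \<epsilon> EN (\<phi>, 0)) + \<epsilon> *\<^sub>R GG (trunc ?N \<epsilon> EN) \<phi>)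
        = \<epsilon> ^ ?N *\<^sub>R Q1 (\<epsilon>, \<phi>)"
      unfolding nl expand Q1_def using R1[of \<epsilon> \<phi>]
      by (simp add: scaleR_add_right scaleR_diff_right del: power_Suc) (simp add: algebra_simps)
    also have "\<dots> = \<epsilon> ^ Suc ?N *\<^sub>R q1 (\<epsilon>, \<phi>)"
      using q1(2)[of \<epsilon> \<phi>] by (simp add: Q1_0 mult.commute)
    finally show ?thesis by (simp add: algebra_simps)
  qed
  have S2: "D (trunc ?N \<epsilon> EN) (\<phi>, s) (trunc ?N \<epsilon> fN \<phi>, - 1) = \<epsilon> ^ Suc ?N *\<^sub>R q2 (\<epsilon>, \<phi>, s)" for \<epsilon> \<phi> s
  proof -
    have "D (trunc ?N \<epsilon> EN) (\<phi>, s) (trunc ?N \<epsilon> fN \<phi>, - 1) = \<epsilon> ^ ?N *\<^sub>R Q2 (\<epsilon>, \<phi>, s)"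
      unfolding expand Q2_def R2 by (simp add: scaleR_add_right del: power_Suc)
    also have "\<dots> = \<epsilon> ^ Suc ?N *\<^sub>R q2 (\<epsilon>, \<phi>, s)"
      using q2(2)[of \<epsilon> "(\<phi>, s)"] by (simp add: Q2_0 mult.commute)
    finally show ?thesis .
  qed
  have "order_solution ?N fN EN q1 q2"
    unfolding order_solution_def
  proof (intro conjI allI)
    show "smooth (fN l)" "torus_map (fN l)" "smooth (EN l)" "period (axis i (2 * pi), 0) (EN l)" for l i
      using f f' E E'(1) E'_period by (auto simp: fN_def EN_def)
    show "fN 0 \<phi> = \<omega>" for \<phi> using zero by (simp add: fN_def)
    show "EN 0 = E0" using zero by (simp add: EN_def)
  qed (use q1 q2 Q1_period Q2_period S1 S2 in auto)
  then show ?thesis by blast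
qed

lemma order_solution_exists: "\<exists>f E \<rho> \<sigma>. order_solution L f E \<rho> \<sigma>"
  by (induction L) (use order_solution_0 order_solution_Suc in blast)+

end

section \<open>Estimates of the residuals\<close>

lemma uniform_bigoI:
  assumes "\<And>\<epsilon> x. \<bar>\<epsilon>\<bar> \<le> 1 \<Longrightarrow> x \<in> A \<epsilon> \<Longrightarrow> norm (r \<epsilon> x) \<le> C * \<bar>\<epsilon>\<bar> ^ p"
  shows "uniform_bigo p A r"
  unfolding uniform_bigo_def eventually_nhds_metric
  by (rule exI[of _ C], rule exI[of _ 1]) (use assms in auto)

lemma norm_blk_le: "norm (blk c j x) \<le> norm x"
  by (rule norm_le_componentwise_cart) (simp add: blk_def)

lemma smooth_D_bounded_on_compact:
  fixes g :: "'a::euclidean_space \<Rightarrow> 'b::real_normed_vector"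
  assumes "smooth g" "compact S"
  obtains K where "K \<ge> 0" "\<And>x h. x \<in> S \<Longrightarrow> norm (D g x h) \<le> K * norm h"
proof -
  have "\<exists>C. \<forall>x\<in>S. norm (D g x b) \<le> C" for b
  proof -
    have "continuous_on S (\<lambda>x. D g x b)"
      using smooth_imp_continuous_on[OF smooth_D[OF assms(1)], of b] continuous_on_subset by blast
    then have "bounded ((\<lambda>x. D g x b) ` S)"
      by (intro compact_imp_bounded compact_continuous_image assms(2))
    then show ?thesis by (simp add: bounded_iff)
  qed
  then obtain C where C: "\<And>b x. x \<in> S \<Longrightarrow> norm (D g x b) \<le> C b" by metis
  have "norm (D g x h) \<le> (\<Sum>b\<in>Basis. \<bar>C b\<bar>) * norm h" if "x \<in> S" for x h
  proof -
    have "norm (D g x h) = norm (\<Sum>b\<in>Basis. (h \<bullet> b) *\<^sub>R D g x b)"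
      using linear_euclidean_sum[OF linear_D[OF assms(1)]] by metis
    also have "\<dots> \<le> (\<Sum>b\<in>Basis. norm h * \<bar>C b\<bar>)"
      using C[OF that] by (intro sum_norm_le) (simp add: Basis_le_norm mult_mono order.trans[OF _ abs_ge_self])
    finally show ?thesis by (simp add: sum_distrib_left mult.commute)
  qed
  then show ?thesis by (rule that[rotated]) (auto intro: sum_nonneg)
qed

lemma smooth_lipschitz_on_compact:
  fixes g :: "'a::euclidean_space \<Rightarrow> 'b::real_normed_vector"
  assumes g: "smooth g" and S: "compact S" "convex S"
  obtains K where "K \<ge> 0" "\<And>x y. x \<in> S \<Longrightarrow> y \<in> S \<Longrightarrow> norm (g x - g y) \<le> K * norm (x - y)"
proof -
  obtain K where K: "K \<ge> 0" "\<And>x h. x \<in> S \<Longrightarrow> norm (D g x h) \<le> K * norm h"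
    using smooth_D_bounded_on_compact[OF g S(1)] by metis
  have "norm (g x - g y) \<le> K * norm (x - y)" if "x \<in> S" "y \<in> S" for x y
  proof (rule differentiable_bound[OF S(2) _ _ that])
    show "(g has_derivative D g x) (at x within S)" for x
      using smooth_imp_has_derivative[OF g] by (rule has_derivative_at_withinI)
    show "onorm (D g x) \<le> K" if "x \<in> S" for x
      by (rule onorm_bound) (use K that in auto)
  qed
  with K(1) show ?thesis by (rule that)
qed

lemma max_delay_ge: "\<tau> j k \<le> max_delay \<tau>" for \<tau> :: "'m::finite \<Rightarrow> 'm \<Rightarrow> real"
  unfolding max_delay_def by (rule Max_ge) (auto intro: range_eqI[of _ _ "(j, k)"])

context delay_network
begin

lemma network_rhs_blk:
  "network_rhs c F G \<epsilon> j (U (\<phi>, 0)) (\<lambda>k. U (\<phi>, - \<tau> j k)) = blk c j (FF (U (\<phi>, 0)) + \<epsilon> *\<^sub>R GG U \<phi>)"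
proof -
  have "blk c j (FF (U (\<phi>, 0))) = F j (blk c j (U (\<phi>, 0)))"
    unfolding FF_def by (intro blk_sum_factors F_range blk_in_factor)
  moreover have "blk c j (GG U \<phi>) = (\<Sum>k\<in>UNIV. G j k (blk c j (U (\<phi>, 0))) (blk c k (U (\<phi>, - \<tau> j k))))"
    unfolding GG_def by (intro blk_sum_factors factor_sum G_range blk_in_factor)
  ultimately show ?thesis
    by (simp add: network_rhs_def linear_add[OF linear_blk] linear_scale[OF linear_blk])
qed

context
  fixes L :: nat and f E \<rho> \<sigma>
  assumes sol: "order_solution L f E \<rho> \<sigma>"
begin

lemma f_sol: "smooth (f l)" "torus_map (f l)" "f 0 \<phi> = \<omega>"
  and E_sol: "smooth (E l)" "period (axis i (2 * pi), 0) (E l)" "E 0 = E0"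
  and \<rho>_sol: "smooth \<rho>" "period (0, axis i (2 * pi)) \<rho>"
  and \<sigma>_sol: "smooth \<sigma>" "period (0, axis i (2 * pi), 0) \<sigma>"
  and state_residual: "D (trunc L \<epsilon> E) (\<phi>, 0) (trunc L \<epsilon> f \<phi>, 0) - FF (trunc L \<epsilon> E (\<phi>, 0))
      - \<epsilon> *\<^sub>R GG (trunc L \<epsilon> E) \<phi> = \<epsilon> ^ Suc L *\<^sub>R \<rho> (\<epsilon>, \<phi>)"
  and history_residual: "D (trunc L \<epsilon> E) (\<phi>, s) (trunc L \<epsilon> f \<phi>, - 1) = \<epsilon> ^ Suc L *\<^sub>R \<sigma> (\<epsilon>, \<phi>, s)"
  using sol unfolding order_solution_def by blast+

lemma smooth_truncE: "smooth (trunc L \<epsilon> E)"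
  by (rule smooth_trunc[OF E_sol(1)])

lemma \<rho>_bounded: "\<exists>C. \<forall>\<epsilon> \<phi>. \<bar>\<epsilon>\<bar> \<le> 1 \<longrightarrow> norm (\<rho> (\<epsilon>, \<phi>)) \<le> C"
proof -
  have "continuous_on UNIV (\<lambda>z :: real \<times> (real^'m) \<times> real. \<rho> (fst z, fst (snd z)))"
    by (intro smooth_imp_continuous_on smooth_compose[OF \<rho>_sol(1)] smooth_Pair smooth_fst smooth_snd smooth_id)
  moreover have "period (0, axis i (2 * pi), 0) (\<lambda>z :: real \<times> (real^'m) \<times> real. \<rho> (fst z, fst (snd z)))" for i
    using \<rho>_sol(2)[of i] by (simp add: period_def split_paired_all)
  ultimately have "\<exists>C. \<forall>\<epsilon> \<phi> s. \<bar>\<epsilon>\<bar> \<le> 1 \<longrightarrow> s \<in> {0..0::real} \<longrightarrow> norm (\<rho> (fst (\<epsilon>, \<phi>, s), fst (snd (\<epsilon>, \<phi>, s)))) \<le> C"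
    by (rule periodic_bounded)
  then show ?thesis by simp
qed

lemma \<sigma>_bounded: "\<exists>C. \<forall>\<epsilon> \<phi> s. \<bar>\<epsilon>\<bar> \<le> 1 \<longrightarrow> s \<in> {- max_delay \<tau>..0} \<longrightarrow> norm (\<sigma> (\<epsilon>, \<phi>, s)) \<le> C"
  by (rule periodic_bounded[OF smooth_imp_continuous_on[OF \<sigma>_sol(1)] \<sigma>_sol(2)])

text \<open>Provides a ball, common to all small \<epsilon>, all phases and all history times, on
  which \<open>G\<close> has a Lipschitz constant.\<close>

lemma E_bounded: "\<exists>C. \<forall>\<epsilon> \<phi> s. \<bar>\<epsilon>\<bar> \<le> 1 \<longrightarrow> s \<in> {- max_delay \<tau>..0} \<longrightarrow> norm (trunc L \<epsilon> E (\<phi>, s)) \<le> C"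
proof -
  have "continuous_on UNIV (\<lambda>z. trunc L (fst z) E (snd z))"
    by (rule smooth_imp_continuous_on[OF smooth_trunc_joint[OF E_sol(1) smooth_fst[OF smooth_id] smooth_snd[OF smooth_id]]])
  moreover have "period (0, axis i (2 * pi), 0) (\<lambda>z. trunc L (fst z) E (snd z))" for i
  proof -
    have "period (axis i (2 * pi), 0) (trunc L \<epsilon> E)" for \<epsilon> by (rule period_trunc[OF E_sol(2)])
    then show ?thesis by (simp add: period_def split_paired_all)
  qed
  ultimately have "\<exists>C. \<forall>\<epsilon> \<phi> s. \<bar>\<epsilon>\<bar> \<le> 1 \<longrightarrow> s \<in> {- max_delay \<tau>..0} \<longrightarrow>
      norm (trunc L (fst (\<epsilon>, \<phi>, s)) E (snd (\<epsilon>, \<phi>, s))) \<le> C"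
    by (rule periodic_bounded)
  then show ?thesis by simp
qed

lemma state_equation:
  obtains C where "\<And>\<epsilon> \<phi> j. \<bar>\<epsilon>\<bar> \<le> 1 \<Longrightarrow> norm (blk c j (D (trunc L \<epsilon> E) (\<phi>, 0) (trunc L \<epsilon> f \<phi>, 0))
    - network_rhs c F G \<epsilon> j (trunc L \<epsilon> E (\<phi>, 0)) (\<lambda>k. trunc L \<epsilon> E (\<phi>, - \<tau> j k))) \<le> C * \<bar>\<epsilon>\<bar> ^ (L + 1)"
proof -
  obtain C where C: "\<And>\<epsilon> \<phi>. \<bar>\<epsilon>\<bar> \<le> 1 \<Longrightarrow> norm (\<rho> (\<epsilon>, \<phi>)) \<le> C" using \<rho>_bounded by blast
  show ?thesis
  proof (rule that[of C])
    fix \<epsilon> :: real and \<phi> j assume \<epsilon>: "\<bar>\<epsilon>\<bar> \<le> 1"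
    have "blk c j (D (trunc L \<epsilon> E) (\<phi>, 0) (trunc L \<epsilon> f \<phi>, 0))
        - network_rhs c F G \<epsilon> j (trunc L \<epsilon> E (\<phi>, 0)) (\<lambda>k. trunc L \<epsilon> E (\<phi>, - \<tau> j k))
        = blk c j (\<epsilon> ^ Suc L *\<^sub>R \<rho> (\<epsilon>, \<phi>))"
      unfolding network_rhs_blk state_residual[symmetric]
      by (simp add: linear_diff[OF linear_blk] linear_add[OF linear_blk])
    also have "norm \<dots> \<le> norm (\<epsilon> ^ Suc L *\<^sub>R \<rho> (\<epsilon>, \<phi>))" by (rule norm_blk_le)
    also have "\<dots> = norm (\<rho> (\<epsilon>, \<phi>)) * \<bar>\<epsilon>\<bar> ^ (L + 1)" by (simp add: power_abs abs_mult)
    also have "\<dots> \<le> C * \<bar>\<epsilon>\<bar> ^ (L + 1)" by (intro mult_right_mono C \<epsilon>) auto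
    finally show "norm (blk c j (D (trunc L \<epsilon> E) (\<phi>, 0) (trunc L \<epsilon> f \<phi>, 0))
        - network_rhs c F G \<epsilon> j (trunc L \<epsilon> E (\<phi>, 0)) (\<lambda>k. trunc L \<epsilon> E (\<phi>, - \<tau> j k))) \<le> C * \<bar>\<epsilon>\<bar> ^ (L + 1)" .
  qed
qed

lemma history_equation:
  obtains C where "C \<ge> 0" "\<And>\<epsilon> \<phi> s. \<bar>\<epsilon>\<bar> \<le> 1 \<Longrightarrow> s \<in> {- max_delay \<tau>..0} \<Longrightarrow>
    norm (D (trunc L \<epsilon> E) (\<phi>, s) (trunc L \<epsilon> f \<phi>, - 1)) \<le> C * \<bar>\<epsilon>\<bar> ^ (L + 1)"
proof -
  obtain C where C: "\<And>\<epsilon> \<phi> s. \<bar>\<epsilon>\<bar> \<le> 1 \<Longrightarrow> s \<in> {- max_delay \<tau>..0} \<Longrightarrow> norm (\<sigma> (\<epsilon>, \<phi>, s)) \<le> C"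
    using \<sigma>_bounded by blast
  show ?thesis
  proof (rule that[of "\<bar>C\<bar>"])
    fix \<epsilon> :: real and \<phi> s assume *: "\<bar>\<epsilon>\<bar> \<le> 1" "s \<in> {- max_delay \<tau>..0}"
    have "norm (D (trunc L \<epsilon> E) (\<phi>, s) (trunc L \<epsilon> f \<phi>, - 1)) = norm (\<sigma> (\<epsilon>, \<phi>, s)) * \<bar>\<epsilon>\<bar> ^ (L + 1)"
      unfolding history_residual by (simp add: power_abs abs_mult)
    also have "\<dots> \<le> \<bar>C\<bar> * \<bar>\<epsilon>\<bar> ^ (L + 1)"
      using C[OF *, of \<phi>] by (intro mult_right_mono) auto
    finally show "norm (D (trunc L \<epsilon> E) (\<phi>, s) (trunc L \<epsilon> f \<phi>, - 1)) \<le> \<bar>C\<bar> * \<bar>\<epsilon>\<bar> ^ (L + 1)" .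
  qed simp
qed

text \<open>Compare along \<open>r \<mapsto> (\<phi> (t + s - r), r)\<close>, which joins \<open>(\<phi> (t + s), 0)\<close> to
  \<open>(\<phi> t, s)\<close> and on which the residual of the history equation is the derivative.\<close>

lemma history_along_trajectory:
  obtains C where "\<And>\<epsilon> \<phi> t s. \<bar>\<epsilon>\<bar> \<le> 1 \<Longrightarrow> (\<phi>, t) \<in> trajectories (trunc L \<epsilon> f) \<Longrightarrow> s \<in> {- max_delay \<tau>..0} \<Longrightarrow>
    norm (trunc L \<epsilon> E (\<phi> t, s) - trunc L \<epsilon> E (\<phi> (t + s), 0)) \<le> C * \<bar>\<epsilon>\<bar> ^ (L + 1)"
proof -
  obtain C where C: "C \<ge> 0" "\<And>\<epsilon> \<phi> s. \<bar>\<epsilon>\<bar> \<le> 1 \<Longrightarrow> s \<in> {- max_delay \<tau>..0} \<Longrightarrow>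
    norm (D (trunc L \<epsilon> E) (\<phi>, s) (trunc L \<epsilon> f \<phi>, - 1)) \<le> C * \<bar>\<epsilon>\<bar> ^ (L + 1)"
    using history_equation by metis
  show ?thesis
  \<comment> \<open>The factor \<open>max_delay \<tau>\<close> bounds the length of the interval
    [s, 0] over which the residual accumulates.\<close>
  proof (rule that[of "C * max_delay \<tau>"])
    fix \<epsilon> :: real and \<phi> t s
    assume \<epsilon>: "\<bar>\<epsilon>\<bar> \<le> 1" and traj: "(\<phi>, t) \<in> trajectories (trunc L \<epsilon> f)" and s: "s \<in> {- max_delay \<tau>..0}"
    let ?b = "C * \<bar>\<epsilon>\<bar> ^ (L + 1)"
    have \<phi>: "(\<phi> has_vector_derivative trunc L \<epsilon> f (\<phi> r)) (at r)" for r
      using traj by (simp add: trajectories_def)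
    define w where "w r = trunc L \<epsilon> E (\<phi> (t + s - r), r)" for r
    define w' where "w' r = D (trunc L \<epsilon> E) (\<phi> (t + s - r), r) (- trunc L \<epsilon> f (\<phi> (t + s - r)), 1)" for r
    have w: "(w has_vector_derivative w' r) (at r)" for r
    proof -
      have "((\<lambda>r. t + s - r) has_vector_derivative - 1) (at r)" by (auto intro!: derivative_eq_intros)
      from vector_diff_chain_at[OF this \<phi>]
      have "((\<lambda>r. (\<phi> (t + s - r), r)) has_vector_derivative (- trunc L \<epsilon> f (\<phi> (t + s - r)), 1)) (at r)"
        by (intro has_vector_derivative_Pair has_vector_derivative_id) (simp add: o_def)
      from smooth_D_curve[OF smooth_truncE this] show ?thesis by (simp add: w_def[abs_def] w'_def)
    qed
    have w': "norm (w' r) \<le> ?b" if "r \<in> {s..0}" for r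
    proof -
      have "w' r = - D (trunc L \<epsilon> E) (\<phi> (t + s - r), r) (trunc L \<epsilon> f (\<phi> (t + s - r)), - 1)"
        using linear_neg[OF linear_D[OF smooth_truncE], of \<epsilon> "(\<phi> (t + s - r), r)" "(trunc L \<epsilon> f (\<phi> (t + s - r)), - 1)"]
        by (simp add: w'_def)
      then show ?thesis using C(2)[OF \<epsilon>, of r] that s by simp
    qed
    have "norm (w s - w 0) \<le> ?b * norm (s - 0)"
    proof (rule differentiable_bound[of "{s..0}"])
      show "(w has_derivative (\<lambda>h. h *\<^sub>R w' r)) (at r within {s..0})" for r
        using has_vector_derivative_at_within[OF w] by (simp add: has_vector_derivative_def)
      show "onorm (\<lambda>h. h *\<^sub>R w' r) \<le> ?b" if "r \<in> {s..0}" for r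
      proof (rule onorm_bound)
        show "norm (h *\<^sub>R w' r) \<le> ?b * norm h" for h
          using mult_right_mono[OF w'[OF that], of "\<bar>h\<bar>"] by (simp add: mult.commute)
      qed (use C in simp)
    qed (use s in auto)
    also have "\<dots> \<le> ?b * max_delay \<tau>" using s C by (intro mult_left_mono) auto
    finally show "norm (trunc L \<epsilon> E (\<phi> t, s) - trunc L \<epsilon> E (\<phi> (t + s), 0)) \<le> C * max_delay \<tau> * \<bar>\<epsilon>\<bar> ^ (L + 1)"
      by (simp add: w_def mult_ac)
  qed
qed

text \<open>A smooth map is Lipschitz on a compact convex set such as a product of balls. Summing
  the constants over all pairs gives one that is independent of \<open>j\<close> and
  \<open>k\<close>.\<close>

lemma G_lipschitz:
  obtains K where "K \<ge> 0" "\<And>j k x y y'. norm x \<le> B \<Longrightarrow> norm y \<le> B \<Longrightarrow> norm y' \<le> B \<Longrightarrow>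
    norm (G j k (blk c j x) (blk c k y) - G j k (blk c j x) (blk c k y')) \<le> K * norm (y - y')"
proof -
  have "\<exists>K\<ge>0. \<forall>z\<in>cball 0 B \<times> cball 0 B. \<forall>z'\<in>cball 0 B \<times> cball 0 B.
      norm ((\<lambda>(x, y). G j k (blk c j x) (blk c k y)) z - (\<lambda>(x, y). G j k (blk c j x) (blk c k y)) z') \<le> K * norm (z - z')" for j k
    using smooth_lipschitz_on_compact[OF G_smooth, of "cball 0 B \<times> cball 0 B" j k]
    by (metis compact_Times compact_cball convex_Times convex_cball)
  then obtain K where K: "\<And>j k. K j k \<ge> 0" "\<And>j k z z'. z \<in> cball 0 B \<times> cball 0 B \<Longrightarrow> z' \<in> cball 0 B \<times> cball 0 B \<Longrightarrow>
      norm ((\<lambda>(x, y). G j k (blk c j x) (blk c k y)) z - (\<lambda>(x, y). G j k (blk c j x) (blk c k y)) z') \<le> K j k * norm (z - z')"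
    by metis
  show ?thesis
  proof (rule that[of "\<Sum>j\<in>UNIV. \<Sum>k\<in>UNIV. K j k"])
    show "0 \<le> (\<Sum>j\<in>UNIV. \<Sum>k\<in>UNIV. K j k)" by (intro sum_nonneg K)
    fix j k and x y y' :: "real^'n" assume *: "norm x \<le> B" "norm y \<le> B" "norm y' \<le> B"
    have "norm (G j k (blk c j x) (blk c k y) - G j k (blk c j x) (blk c k y')) \<le> K j k * norm (y - y')"
      using K(2)[of "(x, y)" "(x, y')" j k] * by (simp add: norm_Pair)
    also have "K j k \<le> (\<Sum>k\<in>UNIV. K j k)" using K by (intro member_le_sum) auto
    also have "\<dots> \<le> (\<Sum>j\<in>UNIV. \<Sum>k\<in>UNIV. K j k)" using K by (intro member_le_sum[of j UNIV "\<lambda>j. \<Sum>k\<in>UNIV. K j k"] sum_nonneg) auto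
    finally show "norm (G j k (blk c j x) (blk c k y) - G j k (blk c j x) (blk c k y')) \<le> (\<Sum>j\<in>UNIV. \<Sum>k\<in>UNIV. K j k) * norm (y - y')"
      by (simp add: mult_right_mono)
  qed
qed

text \<open>Exchanging the delayed history value at \<phi>(t) for the state at \<phi>(t - \<tau>)
  costs the Lipschitz constant of \<open>G\<close> times the error from
  \<open>history_along_trajectory\<close>, once for each of the CARD('m) coupling terms; the
  prefactor \<epsilon> is at most 1 in modulus.\<close>

lemma state_along_trajectory:
  obtains C where "\<And>\<epsilon> \<phi> t j. \<bar>\<epsilon>\<bar> \<le> 1 \<Longrightarrow> (\<phi>, t) \<in> trajectories (trunc L \<epsilon> f) \<Longrightarrow>
    norm (blk c j (D (trunc L \<epsilon> E) (\<phi> t, 0) (trunc L \<epsilon> f (\<phi> t), 0))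
      - network_rhs c F G \<epsilon> j (trunc L \<epsilon> E (\<phi> t, 0)) (\<lambda>k. trunc L \<epsilon> E (\<phi> (t - \<tau> j k), 0))) \<le> C * \<bar>\<epsilon>\<bar> ^ (L + 1)"
proof -
  obtain C1 where C1: "\<And>\<epsilon> \<phi> j. \<bar>\<epsilon>\<bar> \<le> 1 \<Longrightarrow> norm (blk c j (D (trunc L \<epsilon> E) (\<phi>, 0) (trunc L \<epsilon> f \<phi>, 0))
    - network_rhs c F G \<epsilon> j (trunc L \<epsilon> E (\<phi>, 0)) (\<lambda>k. trunc L \<epsilon> E (\<phi>, - \<tau> j k))) \<le> C1 * \<bar>\<epsilon>\<bar> ^ (L + 1)"
    using state_equation by blast
  obtain C2 where C2: "\<And>\<epsilon> \<phi> t s. \<bar>\<epsilon>\<bar> \<le> 1 \<Longrightarrow> (\<phi>, t) \<in> trajectories (trunc L \<epsilon> f) \<Longrightarrow> s \<in> {- max_delay \<tau>..0} \<Longrightarrow>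
    norm (trunc L \<epsilon> E (\<phi> t, s) - trunc L \<epsilon> E (\<phi> (t + s), 0)) \<le> C2 * \<bar>\<epsilon>\<bar> ^ (L + 1)"
    using history_along_trajectory by blast
  obtain B where B: "\<And>\<epsilon> \<phi> s. \<bar>\<epsilon>\<bar> \<le> 1 \<Longrightarrow> s \<in> {- max_delay \<tau>..0} \<Longrightarrow> norm (trunc L \<epsilon> E (\<phi>, s)) \<le> B"
    using E_bounded by blast
  obtain K where K: "K \<ge> 0" "\<And>j k x y y'. norm x \<le> B \<Longrightarrow> norm y \<le> B \<Longrightarrow> norm y' \<le> B \<Longrightarrow>
    norm (G j k (blk c j x) (blk c k y) - G j k (blk c j x) (blk c k y')) \<le> K * norm (y - y')"
    using G_lipschitz[of B] by blast
  have delay: "- \<tau> j k \<in> {- max_delay \<tau>..0}" for j k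
    using delay_pos[of j k] max_delay_ge[of \<tau> j k] by simp
  have zero: "0 \<in> {- max_delay \<tau>..0}" using delay by fastforce
  show ?thesis
  proof (rule that[of "C1 + real CARD('m) * (K * C2)"])
    fix \<epsilon> :: real and \<phi> t j assume \<epsilon>: "\<bar>\<epsilon>\<bar> \<le> 1" and traj: "(\<phi>, t) \<in> trajectories (trunc L \<epsilon> f)"
    let ?x = "trunc L \<epsilon> E (\<phi> t, 0)" and ?b = "\<bar>\<epsilon>\<bar> ^ (L + 1)"
    let ?y = "\<lambda>k. trunc L \<epsilon> E (\<phi> t, - \<tau> j k)" and ?y' = "\<lambda>k. trunc L \<epsilon> E (\<phi> (t - \<tau> j k), 0)"
    let ?d = "blk c j (D (trunc L \<epsilon> E) (\<phi> t, 0) (trunc L \<epsilon> f (\<phi> t), 0))"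
    let ?S = "\<Sum>k\<in>UNIV. G j k (blk c j ?x) (blk c k (?y k)) - G j k (blk c j ?x) (blk c k (?y' k))"
    have "norm ?S \<le> (\<Sum>k\<in>(UNIV :: 'm set). K * (C2 * ?b))"
    proof (rule sum_norm_le)
      fix k
      have "norm (G j k (blk c j ?x) (blk c k (?y k)) - G j k (blk c j ?x) (blk c k (?y' k))) \<le> K * norm (?y k - ?y' k)"
        by (intro K B \<epsilon> zero delay)
      also have "\<dots> \<le> K * (C2 * ?b)"
        using C2[OF \<epsilon> traj delay[of j k]] by (intro mult_left_mono K) simp
      finally show "norm (G j k (blk c j ?x) (blk c k (?y k)) - G j k (blk c j ?x) (blk c k (?y' k))) \<le> K * (C2 * ?b)" .
    qed
    then have S: "norm ?S \<le> real CARD('m) * (K * C2) * ?b" by (simp add: mult_ac)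
    have "norm (\<epsilon> *\<^sub>R ?S) \<le> 1 * norm ?S" unfolding norm_scaleR using \<epsilon> by (intro mult_right_mono) auto
    with S have S': "norm (\<epsilon> *\<^sub>R ?S) \<le> real CARD('m) * (K * C2) * ?b" by simp
    have "?d - network_rhs c F G \<epsilon> j ?x ?y' = (?d - network_rhs c F G \<epsilon> j ?x ?y) + \<epsilon> *\<^sub>R ?S"
      by (simp add: network_rhs_def sum_subtractf algebra_simps)
    also have "norm \<dots> \<le> C1 * ?b + real CARD('m) * (K * C2) * ?b"
      by (rule order.trans[OF norm_triangle_ineq add_mono[OF C1[OF \<epsilon>] S']])
    finally show "norm (?d - network_rhs c F G \<epsilon> j ?x ?y') \<le> (C1 + real CARD('m) * (K * C2)) * ?b"
      by (simp add: algebra_simps)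
  qed
qed

end

end

theorem theorem1p1:
  fixes c :: "'n::finite \<Rightarrow> 'm::finite"
    and F :: "'m \<Rightarrow> real^'n \<Rightarrow> real^'n"
    and G :: "'m \<Rightarrow> 'm \<Rightarrow> real^'n \<Rightarrow> real^'n \<Rightarrow> real^'n"
    and \<tau> :: "'m \<Rightarrow> 'm \<Rightarrow> real"
    and \<Gamma> :: "'m \<Rightarrow> real \<Rightarrow> real^'n"
    and T :: "'m \<Rightarrow> real"
    and L :: nat
  assumes F_range: "\<And>j x. x \<in> factor c j \<Longrightarrow> F j x \<in> factor c j"
    and F_smooth: "\<And>j. smooth_on UNIV (\<lambda>x. F j (blk c j x))"
    and G_range: "\<And>j k x y. x \<in> factor c j \<Longrightarrow> y \<in> factor c k \<Longrightarrow> G j k x y \<in> factor c j"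
    and G_smooth: "\<And>j k. smooth_on UNIV (\<lambda>(x, y). G j k (blk c j x) (blk c k y))"
    and delay_pos: "\<And>j k. 0 < \<tau> j k"
    and periodic: "\<And>j. nonconstant_periodic_solution c j (F j) (T j) (\<Gamma> j)"
    and hyperbolic: "\<And>j. normally_hyperbolic c j (F j) (T j) (\<Gamma> j)"
  shows "\<exists>(f :: nat \<Rightarrow> real^'m \<Rightarrow> real^'m) (e :: nat \<Rightarrow> real^'m \<Rightarrow> real^'n)
          (E :: nat \<Rightarrow> (real^'m) \<times> real \<Rightarrow> real^'n).
    (\<forall>l\<le>L. torus_map (f l) \<and> smooth_on UNIV (f l) \<and>
            torus_map (e l) \<and> smooth_on UNIV (e l) \<and>
            (\<forall>s\<in>{- max_delay \<tau>..0}. torus_map (\<lambda>\<phi>. E l (\<phi>, s))) \<and>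
            smooth_on (UNIV \<times> {- max_delay \<tau>..0}) (E l)) \<and>
    (\<forall>\<phi>. f 0 \<phi> = freq T) \<and>
    (\<forall>j \<phi>. blk c j (e 0 \<phi>) = \<Gamma> j (\<phi> $ j / freq T $ j)) \<and>
    (\<forall>j \<phi>. \<forall>s\<in>{- max_delay \<tau>..0}. blk c j (E 0 (\<phi>, s)) = \<Gamma> j (\<phi> $ j / freq T $ j + s)) \<and>
    (\<forall>\<epsilon> \<phi>. trunc L \<epsilon> e \<phi> = trunc L \<epsilon> E (\<phi>, 0)) \<and>
    (\<forall>j. uniform_bigo (L + 1) (\<lambda>\<epsilon>. UNIV)
       (\<lambda>\<epsilon> \<phi>. frechet_derivative (\<lambda>\<psi>. blk c j (trunc L \<epsilon> e \<psi>)) (at \<phi>) (trunc L \<epsilon> f \<phi>)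
             - network_rhs c F G \<epsilon> j (trunc L \<epsilon> e \<phi>) (\<lambda>k. trunc L \<epsilon> E (\<phi>, - \<tau> j k)))) \<and>
    (\<forall>j. uniform_bigo (L + 1) (\<lambda>\<epsilon>. UNIV \<times> {- max_delay \<tau>..0})
       (\<lambda>\<epsilon> (\<phi>, s). frechet_derivative (\<lambda>\<psi>. blk c j (trunc L \<epsilon> E (\<psi>, s))) (at \<phi>) (trunc L \<epsilon> f \<phi>)
             - vector_derivative (\<lambda>r. blk c j (trunc L \<epsilon> E (\<phi>, r))) (at s within {- max_delay \<tau>..0}))) \<and>
    \<comment> \<open>in particular: solutions of the truncated phase dynamics are mapped to
        (state, history) pairs of solutions of the delay equation, up to the same order\<close>
    (\<forall>j. uniform_bigo (L + 1) (\<lambda>\<epsilon>. trajectories (trunc L \<epsilon> f))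
       (\<lambda>\<epsilon> (\<phi>, t). vector_derivative (\<lambda>r. blk c j (trunc L \<epsilon> e (\<phi> r))) (at t)
             - network_rhs c F G \<epsilon> j (trunc L \<epsilon> e (\<phi> t)) (\<lambda>k. trunc L \<epsilon> e (\<phi> (t - \<tau> j k))))) \<and>
    uniform_bigo (L + 1) (\<lambda>\<epsilon>. trajectories (trunc L \<epsilon> f) \<times> {- max_delay \<tau>..0})
       (\<lambda>\<epsilon> ((\<phi>, t), s). trunc L \<epsilon> E (\<phi> t, s) - trunc L \<epsilon> e (\<phi> (t + s)))"
proof -
  interpret delay_network c F G \<tau> \<Gamma> T
    by unfold_locales (fact F_range F_smooth G_range G_smooth delay_pos periodic hyperbolic)+
  obtain f E \<rho> \<sigma> where sol: "order_solution L f E \<rho> \<sigma>" using order_solution_exists by blast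
  \<comment> \<open>With this choice the boundary condition holds exactly at each order, hence for
    the truncations.\<close>
  define e where "e l \<phi> = E l (\<phi>, 0)" for l \<phi>
  note f = f_sol[OF sol] and E = E_sol[OF sol] and tE = smooth_truncE[OF sol]
  have te: "trunc L \<epsilon> e \<phi> = trunc L \<epsilon> E (\<phi>, 0)" for \<epsilon> \<phi> by (simp add: trunc_def e_def)
  have slice: "smooth (\<lambda>\<phi>. E l (\<phi>, s))" for l s
    by (intro smooth_compose[OF E(1)] smooth_Pair smooth_id smooth_const)
  have torus: "torus_map (\<lambda>\<phi>. E l (\<phi>, s))" for l s
    using E(2)[of _ l] by (simp add: torus_map_def period_def)
  have D_blk: "D (\<lambda>\<psi>. blk c j (trunc L \<epsilon> E (\<psi>, s))) \<phi> v = blk c j (D (trunc L \<epsilon> E) (\<phi>, s) (v, 0))" for j \<epsilon> s \<phi> v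
  proof -
    have "smooth (\<lambda>\<psi>. trunc L \<epsilon> E (\<psi>, s))" by (intro smooth_compose[OF tE] smooth_Pair smooth_id smooth_const)
    then show ?thesis by (simp add: D_linear_compose[OF _ linear_blk] D_slice[OF tE])
  qed
  \<comment> \<open>The history interval is nondegenerate, so the derivative within it is unique
    even at the endpoints.\<close>
  have delay: "0 < max_delay \<tau>" using delay_pos max_delay_ge[of \<tau>] by (metis less_le_trans)
  show ?thesis
  proof (intro exI[of _ f] exI[of _ e] exI[of _ E] conjI allI impI ballI)
    fix l s
    show "torus_map (f l)" "smooth (f l)" by (rule f)+
    show "torus_map (e l)" "smooth (e l)" using torus slice by (simp_all add: e_def[abs_def])
    show "torus_map (\<lambda>\<phi>. E l (\<phi>, s))" by (rule torus)
    show "smooth_on (UNIV \<times> {- max_delay \<tau>..0}) (E l)" by (rule smooth_on_subset[OF E(1) subset_UNIV])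
  next
    fix j \<phi> s
    show "f 0 \<phi> = freq T" by (simp add: f \<omega>_def)
    show "blk c j (e 0 \<phi>) = \<Gamma> j (\<phi> $ j / freq T $ j)"
      by (simp add: e_def E blk_E0 phase_def \<omega>_def)
    show "blk c j (E 0 (\<phi>, s)) = \<Gamma> j (\<phi> $ j / freq T $ j + s)"
      by (simp add: E blk_E0 phase_def \<omega>_def)
  next
    fix \<epsilon> \<phi> show "trunc L \<epsilon> e \<phi> = trunc L \<epsilon> E (\<phi>, 0)" by (rule te)
  next
    fix j
    obtain C where C: "\<And>\<epsilon> \<phi> j. \<bar>\<epsilon>\<bar> \<le> 1 \<Longrightarrow> norm (blk c j (D (trunc L \<epsilon> E) (\<phi>, 0) (trunc L \<epsilon> f \<phi>, 0))
      - network_rhs c F G \<epsilon> j (trunc L \<epsilon> E (\<phi>, 0)) (\<lambda>k. trunc L \<epsilon> E (\<phi>, - \<tau> j k))) \<le> C * \<bar>\<epsilon>\<bar> ^ (L + 1)"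
      using state_equation[OF sol] by blast
    show "uniform_bigo (L + 1) (\<lambda>\<epsilon>. UNIV)
       (\<lambda>\<epsilon> \<phi>. frechet_derivative (\<lambda>\<psi>. blk c j (trunc L \<epsilon> e \<psi>)) (at \<phi>) (trunc L \<epsilon> f \<phi>)
             - network_rhs c F G \<epsilon> j (trunc L \<epsilon> e \<phi>) (\<lambda>k. trunc L \<epsilon> E (\<phi>, - \<tau> j k)))"
      unfolding te D_blk by (rule uniform_bigoI[OF C])
  next
    fix j
    obtain C where C: "C \<ge> 0" "\<And>\<epsilon> \<phi> s. \<bar>\<epsilon>\<bar> \<le> 1 \<Longrightarrow> s \<in> {- max_delay \<tau>..0} \<Longrightarrow>
      norm (D (trunc L \<epsilon> E) (\<phi>, s) (trunc L \<epsilon> f \<phi>, - 1)) \<le> C * \<bar>\<epsilon>\<bar> ^ (L + 1)"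
      using history_equation[OF sol] by metis
    show "uniform_bigo (L + 1) (\<lambda>\<epsilon>. UNIV \<times> {- max_delay \<tau>..0})
       (\<lambda>\<epsilon> (\<phi>, s). frechet_derivative (\<lambda>\<psi>. blk c j (trunc L \<epsilon> E (\<psi>, s))) (at \<phi>) (trunc L \<epsilon> f \<phi>)
             - vector_derivative (\<lambda>r. blk c j (trunc L \<epsilon> E (\<phi>, r))) (at s within {- max_delay \<tau>..0}))"
    proof (rule uniform_bigoI, clarify)
      fix \<epsilon> :: real and \<phi> :: "real^'m" and s assume \<epsilon>: "\<bar>\<epsilon>\<bar> \<le> 1" and s: "s \<in> {- max_delay \<tau>..0}"
      have "((\<lambda>r. (\<phi>, r)) has_vector_derivative (0, 1)) (at s)"
        by (intro has_vector_derivative_Pair) (auto intro!: derivative_eq_intros)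
      from smooth_D_curve[OF tE this]
      have "((\<lambda>r. blk c j (trunc L \<epsilon> E (\<phi>, r))) has_vector_derivative blk c j (D (trunc L \<epsilon> E) (\<phi>, s) (0, 1))) (at s)"
        by (rule bounded_linear.has_vector_derivative[OF linear_blk[THEN linear_conv_bounded_linear[THEN iffD1]]])
      then have "vector_derivative (\<lambda>r. blk c j (trunc L \<epsilon> E (\<phi>, r))) (at s within {- max_delay \<tau>..0})
          = blk c j (D (trunc L \<epsilon> E) (\<phi>, s) (0, 1))"
        using vector_derivative_within_closed_interval[OF _ s has_vector_derivative_at_within] delay by simp
      moreover have "D (trunc L \<epsilon> E) (\<phi>, s) (trunc L \<epsilon> f \<phi>, - 1) =
          D (trunc L \<epsilon> E) (\<phi>, s) (trunc L \<epsilon> f \<phi>, 0) - D (trunc L \<epsilon> E) (\<phi>, s) (0, 1)"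
        using linear_diff[OF linear_D[OF tE], of \<epsilon> "(\<phi>, s)" "(trunc L \<epsilon> f \<phi>, 0)" "(0, 1)"] by simp
      ultimately have "D (\<lambda>\<psi>. blk c j (trunc L \<epsilon> E (\<psi>, s))) \<phi> (trunc L \<epsilon> f \<phi>)
          - vector_derivative (\<lambda>r. blk c j (trunc L \<epsilon> E (\<phi>, r))) (at s within {- max_delay \<tau>..0})
          = blk c j (D (trunc L \<epsilon> E) (\<phi>, s) (trunc L \<epsilon> f \<phi>, - 1))"
        by (simp add: D_blk linear_diff[OF linear_blk])
      then show "norm (D (\<lambda>\<psi>. blk c j (trunc L \<epsilon> E (\<psi>, s))) \<phi> (trunc L \<epsilon> f \<phi>)
          - vector_derivative (\<lambda>r. blk c j (trunc L \<epsilon> E (\<phi>, r))) (at s within {- max_delay \<tau>..0})) \<le> C * \<bar>\<epsilon>\<bar> ^ (L + 1)"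
        using order.trans[OF norm_blk_le C(2)[OF \<epsilon> s]] by simp
    qed
  next
    fix j
    obtain C where C: "\<And>\<epsilon> \<phi> t j. \<bar>\<epsilon>\<bar> \<le> 1 \<Longrightarrow> (\<phi>, t) \<in> trajectories (trunc L \<epsilon> f) \<Longrightarrow>
      norm (blk c j (D (trunc L \<epsilon> E) (\<phi> t, 0) (trunc L \<epsilon> f (\<phi> t), 0))
        - network_rhs c F G \<epsilon> j (trunc L \<epsilon> E (\<phi> t, 0)) (\<lambda>k. trunc L \<epsilon> E (\<phi> (t - \<tau> j k), 0))) \<le> C * \<bar>\<epsilon>\<bar> ^ (L + 1)"
      using state_along_trajectory[OF sol] by blast
    show "uniform_bigo (L + 1) (\<lambda>\<epsilon>. trajectories (trunc L \<epsilon> f))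
       (\<lambda>\<epsilon> (\<phi>, t). vector_derivative (\<lambda>r. blk c j (trunc L \<epsilon> e (\<phi> r))) (at t)
             - network_rhs c F G \<epsilon> j (trunc L \<epsilon> e (\<phi> t)) (\<lambda>k. trunc L \<epsilon> e (\<phi> (t - \<tau> j k))))"
      unfolding te
    proof (rule uniform_bigoI, clarify)
      fix \<epsilon> :: real and \<phi> :: "real \<Rightarrow> real^'m" and t assume \<epsilon>: "\<bar>\<epsilon>\<bar> \<le> 1" and traj: "(\<phi>, t) \<in> trajectories (trunc L \<epsilon> f)"
      have "((\<lambda>r. (\<phi> r, 0)) has_vector_derivative (trunc L \<epsilon> f (\<phi> t), 0)) (at t)"
        using traj by (intro has_vector_derivative_Pair) (auto simp: trajectories_def)
      from smooth_D_curve[OF tE this]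
      have "((\<lambda>r. blk c j (trunc L \<epsilon> E (\<phi> r, 0))) has_vector_derivative
          blk c j (D (trunc L \<epsilon> E) (\<phi> t, 0) (trunc L \<epsilon> f (\<phi> t), 0))) (at t)"
        by (rule bounded_linear.has_vector_derivative[OF linear_blk[THEN linear_conv_bounded_linear[THEN iffD1]]])
      from vector_derivative_at[OF this] C[OF \<epsilon> traj, of j]
      show "norm (vector_derivative (\<lambda>r. blk c j (trunc L \<epsilon> E (\<phi> r, 0))) (at t)
          - network_rhs c F G \<epsilon> j (trunc L \<epsilon> E (\<phi> t, 0)) (\<lambda>k. trunc L \<epsilon> E (\<phi> (t - \<tau> j k), 0))) \<le> C * \<bar>\<epsilon>\<bar> ^ (L + 1)"
        by simp
    qed
  next
    obtain C where C: "\<And>\<epsilon> \<phi> t s. \<bar>\<epsilon>\<bar> \<le> 1 \<Longrightarrow> (\<phi>, t) \<in> trajectories (trunc L \<epsilon> f) \<Longrightarrow> s \<in> {- max_delay \<tau>..0} \<Longrightarrow>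
      norm (trunc L \<epsilon> E (\<phi> t, s) - trunc L \<epsilon> E (\<phi> (t + s), 0)) \<le> C * \<bar>\<epsilon>\<bar> ^ (L + 1)"
      using history_along_trajectory[OF sol] by blast
    show "uniform_bigo (L + 1) (\<lambda>\<epsilon>. trajectories (trunc L \<epsilon> f) \<times> {- max_delay \<tau>..0})
       (\<lambda>\<epsilon> ((\<phi>, t), s). trunc L \<epsilon> E (\<phi> t, s) - trunc L \<epsilon> e (\<phi> (t + s)))"
      unfolding te by (rule uniform_bigoI[where C = C], clarify) (rule C)
  qed
qed

end
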